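(* For any generalised locus configuration $\mathcal A$ in the plane $V=\mathbb C^2$ (i.e. a locus configuration of type $W$ for some finite Coxeter group $W$ acting on $\mathbb C^2$), and an arbitrary parameter $\omega$, the operator $$L_{\mathcal A}^\omega=\Delta-\omega^2x^2-\sum_{\alpha\in\mathcal A_+}\frac{k_\alpha(k_\alpha+1)(\alpha,\alpha)}{(\alpha,x)^2}$$ is superintegrable.
   Context: $V=\mathbb C^2$ carries the standard symmetric bilinear form $(\cdot,\cdot)$, $x^2=(x,x)$, $\Delta$ the Laplacian. For non-isotropic $\alpha$, $s_\alpha(x)=x-2\frac{(\alpha,x)}{(\alpha,\alpha)}\alpha$. $W$ is a finite Coxeter group acting on $V$, generated by orthogonal reflections (possibly trivial), with $W$-invariant root system $R=R_+\cup(-R_+)$ (one normal in $R_+$ per reflection). A configuration $(\mathcal A,k)$ is a finite set $\mathcal A=\mathcal A_+\cup(-\mathcal A_+)$ of non-isotropic vectors, those in $\mathcal A_+$ pairwise nonparallel, with multiplicities $k_\alpha=k_{-\alpha}\in\mathbb C$; $u_{\mathcal A}=\sum_{\alpha\in\mathcal A_+}\frac{k_\alpha(k_\alpha+1)(\alpha,\alpha)}{(\alpha,x)^2}$. It is a locus configuration of type $W$ if: (i) $R\subset\mathcal A$, and $\mathcal A$ and $k$ are $W$-invariant; (ii) for every $\alpha\in\mathcal A\setminus R$, $k_\alpha\in\mathbb Z_{\ge0}$ and $u_{\mathcal A}(x)-u_{\mathcal A}(s_\alpha x)$ is divisible by $(\alpha,x)^{2k_\alpha}$ (i.e. the quotient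 is regular at a generic point of the hyperplane $(\alpha,x)=0$). Superintegrable (in two dimensions, maximally superintegrable): there are, besides $L=L_{\mathcal A}^\omega$, two further differential operators with rational coefficients, each commuting with $L$ (but not necessarily with each other), such that the principal symbols of the three operators are algebraically independent. *)

theory Defs
  imports
    "HOL-Analysis.Analysis"
    "HOL-Computational_Algebra.Computational_Algebra"
    "HOL-Library.Poly_Mapping"
    "HOL-Algebra.Bij"
    "HOL-Algebra.Generated_Groups"
begin

section \<open>The field of rational functions on the plane\<close>

text \<open>
  Polynomials in \<open>x\<^sub>1, x\<^sub>2\<close> are represented as iterated univariate polynomials: the
  inner variable is \<open>x\<^sub>1\<close>, the outer one is \<open>x\<^sub>2\<close>.
\<close>

type_synonym plane = "complex ^ 2"
type_synonym poly2 = "complex poly poly"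
type_synonym ratfun = "poly2 fract"

definition eval2 :: "poly2 \<Rightarrow> plane \<Rightarrow> complex" where
  "eval2 p v = poly (poly p [:v $ 2:]) (v $ 1)"

definition rconst :: "complex \<Rightarrow> ratfun" where
  "rconst c = to_fract [:[:c:]:]"

definition dpoly1 :: "poly2 \<Rightarrow> poly2" where
  "dpoly1 = map_poly pderiv"

definition dpoly2 :: "poly2 \<Rightarrow> poly2" where
  "dpoly2 = pderiv"

lemma dpoly1_mult: "dpoly1 (p * q) = dpoly1 p * q + p * dpoly1 q"
proof (rule poly_eqI)
  fix n
  have c: "coeff (dpoly1 r) i = pderiv (coeff r i)" for r i
    by (simp add: dpoly1_def coeff_map_poly)
  have "pderiv (\<Sum>i\<in>I. f i) = (\<Sum>i\<in>I. pderiv (f i))"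
    for f :: "nat \<Rightarrow> complex poly" and I
    by (induction I rule: infinite_finite_induct) (simp_all add: pderiv_add)
  then show "coeff (dpoly1 (p * q)) n = coeff (dpoly1 p * q + p * dpoly1 q) n"
    by (simp add: c coeff_mult pderiv_mult sum.distrib [symmetric])
      (simp add: ac_simps)
qed

lemma dpoly2_mult: "dpoly2 (p * q) = dpoly2 p * q + p * dpoly2 q"
  by (simp add: dpoly2_def pderiv_mult algebra_simps)

text \<open>
  The extension of a derivation to fractions by the quotient rule; the description is meaningful
  only if \<open>d\<close> obeys the Leibniz rule (\<open>fract_deriv_Fract\<close> below).
\<close>

definition fract_deriv :: "('a \<Rightarrow> 'a) \<Rightarrow> 'a::idom fract \<Rightarrow> 'a fract" where
  "fract_deriv d f =
     (THE g. \<exists>a b. b \<noteq> 0 \<and> f = Fract a b \<and> g = Fract (d a * b - a * d b) (b * b))"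

lemma fract_deriv_Fract:
  fixes d :: "'a::idom \<Rightarrow> 'a"
  assumes d: "\<And>p q. d (p * q) = d p * q + p * d q" and b: "b \<noteq> 0"
  shows "fract_deriv d (Fract a b) = Fract (d a * b - a * d b) (b * b)"
  unfolding fract_deriv_def
proof (rule the_equality)
  show "\<exists>a' b'. b' \<noteq> 0 \<and> Fract a b = Fract a' b' \<and>
      Fract (d a * b - a * d b) (b * b) = Fract (d a' * b' - a' * d b') (b' * b')"
    using b by blast
next
  fix g assume "\<exists>a' b'. b' \<noteq> 0 \<and> Fract a b = Fract a' b' \<and>
      g = Fract (d a' * b' - a' * d b') (b' * b')"
  then obtain a' b' where b': "b' \<noteq> 0" and f: "Fract a b = Fract a' b'"
    and g: "g = Fract (d a' * b' - a' * d b') (b' * b')" by blast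
  have eq: "a * b' = a' * b" using f b b' by (simp add: eq_fract)
  then have e: "d a * b' + a * d b' = d a' * b + a' * d b"
    using d[of a b'] d[of a' b] by simp
  have "(d a * b - a * d b) * (b' * b') - (d a' * b' - a' * d b') * (b * b)
      = b * b' * ((d a * b' + a * d b') - (d a' * b + a' * d b))
        - (b' * d b + b * d b') * (a * b' - a' * b)"
    by (simp add: algebra_simps)
  then have "(d a' * b' - a' * d b') * (b * b) = (d a * b - a * d b) * (b' * b')"
    using e eq by simp
  then show "g = Fract (d a * b - a * d b) (b * b)"
    using b b' g by (simp add: eq_fract)
qed

definition pd1 :: "ratfun \<Rightarrow> ratfun" where
  "pd1 = fract_deriv dpoly1"

definition pd2 :: "ratfun \<Rightarrow> ratfun" where
  "pd2 = fract_deriv dpoly2"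

lemma pd1_Fract: "b \<noteq> 0 \<Longrightarrow> pd1 (Fract a b) = Fract (dpoly1 a * b - a * dpoly1 b) (b * b)"
  by (simp add: pd1_def fract_deriv_Fract dpoly1_mult)

lemma pd2_Fract: "b \<noteq> 0 \<Longrightarrow> pd2 (Fract a b) = Fract (dpoly2 a * b - a * dpoly2 b) (b * b)"
  by (simp add: pd2_def fract_deriv_Fract dpoly2_mult)

section \<open>Bilinear form, reflections and reflection groups\<close>

text \<open>
  The form and the reflections are defined over any field, so that they make sense both on the
  plane itself and at its generic point \<open>(x\<^sub>1, x\<^sub>2)\<close>, which has coordinates in the field of
  rational functions.  The form is bilinear, not Hermitian.
\<close>

definition bil :: "'a::comm_ring_1 ^ 2 \<Rightarrow> 'a ^ 2 \<Rightarrow> 'a" where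
  "bil x y = (\<Sum>i\<in>UNIV. x $ i * y $ i)"

definition reflection :: "'a::field ^ 2 \<Rightarrow> 'a ^ 2 \<Rightarrow> 'a ^ 2" where
  "reflection \<alpha> x = x - (2 * bil \<alpha> x / bil \<alpha> \<alpha>) *s \<alpha>"

definition emb :: "plane \<Rightarrow> ratfun ^ 2" where
  "emb v = (\<chi> i. rconst (v $ i))"

definition gen_pt :: "ratfun ^ 2" where
  "gen_pt = (\<chi> i. if i = 1 then to_fract [:[:0, 1:]:] else to_fract [:0, 1:])"

definition is_reflection :: "(plane \<Rightarrow> plane) \<Rightarrow> bool" where
  "is_reflection s \<longleftrightarrow> (\<exists>\<alpha>. bil \<alpha> \<alpha> \<noteq> 0 \<and> s = reflection \<alpha>)"

text \<open>
  Finite groups generated by orthogonal reflections; since a finite subgroup of the complex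
  orthogonal group is conjugate to a real one, these are exactly the finite Coxeter groups acting
  on the plane by orthogonal reflections.  The trivial group is included.
\<close>

definition reflection_group :: "(plane \<Rightarrow> plane) set \<Rightarrow> bool" where
  "reflection_group W \<longleftrightarrow>
     finite W \<and> W = generate (BijGroup UNIV) {s \<in> W. is_reflection s}"

definition root_system :: "(plane \<Rightarrow> plane) set \<Rightarrow> plane set \<Rightarrow> bool" where
  "root_system W R \<longleftrightarrow>
     (\<exists>Rp. R = Rp \<union> uminus ` Rp \<and>
        (\<forall>\<alpha>\<in>Rp. bil \<alpha> \<alpha> \<noteq> 0 \<and> reflection \<alpha> \<in> W) \<and>
        (\<forall>s\<in>W. is_reflection s \<longrightarrow> (\<exists>!\<alpha>. \<alpha> \<in> Rp \<and> s = reflection \<alpha>))) \<and>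
     (\<forall>w\<in>W. w ` R = R)"

section \<open>Locus configurations\<close>

text \<open>
  A configuration is given by its positive half \<open>Ap\<close>; the values of \<open>k\<close> outside
  \<open>Ap \<union> uminus ` Ap\<close> are irrelevant.
\<close>

definition full :: "plane set \<Rightarrow> plane set" where
  "full Ap = Ap \<union> uminus ` Ap"

definition configuration :: "plane set \<Rightarrow> (plane \<Rightarrow> complex) \<Rightarrow> bool" where
  "configuration Ap k \<longleftrightarrow>
     finite Ap \<and>
     (\<forall>\<alpha>\<in>Ap. bil \<alpha> \<alpha> \<noteq> 0) \<and>
     (\<forall>\<alpha>\<in>Ap. \<forall>\<beta>\<in>Ap. \<alpha> \<noteq> \<beta> \<longrightarrow> (\<nexists>c. \<beta> = c *s \<alpha>)) \<and>
     (\<forall>\<alpha>\<in>full Ap. k (- \<alpha>) = k \<alpha>)"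

definition potential :: "plane set \<Rightarrow> (plane \<Rightarrow> complex) \<Rightarrow> ratfun ^ 2 \<Rightarrow> ratfun" where
  "potential Ap k x =
     (\<Sum>\<alpha>\<in>Ap. rconst (k \<alpha> * (k \<alpha> + 1) * bil \<alpha> \<alpha>) / (bil (emb \<alpha>) x)\<^sup>2)"

text \<open>
  Regularity at a generic point of the line \<open>(\<alpha>, x) = 0\<close>: some representation of the rational
  function as a fraction has a denominator that does not vanish identically on that line.
\<close>

definition regular_on_line :: "plane \<Rightarrow> ratfun \<Rightarrow> bool" where
  "regular_on_line \<alpha> f \<longleftrightarrow>
     (\<exists>p q. f = Fract p q \<and> (\<exists>v. bil \<alpha> v = 0 \<and> eval2 q v \<noteq> 0))"

definition locus_configuration ::
  "(plane \<Rightarrow> plane) set \<Rightarrow> plane set \<Rightarrow> plane set \<Rightarrow> (plane \<Rightarrow> complex) \<Rightarrow> bool" where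
  "locus_configuration W R Ap k \<longleftrightarrow>
     configuration Ap k \<and>
     R \<subseteq> full Ap \<and>
     (\<forall>w\<in>W. w ` full Ap = full Ap \<and> (\<forall>\<alpha>\<in>full Ap. k (w \<alpha>) = k \<alpha>)) \<and>
     (\<forall>\<alpha>\<in>full Ap - R. \<exists>m::nat. k \<alpha> = of_nat m \<and>
        regular_on_line \<alpha>
          ((potential Ap k gen_pt - potential Ap k (reflection (emb \<alpha>) gen_pt))
             / (bil (emb \<alpha>) gen_pt) ^ (2 * m)))"

section \<open>Differential operators with rational coefficients\<close>

text \<open>
  The finitely supported family \<open>a\<close> stands for the operator
  \<open>\<Sum> a(i,j) \<partial>\<^sub>1\<^sup>i \<partial>\<^sub>2\<^sup>j\<close>.  Such an operator is determined by its action on rational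
  functions, so commutation can be tested on that action.

  Polynomials in the dual variables \<open>\<xi>\<^sub>1, \<xi>\<^sub>2\<close> over the field of rational functions are
  also finitely supported families, but with the (commutative) convolution product of
  \<^type>\<open>poly_mapping\<close>.  That product is used for symbols only; it is not the composition of
  operators.
\<close>

type_synonym diffop = "(nat \<times> nat) \<Rightarrow>\<^sub>0 ratfun"
type_synonym symb = "(nat \<times> nat) \<Rightarrow>\<^sub>0 ratfun"

definition act :: "diffop \<Rightarrow> ratfun \<Rightarrow> ratfun" where
  "act D f = (\<Sum>(i, j)\<in>Poly_Mapping.keys D. Poly_Mapping.lookup D (i, j) * (pd1 ^^ i) ((pd2 ^^ j) f))"

definition commute :: "diffop \<Rightarrow> diffop \<Rightarrow> bool" where
  "commute D E \<longleftrightarrow> act D \<circ> act E = act E \<circ> act D"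

definition diffop_order :: "diffop \<Rightarrow> nat" where
  "diffop_order D = Max ((\<lambda>(i, j). i + j) ` Poly_Mapping.keys D)"

definition principal_symbol :: "diffop \<Rightarrow> symb" where
  "principal_symbol D =
     (\<Sum>(i, j)\<in>{(i, j)\<in>Poly_Mapping.keys D. i + j = diffop_order D}.
        Poly_Mapping.single (i, j) (Poly_Mapping.lookup D (i, j)))"

text \<open>Algebraic independence over the complex numbers; \<open>P\<close> is a polynomial in three variables.\<close>

definition alg_indep3 :: "symb \<Rightarrow> symb \<Rightarrow> symb \<Rightarrow> bool" where
  "alg_indep3 a b c \<longleftrightarrow>
     (\<forall>P :: (nat \<times> nat \<times> nat) \<Rightarrow>\<^sub>0 complex.
        (\<Sum>(i, j, l)\<in>Poly_Mapping.keys P.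
           Poly_Mapping.single 0 (rconst (Poly_Mapping.lookup P (i, j, l))) * a ^ i * b ^ j * c ^ l) = 0
        \<longrightarrow> P = 0)"

definition superintegrable :: "diffop \<Rightarrow> bool" where
  "superintegrable L \<longleftrightarrow>
     (\<exists>P Q. commute P L \<and> commute Q L \<and>
        alg_indep3 (principal_symbol L) (principal_symbol P) (principal_symbol Q))"

definition calogero_moser ::
  "plane set \<Rightarrow> (plane \<Rightarrow> complex) \<Rightarrow> complex \<Rightarrow> diffop" where
  "calogero_moser Ap k \<omega> =
     Poly_Mapping.single (2, 0) 1 + Poly_Mapping.single (0, 2) 1
     - Poly_Mapping.single (0, 0)
         (rconst (\<omega>\<^sup>2) * bil gen_pt gen_pt + potential Ap k gen_pt)"

lemma act_calogero_moser:
  "act (calogero_moser Ap k \<omega>) f =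
     pd1 (pd1 f) + pd2 (pd2 f)
     - (rconst (\<omega>\<^sup>2) * bil gen_pt gen_pt + potential Ap k gen_pt) * f"
proof -
  let ?D = "calogero_moser Ap k \<omega>"
  let ?S = "{(2, 0), (0, 2), (0, 0)} :: (nat \<times> nat) set"
  have "Poly_Mapping.keys ?D \<subseteq> ?S"
    by (auto simp: calogero_moser_def in_keys_iff lookup_add lookup_minus lookup_single when_def
        split: if_splits)
  then have "act ?D f = (\<Sum>(i, j)\<in>?S. Poly_Mapping.lookup ?D (i, j) * (pd1 ^^ i) ((pd2 ^^ j) f))"
    unfolding act_def by (intro sum.mono_neutral_left) (auto simp: in_keys_iff)
  then show ?thesis
    by (simp add: calogero_moser_def lookup_add lookup_minus lookup_single when_def
        numeral_2_eq_2 algebra_simps)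
qed

end

theory Submission
  imports Defs
begin

text \<open>
  Write \<open>L\<close> for the operator with \<open>\<omega> = 0\<close> and \<open>u\<close> for its potential.  Since \<open>u\<close> is homogeneous of
  degree \<open>-2\<close>, the angular part \<open>(x\<^sub>1 \<partial>\<^sub>2 - x\<^sub>2 \<partial>\<^sub>1)\<^sup>2 - x\<^sup>2 u\<close> commutes with
  \<open>L - \<omega>\<^sup>2 x\<^sup>2\<close>.  For the other integral take a reflection invariant polynomial \<open>g\<close>, homogeneous
  of even degree \<open>N\<close> and vanishing to high order on the lines of the configuration, and consider
  the rungs \<open>X n = ad(L)\<^sup>n g\<close>, of degree \<open>N - 2 n\<close> and order at most \<open>n\<close>.

  The poles of the principal symbols of all rungs are bounded independently of \<open>n\<close>: at a line outside
  \<open>R\<close> the rungs preserve the quasi-invariant functions, by the locus condition; at a mirror in \<open>R\<close>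
  they lie in an algebra of operators whose symbols are regular, a local form of the spherical
  Cherednik algebra, whatever the multiplicity.  A symbol of order at most \<open>n\<close> then has degree at
  least \<open>- n\<close> up to a constant, so \<open>X n = 0\<close> for large \<open>n\<close>.  The last non-zero rung commutes with \<open>L\<close>, hence
  its symbol is polynomial and has non-negative degree in \<open>x\<close>, which leaves only the rung \<open>N\<close>.
  So \<open>L\<close> and \<open>x\<^sup>2\<close> generate an action of \<open>sl\<^sub>2\<close> on the span of \<open>X 0, \<dots>, X N\<close>, and for even \<open>N\<close> the
  element \<open>L - \<omega>\<^sup>2 x\<^sup>2\<close> kills a vector with leading term \<open>X N\<close>, whose symbol is a multiple of
  \<open>g(\<xi>)\<close>.  Finally \<open>\<xi>\<^sup>2\<close>, \<open>(x\<^sub>1 \<xi>\<^sub>2 - x\<^sub>2 \<xi>\<^sub>1)\<^sup>2\<close> and \<open>g(\<xi>)\<close> are algebraically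
  independent, because \<open>g\<close> does not vanish on isotropic vectors.
\<close>

section \<open>Rational functions on the plane\<close>

text \<open>Near a mirror in \<open>R\<close> with an arbitrary complex multiplicity k, the
  functions that \<open>L\<close> preserves are even functions times the power -k of the equation of
  the mirror. That algebra is filtered by a weight, and ad(L) raises the weight by 1. The weight
  only bounds the order from above, whereas homogeneity has to be exploited at the true order, which
  may be smaller. Hence normal forms are needed: they show that an element whose order is below its
  weight already has smaller weight (\<open>filt_drop\<close>). Operators are treated as
  endomorphisms of the function field, without coefficients. Symbol coefficients are extracted by
  repeated commutators with linear forms, which makes it harmless to pass between \<open>e1\<close>,
  \<open>e2\<close> and a frame adapted to a mirror.\<close>

instance fract :: ("{idom,ring_char_0}") ring_char_0
proof
  show "inj (of_nat :: nat \<Rightarrow> 'a fract)"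
    by (rule injI) (simp add: of_nat_fract eq_fract)
qed

instance fract :: ("{idom,ring_char_0}") field_char_0 ..

lemma eval2_simps [simp]:
  "eval2 0 v = 0" "eval2 1 v = 1"
  "eval2 (p + q) v = eval2 p v + eval2 q v" "eval2 (p - q) v = eval2 p v - eval2 q v"
  "eval2 (- p) v = - eval2 p v" "eval2 (p * q) v = eval2 p v * eval2 q v"
  "eval2 [:[:c:]:] v = c" "eval2 [:[:0, c:]:] v = c * v $ 1" "eval2 [:0, [:c:]:] v = c * v $ 2"
  "eval2 [:0, 1:] v = v $ 2"
  by (simp_all add: eval2_def)

lemma poly2_induct:
  fixes p :: poly2
  assumes const: "\<And>c. P [:[:c:]:]" and x1: "P [:[:0, 1:]:]" and x2: "P [:0, 1:]"
    and add: "\<And>p q. P p \<Longrightarrow> P q \<Longrightarrow> P (p + q)" and mult: "\<And>p q. P p \<Longrightarrow> P q \<Longrightarrow> P (p * q)"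
  shows "P p"
proof -
  have inner: "P [:a:]" for a :: "complex poly"
  proof (induction a)
    case 0
    show ?case using const[of 0] by simp
  next
    case (pCons c a)
    have "[:pCons c a:] = [:[:c:]:] + [:[:0, 1:]:] * [:a:]" by simp
    then show ?case using add mult const x1 pCons.IH by metis
  qed
  show ?thesis
  proof (induction p)
    case 0
    show ?case using const[of 0] by simp
  next
    case (pCons a p)
    have "pCons a p = [:a:] + [:0, 1:] * p" by simp
    then show ?case using add mult inner x2 pCons.IH by metis
  qed
qed

lemma eval2_eqI:
  assumes "\<And>v. eval2 p v = eval2 q v"
  shows "p = q"
proof -
  define r where "r = p - q"
  have r: "poly (poly r [:b:]) a = 0" for a b
    using assms[of "vector [a, b]"] by (simp add: r_def eval2_def)
  have "poly r [:b:] = 0" for b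
    using r[of b] by (metis poly_all_0_iff_0)
  then have "range (\<lambda>b::complex. [:b:]) \<subseteq> {x. poly r x = 0}" by auto
  moreover have "infinite (range (\<lambda>b::complex. [:b:]))"
    using infinite_UNIV_char_0 by (subst finite_image_iff) (auto simp: inj_on_def)
  ultimately have "infinite {x. poly r x = 0}" using finite_subset by blast
  then have "r = 0" using poly_roots_finite by blast
  then show ?thesis by (simp add: r_def)
qed

lemma bil_eq: "bil x y = x $ 1 * y $ 1 + x $ 2 * y $ 2"
  by (simp add: bil_def UNIV_2)

lemma rconst_simps [simp]:
  "rconst 0 = 0" "rconst 1 = 1" "rconst (a + b) = rconst a + rconst b"
  "rconst (a - b) = rconst a - rconst b" "rconst (- a) = - rconst a"
  "rconst (a * b) = rconst a * rconst b"
  by (simp_all add: rconst_def flip: to_fract_add to_fract_mult to_fract_diff to_fract_uminus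
      to_fract_1 add: one_pCons)

lemma rconst_eq_iff [simp]: "rconst a = rconst b \<longleftrightarrow> a = b"
  by (simp add: rconst_def)

lemma rconst_eq_0_iff [simp]: "rconst a = 0 \<longleftrightarrow> a = 0"
  using rconst_eq_iff[of a 0] by (simp del: rconst_eq_iff)

lemma rconst_power [simp]: "rconst (a ^ n) = rconst a ^ n"
  by (induction n) simp_all

lemma rconst_of_nat [simp]: "rconst (of_nat n) = of_nat n"
  by (induction n) simp_all

lemma rconst_of_int [simp]: "rconst (of_int n) = of_int n"
  by (cases n) (simp_all flip: of_nat_Suc)

lemma rconst_numeral [simp]: "rconst (numeral n) = numeral n"
  using rconst_of_nat[of "numeral n"] by (simp del: rconst_of_nat)

lemma rconst_inverse: "rconst (inverse a) = inverse (rconst a)"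
proof (cases "a = 0")
  case False
  then have "rconst (inverse a) * rconst a = 1" by (simp flip: rconst_simps(6))
  then show ?thesis using False by (simp add: field_simps)
qed simp

lemma rconst_sum [simp]: "rconst (sum f A) = (\<Sum>x\<in>A. rconst (f x))"
  by (induction A rule: infinite_finite_induct) simp_all

lemma to_fract_power: "to_fract (p ^ n) = to_fract p ^ n"
  by (induction n) simp_all

definition linp :: "plane \<Rightarrow> poly2" where
  "linp v = [:[:0, v $ 1:], [:v $ 2:]:]"

definition lin :: "plane \<Rightarrow> ratfun" where
  "lin v = bil (emb v) gen_pt"

lemma eval2_linp [simp]: "eval2 (linp v) w = bil v w"
  by (simp add: linp_def eval2_def bil_eq algebra_simps)

lemma to_fract_linp: "to_fract (linp v) = lin v"
proof -
  have "linp v = [:[:v $ 1:]:] * [:[:0, 1:]:] + [:[:v $ 2:]:] * [:0, 1:]"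
    by (simp add: linp_def)
  then have "to_fract (linp v) = rconst (v $ 1) * to_fract [:[:0, 1:]:] + rconst (v $ 2) * to_fract [:0, 1:]"
    by (simp only: to_fract_mult to_fract_add rconst_def)
  then show ?thesis by (simp add: lin_def bil_eq emb_def gen_pt_def)
qed

lemma lin_add: "lin (v + w) = lin v + lin w"
  and lin_scale: "lin (c *s v) = rconst c * lin v"
  and lin_minus: "lin (- v) = - lin v"
  and lin_diff: "lin (v - w) = lin v - lin w"
  by (simp_all add: lin_def bil_eq emb_def algebra_simps)

lemma lin_eq_0_iff [simp]: "lin v = 0 \<longleftrightarrow> v = 0"
proof -
  have "linp v = 0 \<longleftrightarrow> v = 0" by (simp add: linp_def vec_eq_iff forall_2)
  then show ?thesis by (simp flip: to_fract_linp)
qed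

lemma lin_0 [simp]: "lin 0 = 0"
  by simp

definition poly_fn :: "ratfun \<Rightarrow> bool" where
  "poly_fn f \<longleftrightarrow> (\<exists>p. f = to_fract p)"

lemma ratfun_cases: obtains p q where "q \<noteq> 0" "f = to_fract p / to_fract (q :: poly2)"
  by (metis Fract_cases_nonzero Fract_conv_to_fract to_fract_0 div_0 one_neq_zero)

lemma coord_lin:
  "to_fract [:[:0, 1:]:] = lin (axis 1 1)" "to_fract [:0, 1:] = lin (axis 2 1)"
  by (simp_all add: lin_def bil_eq emb_def gen_pt_def axis_def)

lemma poly_fn_induct [consumes 1]:
  assumes f: "poly_fn f" and const: "\<And>c. P (rconst c)" and lin: "\<And>v. P (lin v)"
    and add: "\<And>f g. P f \<Longrightarrow> P g \<Longrightarrow> P (f + g)" and mult: "\<And>f g. P f \<Longrightarrow> P g \<Longrightarrow> P (f * g)"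
  shows "P f"
proof -
  have "P (to_fract p)" for p
    by (induction p rule: poly2_induct)
      (use const lin add mult in \<open>simp_all add: coord_lin flip: rconst_def\<close>)
  then show ?thesis using f by (auto simp: poly_fn_def)
qed

text \<open>Used for derivations and for commutation with multiplications: both are compatible with
  the field operations, so constants and linear forms decide.\<close>

lemma ratfun_induct [case_names const lin add mult inverse]:
  assumes const: "\<And>c. P (rconst c)" and lin: "\<And>v. P (lin v)"
    and add: "\<And>f g. P f \<Longrightarrow> P g \<Longrightarrow> P (f + g)" and mult: "\<And>f g. P f \<Longrightarrow> P g \<Longrightarrow> P (f * g)"
    and inv: "\<And>f. P f \<Longrightarrow> f \<noteq> 0 \<Longrightarrow> P (inverse f)"
  shows "P f"
proof -
  obtain p q where pq: "q \<noteq> 0" "f = to_fract p / to_fract q" by (rule ratfun_cases)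
  have "P (to_fract r)" for r
    by (rule poly_fn_induct[of _ P]) (use const lin add mult in \<open>auto simp: poly_fn_def\<close>)
  then show ?thesis using pq mult inv by (simp add: divide_inverse)
qed

section \<open>Derivations\<close>

lemma dpoly_add:
  "dpoly1 (p + q) = dpoly1 p + dpoly1 q" "dpoly2 (p + q) = dpoly2 p + dpoly2 q"
  by (simp_all add: dpoly1_def dpoly2_def pderiv_add poly_eq_iff coeff_map_poly)

lemma fract_deriv_derivation:
  fixes d :: "poly2 \<Rightarrow> poly2"
  assumes m: "\<And>p q. d (p * q) = d p * q + p * d q" and a: "\<And>p q. d (p + q) = d p + d q"
  shows "fract_deriv d (f + g) = fract_deriv d f + fract_deriv d g"
    and "fract_deriv d (f * g) = fract_deriv d f * g + f * fract_deriv d g"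
    and "fract_deriv d (to_fract p) = to_fract (d p)"
proof -
  obtain a b r s where *: "b \<noteq> 0" "f = Fract a b" "s \<noteq> 0" "g = Fract r s"
    by (metis Fract_cases)
  note F = fract_deriv_Fract[OF m]
  show "fract_deriv d (f + g) = fract_deriv d f + fract_deriv d g"
    "fract_deriv d (f * g) = fract_deriv d f * g + f * fract_deriv d g"
    using * by (simp_all add: F m a eq_fract algebra_simps)
  have "d 1 = 0" using m[of 1 1] by simp
  then show "fract_deriv d (to_fract p) = to_fract (d p)"
    by (simp add: to_fract_def F)
qed

text \<open>Arbitrary constant directions are allowed because the natural frame at a mirror consists
  of \<open>e\<close> and \<open>perp e\<close>.\<close>

definition der :: "plane \<Rightarrow> ratfun \<Rightarrow> ratfun" where
  "der v f = rconst (v $ 1) * pd1 f + rconst (v $ 2) * pd2 f"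

lemma der_add: "der v (f + g) = der v f + der v g"
  and der_mult: "der v (f * g) = der v f * g + f * der v g"
  by (simp_all add: der_def pd1_def pd2_def fract_deriv_derivation dpoly1_mult dpoly2_mult dpoly_add
      algebra_simps)

lemma der_to_fract: "der v (to_fract p) = to_fract ([:[:v $ 1:]:] * dpoly1 p + [:[:v $ 2:]:] * dpoly2 p)"
  by (simp add: der_def pd1_def pd2_def fract_deriv_derivation dpoly1_mult dpoly2_mult dpoly_add
      rconst_def del: mult_pCons_left)

lemma der_rconst [simp]: "der v (rconst c) = 0"
  by (simp add: rconst_def der_to_fract dpoly1_def dpoly2_def map_poly_pCons pderiv_pCons)

lemma der_lin [simp]: "der v (lin w) = rconst (bil v w)"
  by (simp add: der_to_fract dpoly1_def dpoly2_def linp_def map_poly_pCons pderiv_pCons bil_eq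
      rconst_def flip: to_fract_linp)

lemma der_0 [simp]: "der v 0 = 0" using der_rconst[of v 0] by simp
lemma der_1 [simp]: "der v 1 = 0" using der_rconst[of v 1] by simp
lemma der_minus: "der v (- f) = - der v f"
  using der_add[of v f "- f"] by (simp add: eq_neg_iff_add_eq_0 add.commute)
lemma der_diff: "der v (f - g) = der v f - der v g"
  using der_add[of v f "- g"] by (simp add: der_minus)
lemma der_rconst_mult: "der v (rconst c * f) = rconst c * der v f"
  by (simp add: der_mult)
lemma der_of_nat [simp]: "der v (of_nat n) = 0"
  using der_rconst[of v "of_nat n"] by (simp del: der_rconst)
lemma der_numeral [simp]: "der v (numeral n) = 0"
  using der_rconst[of v "numeral n"] by (simp del: der_rconst)

lemma der_inverse: "der v (inverse f) = - der v f / f\<^sup>2"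
proof (cases "f = 0")
  case False
  then have "der v f * inverse f + f * der v (inverse f) = 0" by (simp flip: der_mult)
  then have "f * der v (inverse f) = - (der v f / f)"
    by (simp add: add_eq_0_iff divide_inverse)
  then show ?thesis using False by (simp add: field_simps power2_eq_square)
qed simp

lemma der_divide:
  assumes "g \<noteq> 0"
  shows "der v (f / g) = (der v f * g - f * der v g) / (g * g)"
proof -
  have "der v (f / g) = der v f * inverse g - f * der v g * inverse (g * g)"
    by (simp add: divide_inverse der_mult der_inverse power2_eq_square)
  also have "der v f * inverse g = der v f * g * inverse (g * g)"
    using assms by simp
  finally show ?thesis by (simp add: divide_inverse left_diff_distrib)
qed

lemma der_power: "der v (f ^ Suc n) = of_nat (Suc n) * f ^ n * der v f"
proof (induction n)
  case (Suc n)
  have "der v (f ^ Suc (Suc n)) = der v f * f ^ Suc n + f * der v (f ^ Suc n)"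
    by (simp only: power_Suc der_mult)
  also have "\<dots> = (1 + of_nat (Suc n)) * f ^ Suc n * der v f"
    unfolding Suc.IH by (simp only: power_Suc distrib_left distrib_right mult_1 ac_simps)
  finally show ?case by (simp only: of_nat_Suc)
qed simp

lemma der_dir_add: "der (v + w) f = der v f + der w f"
  and der_dir_scale: "der (c *s v) f = rconst c * der v f"
  by (simp_all add: der_def algebra_simps)

lemma der_axis: "der (axis 1 1) = pd1" "der (axis 2 1) = pd2"
  by (simp_all add: der_def axis_def fun_eq_iff)

lemma der_commute: "der v (der w f) = der w (der v f)"
proof (induction f rule: ratfun_induct)
  case (inverse f)
  \<comment> \<open>Differentiate \<open>f * inverse f = 1\<close> along both directions; the right
    side is symmetric once the derivatives of \<open>f\<close> itself commute.\<close>
  have *: "f * der v' (der w' (inverse f)) = - (der v' (der w' f) * inverse f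
      + der w' f * der v' (inverse f) + der v' f * der w' (inverse f))" for v' w'
  proof -
    have "der v' (der w' (f * inverse f)) = 0" using inverse by simp
    then show ?thesis by (simp only: der_mult der_add eq_neg_iff_add_eq_0) (simp add: ac_simps)
  qed
  have "f * der v (der w (inverse f)) = f * der w (der v (inverse f))"
    unfolding * using inverse by simp
  then show ?case using inverse by simp
next
  case (mult f g)
  then show ?case by (simp add: der_mult der_add algebra_simps)
qed (simp_all add: der_add)

section \<open>The ring of linear operators\<close>

text \<open>A ring under composition, in which commutators can be computed without coefficients.
  Linearity over the constants makes multiplications by constants central.\<close>

typedef endo = "{D :: ratfun \<Rightarrow> ratfun.
    (\<forall>f g. D (f + g) = D f + D g) \<and> (\<forall>c f. D (rconst c * f) = rconst c * D f)}"
  morphisms app Endo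
  by (rule exI[of _ id]) simp

definition linear_op :: "(ratfun \<Rightarrow> ratfun) \<Rightarrow> bool" where
  "linear_op D \<longleftrightarrow>
     (\<forall>f g. D (f + g) = D f + D g) \<and> (\<forall>c f. D (rconst c * f) = rconst c * D f)"

lemma app_Endo: "linear_op D \<Longrightarrow> app (Endo D) = D"
  by (simp add: linear_op_def Endo_inverse)

lemma linear_op_app: "linear_op (app D)"
  using app[of D] by (simp add: linear_op_def)

lemma endo_eqI: "(\<And>f. app D f = app E f) \<Longrightarrow> D = E"
  by (simp add: app_inject[symmetric] fun_eq_iff)

instantiation endo :: ring_1
begin

definition "0 = Endo (\<lambda>f. 0)"
definition "1 = Endo (\<lambda>f. f)"
definition "D + E = Endo (\<lambda>f. app D f + app E f)"
definition "D - E = Endo (\<lambda>f. app D f - app E f)"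
definition "- D = Endo (\<lambda>f. - app D f)"
definition "D * E = Endo (\<lambda>f. app D (app E f))"

lemma app_ring:
  "app 0 f = 0" "app 1 f = f" "app (D + E) f = app D f + app E f" "app (D - E) f = app D f - app E f"
  "app (- D) f = - app D f" "app (D * E) f = app D (app E f)"
  using linear_op_app[of D] linear_op_app[of E]
  by (simp_all add: zero_endo_def one_endo_def plus_endo_def minus_endo_def uminus_endo_def
      times_endo_def app_Endo linear_op_def distrib_left right_diff_distrib add_diff_add
      add.assoc add.left_commute)

instance
proof
  show "(0::endo) \<noteq> 1" by (metis app_ring(1,2) zero_neq_one)
qed (use linear_op_app in \<open>auto intro!: endo_eqI simp: app_ring linear_op_def\<close>)

end

definition mul :: "ratfun \<Rightarrow> endo" where
  "mul g = Endo (\<lambda>f. g * f)"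

definition dv :: "plane \<Rightarrow> endo" where
  "dv v = Endo (der v)"

lemma app_simps [simp]:
  "app 0 f = 0" "app 1 f = f" "app (D + E) f = app D f + app E f" "app (D - E) f = app D f - app E f"
  "app (- D) f = - app D f" "app (D * E) f = app D (app E f)" "app (mul g) f = g * f"
  "app (dv v) f = der v f"
  by (simp_all add: app_ring mul_def dv_def app_Endo linear_op_def distrib_left mult.left_commute
      der_add der_rconst_mult)

lemma app_linear [simp]:
  "app D (f + g) = app D f + app D g" "app D (rconst c * f) = rconst c * app D f"
  using linear_op_app[of D] by (simp_all add: linear_op_def)

lemma app_0 [simp]: "app D 0 = 0"
  using app_linear(2)[of D 0 0] by (simp del: app_linear)

lemma app_of_nat [simp]: "app (of_nat n) f = of_nat n * f"
  by (induction n) (simp_all add: algebra_simps)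

lemma app_of_int [simp]: "app (of_int n) f = of_int n * f"
  by (cases n) (simp_all flip: of_nat_Suc)

lemma app_numeral [simp]: "app (numeral n) f = numeral n * f"
  using app_of_nat[of "numeral n"] by (simp del: app_of_nat)

lemma app_sum [simp]: "app (sum D A) f = (\<Sum>i\<in>A. app (D i) f)"
  by (induction A rule: infinite_finite_induct) simp_all

lemma mul_simps [simp]:
  "mul 0 = 0" "mul 1 = 1" "mul (f + g) = mul f + mul g" "mul (f - g) = mul f - mul g"
  "mul (- f) = - mul f" "mul (f * g) = mul f * mul g"
  by (rule endo_eqI; simp add: algebra_simps)+

lemma mul_eq_iff [simp]: "mul f = mul g \<longleftrightarrow> f = g"
  by (metis app_simps(7) mult_1_right)

lemma mul_eq_0_iff [simp]: "mul f = 0 \<longleftrightarrow> f = 0"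
  using mul_eq_iff[of f 0] by (simp del: mul_eq_iff)

lemma mul_power [simp]: "mul (f ^ n) = mul f ^ n"
  by (induction n) simp_all

lemma mul_of_nat [simp]: "mul (of_nat n) = of_nat n"
  by (rule endo_eqI) simp

lemma mul_numeral [simp]: "mul (numeral n) = numeral n"
  by (rule endo_eqI) simp

lemma mul_commute: "mul f * mul g = mul g * mul f"
  by (rule endo_eqI) simp

lemma mul_rconst_commute: "D * mul (rconst c) = mul (rconst c) * D"
  by (rule endo_eqI) simp

lemma dv_mul: "dv v * mul f = mul f * dv v + mul (der v f)"
  by (rule endo_eqI) (simp add: der_mult algebra_simps)

lemma dv_commute: "dv v * dv w = dv w * dv v"
  by (rule endo_eqI) (simp add: der_commute)

lemma dv_add: "dv (v + w) = dv v + dv w"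
  and dv_scale: "dv (c *s v) = mul (rconst c) * dv v"
  by (rule endo_eqI, simp add: der_dir_add der_dir_scale)+

definition com :: "'a::ring_1 \<Rightarrow> 'a \<Rightarrow> 'a" where
  "com a b = a * b - b * a"

lemma com_add_left: "com (a + b) c = com a c + com b c"
  and com_add_right: "com a (b + c) = com a b + com a c"
  and com_diff_left: "com (a - b) c = com a c - com b c"
  and com_diff_right: "com a (b - c) = com a b - com a c"
  and com_mult_left: "com (a * b) c = a * com b c + com a c * b"
  and com_mult_right: "com a (b * c) = com a b * c + b * com a c"
  and com_jacobi: "com (com a b) c = com a (com b c) + com (com a c) b"
  by (simp_all add: com_def algebra_simps)

lemma com_0 [simp]: "com 0 a = 0" "com a 0 = 0" "com a a = 0" "com a 1 = 0" "com 1 a = 0"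
  by (simp_all add: com_def)

lemma com_of_nat [simp]: "com (of_nat n) a = 0" "com a (of_nat n) = 0"
  by (simp_all add: com_def mult_of_nat_commute)

lemma com_of_int [simp]: "com (of_int n) a = 0" "com a (of_int n) = 0"
  by (simp_all add: com_def mult_of_int_commute)

lemma com_numeral [simp]: "com (numeral n) a = 0" "com a (numeral n) = 0"
  using com_of_nat[where n = "numeral n"] by (simp_all del: com_of_nat)

lemma com_eq_0_iff: "com a b = 0 \<longleftrightarrow> a * b = b * a"
  by (simp add: com_def)

lemma com_anti: "com a b = - com b a"
  by (simp add: com_def)

lemma com_sum_right: "com a (sum f A) = (\<Sum>x\<in>A. com a (f x))"
  by (simp add: com_def sum_distrib_left sum_distrib_right sum_subtractf)

lemma com_mul_mul [simp]: "com (mul f) (mul g) = 0"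
  by (simp add: com_eq_0_iff mul_commute)

lemma com_mul_rconst [simp]: "com D (mul (rconst c)) = 0" "com (mul (rconst c)) D = 0"
  by (simp_all add: com_eq_0_iff mul_rconst_commute)

lemma com_dv_mul [simp]: "com (dv v) (mul f) = mul (der v f)"
  by (simp add: com_def dv_mul)

lemma com_dv_dv [simp]: "com (dv v) (dv w) = 0"
  by (simp add: com_eq_0_iff dv_commute)

section \<open>Order of an operator\<close>

definition ad :: "plane \<Rightarrow> endo \<Rightarrow> endo" where
  "ad v D = com D (mul (lin v))"

text \<open>
  Orders are measured as in Grothendieck's definition; commutators with linear functions suffice
  (\<open>ordlt_1D\<close>).
\<close>

fun ordlt :: "nat \<Rightarrow> endo \<Rightarrow> bool" where
  "ordlt 0 D \<longleftrightarrow> D = 0"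
| "ordlt (Suc n) D \<longleftrightarrow> (\<forall>v. ordlt n (ad v D))"

lemma ordlt_Suc_iff: "ordlt (Suc n) D \<longleftrightarrow> (\<forall>v. ordlt n (ad v D))"
  by simp

declare ordlt.simps(2) [simp del]

lemma ad_simps [simp]:
  "ad v 0 = 0" "ad v (mul f) = 0" "ad v (dv w) = mul (rconst (bil w v))"
  "ad v (D + E) = ad v D + ad v E" "ad v (D - E) = ad v D - ad v E"
  "ad v (D * E) = D * ad v E + ad v D * E"
  "ad v (com D E) = com D (ad v E) + com (ad v D) E"
  by (simp_all add: ad_def com_add_left com_diff_left com_mult_left) (rule com_jacobi)

lemma ad_commute: "ad v (ad w D) = ad w (ad v D)"
  unfolding ad_def by (subst com_jacobi) simp

lemma ad_dir_add: "ad (v + w) D = ad v D + ad w D"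
  and ad_dir_scale: "ad (c *s v) D = mul (rconst c) * ad v D"
  by (simp_all add: ad_def lin_add lin_scale com_add_right com_mult_right)

lemma ordlt_0 [simp]: "ordlt n 0"
  by (induction n) (simp_all add: ordlt_Suc_iff)

lemma ordlt_add: "ordlt n D \<Longrightarrow> ordlt n E \<Longrightarrow> ordlt n (D + E)"
  by (induction n arbitrary: D E) (simp_all add: ordlt_Suc_iff)

lemma ordlt_diff: "ordlt n D \<Longrightarrow> ordlt n E \<Longrightarrow> ordlt n (D - E)"
  by (induction n arbitrary: D E) (simp_all add: ordlt_Suc_iff)

lemma ordlt_sum: "(\<And>x. x \<in> A \<Longrightarrow> ordlt n (D x)) \<Longrightarrow> ordlt n (sum D A)"
  by (induction A rule: infinite_finite_induct) (auto intro: ordlt_add)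

lemma ordlt_Suc: "ordlt n D \<Longrightarrow> ordlt (Suc n) D"
  by (induction n arbitrary: D) (simp_all add: ordlt_Suc_iff)

lemma ordlt_mono: "ordlt m D \<Longrightarrow> m \<le> n \<Longrightarrow> ordlt n D"
  by (induction n) (auto simp: le_Suc_eq intro: ordlt_Suc)

lemma ordlt_mul: "ordlt (Suc n) (mul f)"
  by (simp add: ordlt_Suc_iff)

lemma ordlt_dv: "ordlt (Suc (Suc n)) (dv v)"
  by (simp add: ordlt_Suc_iff)

text \<open>A strict bound m means order at most m - 1, so orders add to m + n - 2. The truncated
  subtraction is harmless: a bound 0 makes the product zero.\<close>

lemma ordlt_times:
  assumes "ordlt m D" "ordlt n E"
  shows "ordlt (m + n - 1) (D * E)"
  using assms
proof (induction "m + n" arbitrary: m n D E rule: less_induct)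
  case less
  show ?case
  proof (cases "m = 0 \<or> n = 0")
    case True
    then show ?thesis using less.prems by auto
  next
    case False
    then obtain m' n' where mn: "m = Suc m'" "n = Suc n'" by (auto simp: gr0_conv_Suc)
    have "ordlt (m' + n') (D * ad v E + ad v D * E)" for v
      using less.hyps[of "Suc m'" n' D "ad v E"] less.hyps[of m' "Suc n'" "ad v D" E] less.prems
      by (auto intro!: ordlt_add simp: mn ordlt_Suc_iff)
    then show ?thesis by (simp add: mn ordlt_Suc_iff)
  qed
qed

lemma ordlt_mul_times: "ordlt n D \<Longrightarrow> ordlt n (mul f * D)"
  using ordlt_times[of 1 "mul f" n D] ordlt_mul[of 0 f] by simp

text \<open>Commuting with linear forms forces commuting with the whole field that they generate,
  and such an operator is determined by its value at 1.\<close>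

lemma ordlt_1D:
  assumes "ordlt 1 D"
  shows "D = mul (app D 1)"
proof -
  have "D * mul f = mul f * D" for f
  proof (induction f rule: ratfun_induct)
    case (lin v)
    then show ?case using assms by (simp add: ad_def com_eq_0_iff ordlt_Suc_iff)
  next
    case (mult f g)
    have "D * mul (f * g) = (D * mul f) * mul g" by (simp only: mul_simps mult.assoc)
    also have "\<dots> = mul f * (D * mul g)" by (simp only: mult mult.assoc)
    also have "\<dots> = mul (f * g) * D" by (simp only: mult mul_simps mult.assoc)
    finally show ?case .
  next
    case (inverse f)
    have *: "mul f * mul (inverse f) = 1" "mul (inverse f) * mul f = 1"
      using inverse by (simp_all flip: mul_simps(6))
    have "mul (inverse f) * D = mul (inverse f) * (D * mul f) * mul (inverse f)"
      by (simp only: mult.assoc * mult_1_right)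
    also have "\<dots> = (mul (inverse f) * mul f) * D * mul (inverse f)"
      by (simp only: inverse mult.assoc)
    finally show ?case by (simp only: * mult_1_left)
  next
    case (add f g)
    then show ?case by (simp only: mul_simps distrib_left distrib_right)
  next
    case (const c)
    show ?case by (rule mul_rconst_commute)
  qed
  then have "app (D * mul f) 1 = app (mul f * D) 1" for f by simp
  then show ?thesis by (intro endo_eqI) (metis app_simps(6,7) mult_1_right mult.commute)
qed

text \<open>The bound for products improves by one because leading terms commute. The gain
  originates in the case of two multiplications, whose commutator is 0.\<close>

lemma ordlt_com:
  assumes "ordlt m D" "ordlt n E"
  shows "ordlt (m + n - 2) (com D E)"
  using assms
proof (induction "m + n" arbitrary: m n D E rule: less_induct)
  case less
  consider "m = 0 \<or> n = 0" | "m = 1" "n = 1" | m' n' where "m = Suc m'" "n = Suc n'" "m' + n' > 0"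
    by (metis add_gr_0 One_nat_def neq0_conv old.nat.exhaust)
  then show ?case
  proof cases
    case 1
    then show ?thesis using less.prems by auto
  next
    case 2
    then have "D = mul (app D 1)" "E = mul (app E 1)" using less.prems ordlt_1D by auto
    then have "com D E = 0" by (metis com_mul_mul)
    then show ?thesis by simp
  next
    case 3
    then obtain k where k: "m' + n' = Suc k" by (auto simp: gr0_conv_Suc)
    have "ordlt k (com D (ad v E) + com (ad v D) E)" for v
      using less.hyps[of "Suc m'" n' D "ad v E"] less.hyps[of m' "Suc n'" "ad v D" E] less.prems 3 k
      by (auto intro!: ordlt_add simp: ordlt_Suc_iff)
    then show ?thesis using 3 k by (simp add: ordlt_Suc_iff)
  qed
qed

lemma ordlt_dv_power: "ordlt (Suc n) (dv v ^ n)"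
proof (induction n)
  case 0
  show ?case using ordlt_mul[of 0 1] by simp
next
  case (Suc n)
  then show ?case using ordlt_times[OF ordlt_dv[of 0 v] Suc] by simp
qed

text \<open>
  On an operator of order \<open>i + j\<close> the value of \<open>mu e\<^sub>1 e\<^sub>2 i j\<close> is multiplication by
  \<open>i! j!\<close> times the coefficient of \<open>\<xi>\<^sub>1\<^sup>i \<xi>\<^sub>2\<^sup>j\<close> in its symbol.
\<close>

definition mu :: "plane \<Rightarrow> plane \<Rightarrow> nat \<Rightarrow> nat \<Rightarrow> endo \<Rightarrow> endo" where
  "mu v w i j D = (ad v ^^ i) ((ad w ^^ j) D)"

lemma ad_funpow_add [simp]: "(ad v ^^ i) (D + E) = (ad v ^^ i) D + (ad v ^^ i) E"
  by (induction i) simp_all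

lemma ad_funpow_0 [simp]: "(ad v ^^ i) 0 = 0"
  by (induction i) simp_all

lemma ad_funpow_commute: "(ad v ^^ i) (ad w D) = ad w ((ad v ^^ i) D)"
  by (induction i) (simp_all add: ad_commute)

lemma mu_0_0 [simp]: "mu v w 0 0 D = D"
  by (simp add: mu_def)

lemma mu_ad: "mu v w i j (ad v D) = mu v w (Suc i) j D" "mu v w i j (ad w D) = mu v w i (Suc j) D"
  by (simp_all add: mu_def ad_funpow_commute)

lemma mu_add: "mu v w i j (D + E) = mu v w i j D + mu v w i j E"
  by (simp add: mu_def)

lemma mu_0 [simp]: "mu v w i j 0 = 0"
  by (simp add: mu_def)

lemma mu_diff: "mu v w i j (D - E) = mu v w i j D - mu v w i j E"
  using mu_add[of v w i j "D - E" E] by simp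

lemma mu_sum: "mu v w i j (sum f A) = (\<Sum>x\<in>A. mu v w i j (f x))"
  by (induction A rule: infinite_finite_induct) (simp_all add: mu_add)

lemma mu_mul_times: "mu v w i j (mul f * D) = mul f * mu v w i j D"
proof -
  have "(ad v ^^ i) (mul f * D) = mul f * (ad v ^^ i) D" for v i D
    by (induction i) simp_all
  then show ?thesis by (simp add: mu_def)
qed

lemma ordlt_mu: "ordlt (n + i + j) D \<Longrightarrow> ordlt n (mu v w i j D)"
proof (induction "i + j" arbitrary: i j D)
  case (Suc k)
  then show ?case
  proof (cases i)
    case 0
    then obtain j' where "j = Suc j'" using Suc by (cases j) auto
    then show ?thesis using Suc.hyps(1)[of i j' "ad w D"] Suc.hyps(2) Suc.prems
      by (simp add: mu_ad ordlt_Suc_iff)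
  next
    case (Suc i')
    then show ?thesis using Suc.hyps(1)[of i' j "ad v D"] Suc.hyps(2) Suc.prems
      by (simp add: mu_ad ordlt_Suc_iff)
  qed
qed simp

lemma mu_eq_0: "ordlt (i + j) D \<Longrightarrow> mu v w i j D = 0"
  using ordlt_mu[of 0 i j D v w] by simp

text \<open>The order is defined with all linear forms, but \<open>ad\<close> is linear in the
  direction, so the two forms of a basis suffice.\<close>

lemma ordlt_muI:
  assumes span: "\<And>u. \<exists>c d. u = c *s v + d *s w"
    and "\<And>i j. i + j = n \<Longrightarrow> mu v w i j D = 0"
  shows "ordlt n D"
  using assms(2)
proof (induction n arbitrary: D)
  case 0
  then show ?case using 0[of 0 0] by simp
next
  case (Suc n)
  have "ordlt n (ad v D)" "ordlt n (ad w D)"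
    using Suc.prems by (auto intro!: Suc.IH simp: mu_ad)
  moreover have "\<exists>c d. ad u D = mul (rconst c) * ad v D + mul (rconst d) * ad w D" for u
    using span[of u] by (metis ad_dir_add ad_dir_scale)
  ultimately have "ordlt n (ad u D)" for u
    by (metis ordlt_add ordlt_mul_times)
  then show ?case by (simp add: ordlt_Suc_iff)
qed

section \<open>Homogeneity\<close>

definition e1 :: plane where "e1 = axis 1 1"
definition e2 :: plane where "e2 = axis 2 1"

lemma e_nth [simp]: "e1 $ 1 = 1" "e1 $ 2 = 0" "e2 $ 1 = 0" "e2 $ 2 = 1"
  by (simp_all add: e1_def e2_def axis_def)

lemma ad_of_nat [simp]: "ad v (of_nat n) = 0"
  and ad_of_int [simp]: "ad v (of_int k) = 0"
  and ad_numeral [simp]: "ad v (numeral m) = 0"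
  by (simp_all add: ad_def)

definition eul :: endo where
  "eul = mul (lin e1) * dv e1 + mul (lin e2) * dv e2"

definition lap :: endo where
  "lap = dv e1 * dv e1 + dv e2 * dv e2"

definition rsq :: ratfun where
  "rsq = (lin e1)\<^sup>2 + (lin e2)\<^sup>2"

lemma rconst_solve:
  assumes "rconst c * f = rconst d * g" "c \<noteq> 0"
  shows "f = rconst (d / c) * g"
proof -
  have "rconst (d / c) * g = rconst (inverse c) * (rconst d * g)"
    by (simp add: divide_inverse mult.commute)
  also have "\<dots> = rconst (inverse c * c) * f"
    by (simp only: assms(1)[symmetric] rconst_simps mult.assoc)
  finally show ?thesis using assms(2) by simp
qed

lemma plane_expand: "v = (v $ 1) *s e1 + (v $ 2) *s e2"
  by (simp add: vec_eq_iff forall_2)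

lemma lin_expand: "lin v = rconst (v $ 1) * lin e1 + rconst (v $ 2) * lin e2"
  by (subst plane_expand[of v]) (simp only: lin_add lin_scale)

lemma dv_expand: "dv v = mul (rconst (v $ 1)) * dv e1 + mul (rconst (v $ 2)) * dv e2"
  by (subst plane_expand[of v]) (simp only: dv_add dv_scale)

lemma bil_axis [simp]:
  "bil e1 v = v $ 1" "bil e2 v = v $ 2" "bil v e1 = v $ 1" "bil v e2 = v $ 2"
  by (simp_all add: bil_eq)

lemma com_mul_dv: "com (mul f) (dv v) = - mul (der v f)"
  by (subst com_anti) simp

lemma app_eul: "app eul f = lin e1 * der e1 f + lin e2 * der e2 f"
  by (simp add: eul_def)

lemma com_eul_mul [simp]: "com eul (mul f) = mul (app eul f)"
  by (simp add: app_eul eul_def com_add_left com_mult_left)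

lemma app_eul_mult: "app eul (f * g) = app eul f * g + f * app eul g"
  by (simp add: app_eul der_mult algebra_simps)

lemma app_eul_lin [simp]: "app eul (lin v) = lin v"
proof -
  have "app eul (lin v) = rconst (v $ 1) * lin e1 + rconst (v $ 2) * lin e2"
    by (simp add: app_eul mult.commute)
  then show ?thesis by (simp only: lin_expand[symmetric])
qed

lemma app_eul_1 [simp]: "app eul 1 = 0"
  by (simp add: app_eul)

lemma com_eul_dv [simp]: "com eul (dv v) = - dv v"
  by (subst (2) dv_expand)
    (simp add: eul_def com_add_left com_mult_left com_mul_dv)

lemma com_eul_lap: "com eul lap = - (2 * lap)"
  by (simp add: lap_def com_add_right com_mult_right algebra_simps mult_2)

lemma ad_lap [simp]: "ad v lap = 2 * dv v"
proof -
  have "dv e1 * mul (rconst a) + mul (rconst a) * dv e1 = 2 * (mul (rconst a) * dv e1)"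
    "dv e2 * mul (rconst a) + mul (rconst a) * dv e2 = 2 * (mul (rconst a) * dv e2)" for a
    by (simp_all only: mul_rconst_commute mult_2)
  then show ?thesis
    by (subst dv_expand) (simp add: lap_def distrib_left)
qed

lemma ad_eul [simp]: "ad v eul = mul (lin v)"
  by (subst lin_expand) (simp add: eul_def mul_commute)

lemma ordlt_lap: "ordlt 3 lap"
  by (simp add: numeral_3_eq_3 ordlt_Suc_iff)

lemma com_dv2_mul:
  "com (dv v * dv v) (mul f) = 2 * (mul (der v f) * dv v) + mul (der v (der v f))"
  by (simp add: com_mult_left dv_mul mult_2)

lemma der_rsq: "der v rsq = 2 * lin v"
  by (subst lin_expand) (simp add: rsq_def power2_eq_square der_add der_mult algebra_simps)

text \<open>The constant 4 is twice the dimension. Together with the degrees of \<open>lap\<close>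
  and \<open>rsq\<close> this is the sl_2 relation behind the ladder.\<close>

lemma com_lap_rsq: "com lap (mul rsq) = 4 * eul + 4"
  by (rule endo_eqI) (simp add: com_def lap_def eul_def der_mult der_add der_rsq algebra_simps)

lemma app_eul_rsq: "app eul rsq = 2 * rsq"
  by (simp add: rsq_def power2_eq_square app_eul_mult algebra_simps)

lemma com_eul_ad:
  assumes "com eul D = of_int k * D"
  shows "com eul (ad v D) = of_int (k + 1) * ad v D"
proof -
  have "ad v (com eul D) = com eul (ad v D) + com (mul (lin v)) D" by simp
  moreover have "com (mul (lin v)) D = - ad v D"
    unfolding ad_def by (rule com_anti)
  ultimately show ?thesis using assms by (simp add: algebra_simps)
qed

text \<open>Every commutator with a linear form, which has degree 1, raises the degree by 1.\<close>

lemma com_eul_mu: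
  assumes "com eul D = of_int k * D"
  shows "com eul (mu v w i j D) = of_int (k + int i + int j) * mu v w i j D"
proof -
  have *: "com eul D = of_int k * D \<Longrightarrow>
      com eul ((ad v ^^ i) D) = of_int (k + int i) * (ad v ^^ i) D" for k v i D
  proof (induction i)
    case (Suc i)
    then show ?case using com_eul_ad[of "(ad v ^^ i) D" "k + int i" v] by (simp add: ac_simps)
  qed simp
  show ?thesis
    using *[where D = "(ad w ^^ j) D" and k = "k + int j"] *[where D = D and k = k] assms
    by (simp add: mu_def ac_simps)
qed

lemma der_funpow_commute: "(der v ^^ n) (der w f) = der w ((der v ^^ n) f)"
  by (induction n) (simp_all add: der_commute)

lemma der_funpow_0 [simp]: "(der v ^^ n) 0 = 0"
  by (induction n) simp_all

lemma der_funpow_add: "(der v ^^ n) (f + g) = (der v ^^ n) f + (der v ^^ n) g"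
  by (induction n) (simp_all add: der_add)

lemma der_funpow_rconst_mult: "(der v ^^ n) (rconst c * f) = rconst c * (der v ^^ n) f"
  by (induction n) (simp_all add: der_rconst_mult)

lemma der_funpow_mono: "(der v ^^ m) f = 0 \<Longrightarrow> m \<le> n \<Longrightarrow> (der v ^^ n) f = 0"
  using funpow_add[of "n - m" m "der v"] by simp

lemma app_eul_der:
  assumes "app eul s = of_int d * s"
  shows "app eul (der v s) = of_int (d - 1) * der v s"
proof -
  have "app (com eul (dv v)) s = - der v s" by simp
  moreover have "der v (of_int d * s) = of_int d * der v s"
    by (metis der_rconst_mult rconst_of_int)
  ultimately show ?thesis using assms by (simp add: com_def algebra_simps)
qed

lemma app_eul_der_funpow:
  assumes "app eul s = of_int d * s"
  shows "app eul ((der v ^^ n) s) = of_int (d - int n) * (der v ^^ n) s"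
proof (induction n)
  case (Suc n)
  then show ?case using app_eul_der[of "(der v ^^ n) s" "d - int n" v] by (simp add: algebra_simps)
qed (use assms in simp)

text \<open>
  An element annihilated by powers of both partial derivatives is a polynomial, so its degree of
  homogeneity is not negative.
\<close>

lemma homogeneous_neg_eq_0:
  assumes "app eul s = of_int d * s" "d < 0" "(der e1 ^^ a) s = 0" "(der e2 ^^ b) s = 0"
  shows "s = 0"
  using assms
proof (induction "a + b" arbitrary: a b d s rule: less_induct)
  case less
  show ?case
  proof (cases "a = 0 \<or> b = 0")
    case True
    then show ?thesis using less.prems by auto
  next
    case False
    then obtain a' b' where ab: "a = Suc a'" "b = Suc b'" by (auto simp: gr0_conv_Suc)
    have "der e1 s = 0"
    proof (rule less.hyps[of a' b "der e1 s" "d - 1"])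
      show "(der e1 ^^ a') (der e1 s) = 0"
        using less.prems(3) by (simp add: ab der_funpow_commute)
      show "(der e2 ^^ b) (der e1 s) = 0"
        using less.prems(4) by (simp add: der_funpow_commute)
    qed (use less.prems ab app_eul_der in auto)
    moreover have "der e2 s = 0"
    proof (rule less.hyps[of a b' "der e2 s" "d - 1"])
      show "(der e2 ^^ b') (der e2 s) = 0"
        using less.prems(4) by (simp add: ab der_funpow_commute)
      show "(der e1 ^^ a) (der e2 s) = 0"
        using less.prems(3) by (simp add: der_funpow_commute)
    qed (use less.prems ab app_eul_der in auto)
    ultimately have "app eul s = 0" by (simp add: app_eul)
    then show ?thesis using less.prems by simp
  qed
qed

lemma der_funpow_mult_eq_0:
  assumes "(der v ^^ a) f = 0" "(der v ^^ b) g = 0"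
  shows "(der v ^^ (a + b)) (f * g) = 0"
  using assms
proof (induction "a + b" arbitrary: a b f g rule: less_induct)
  case less
  show ?case
  proof (cases "a = 0 \<or> b = 0")
    case True
    then show ?thesis using less.prems by auto
  next
    case False
    then obtain a' b' where ab: "a = Suc a'" "b = Suc b'" by (auto simp: gr0_conv_Suc)
    have "(der v ^^ (a' + b)) (der v f * g) = 0"
      using less.prems by (intro less.hyps) (auto simp: ab der_funpow_commute)
    moreover have "(der v ^^ (a + b')) (f * der v g) = 0"
      using less.prems by (intro less.hyps) (auto simp: ab der_funpow_commute)
    ultimately have "(der v ^^ (a' + b)) (der v (f * g)) = 0"
      by (simp add: der_mult der_funpow_add der_add ab)
    then show ?thesis by (simp add: ab der_funpow_commute)
  qed
qed

lemma poly_fn_nilpotent: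
  assumes "poly_fn f"
  shows "\<exists>n. (der v ^^ n) f = 0"
  using assms
proof (induction rule: poly_fn_induct)
  case (1 c)
  show ?case by (rule exI[of _ 1]) simp
next
  case (2 w)
  show ?case by (rule exI[of _ 2]) (simp add: numeral_2_eq_2)
next
  case (3 f g)
  then obtain a b where "(der v ^^ a) f = 0" "(der v ^^ b) g = 0" by blast
  then have "(der v ^^ (a + b)) (f + g) = 0"
    using der_funpow_mono[of a v f "a + b"] der_funpow_mono[of b v g "a + b"]
    by (simp add: der_funpow_add)
  then show ?case by blast
next
  case (4 f g)
  then show ?case using der_funpow_mult_eq_0 by blast
qed

lemma homogeneous_poly_neg_eq_0:
  assumes "app eul s = of_int d * s" "d < 0" "poly_fn s"
  shows "s = 0"
  using assms homogeneous_neg_eq_0 poly_fn_nilpotent by metis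

section \<open>Iterated commutators with a Schroedinger operator\<close>

text \<open>The oscillator term has degree 2 and would spoil the homogeneity of \<open>L\<close>; it
  is put back only in \<open>com_Q\<close> and \<open>com_ang\<close>.\<close>

locale schroedinger =
  fixes w :: ratfun
  assumes hom_w: "app eul w = - (2 * w)"
begin

definition L :: endo where
  "L = lap - mul w"

lemma ordlt_L: "ordlt 3 L"
  using ordlt_diff[OF ordlt_lap, of "mul w"] ordlt_mul[of 2 w] by (simp add: L_def)

lemma ad_L [simp]: "ad v L = 2 * dv v"
  by (simp add: L_def)

lemma com_eul_L: "com eul L = - (2 * L)"
  by (simp only: L_def com_diff_right com_eul_lap com_eul_mul hom_w mul_simps mul_numeral)
    (simp add: algebra_simps)

lemma com_L_rsq: "com L (mul rsq) = 4 * eul + 4"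
  by (simp add: L_def com_diff_left com_lap_rsq)

text \<open>The Leibniz expansion stops after the terms in which \<open>L\<close> is hit once:
  \<open>ad v L\<close> is \<open>2 * dv v\<close>, and hitting it again leaves a central constant.
  For n = 0 the truncated index is multiplied by 0.\<close>

lemma ad_funpow_com_L:
  "(ad v ^^ n) (com L X) = com L ((ad v ^^ n) X)
      + of_nat (2 * n) * com (dv v) ((ad v ^^ (n - 1)) X)"
proof (induction n)
  case (Suc n)
  have "(ad v ^^ Suc n) (com L X) = com L ((ad v ^^ Suc n) X) + 2 * com (dv v) ((ad v ^^ n) X)
      + of_nat (2 * n) * com (dv v) (ad v ((ad v ^^ (n - 1)) X))"
    by (simp add: Suc com_mult_left del: of_nat_mult)
  also have "\<dots> = com L ((ad v ^^ Suc n) X) + of_nat (2 * Suc n) * com (dv v) ((ad v ^^ n) X)"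
    by (cases n) (simp_all add: algebra_simps mult_2)
  finally show ?case by simp
qed simp

lemma mu_com_L:
  "mu e1 e2 i j (com L X) = com L (mu e1 e2 i j X)
     + of_nat (2 * i) * com (dv e1) (mu e1 e2 (i - 1) j X)
     + of_nat (2 * j) * com (dv e2) (mu e1 e2 i (j - 1) X)"
proof -
  have 2: "(ad v ^^ n) (com (dv u) X) = com (dv u) ((ad v ^^ n) X)" for u v n X
    by (induction n) simp_all
  have 3: "(ad v ^^ n) (of_nat k * X) = of_nat k * (ad v ^^ n) X" for v n k X
    by (induction n) simp_all
  show ?thesis
    unfolding mu_def ad_funpow_com_L by (simp only: ad_funpow_add ad_funpow_com_L 2 3)
qed

text \<open>At top order \<open>com L\<close> differentiates the symbol along the free motion, that
  is by 2 (xi, d/dx); the potential contributes only to lower order. The factors i and j stem from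
  the \<open>i! j!\<close> in \<open>mu\<close>.\<close>

lemma mu_com_L_top:
  assumes X: "ordlt (Suc m) X" and ij: "i + j = Suc m"
  defines "s \<equiv> \<lambda>i j. app (mu e1 e2 i j X) 1"
  shows "mu e1 e2 i j (com L X)
    = mul (2 * (of_nat i * der e1 (s (i - 1) j) + of_nat j * der e2 (s i (j - 1))))"
proof -
  have s: "mu e1 e2 i j X = mul (s i j)" if "i + j = m" for i j
    using ordlt_1D[OF ordlt_mu[of 1 i j X e1 e2]] X that by (simp add: s_def add.commute)
  have "mu e1 e2 i j X = 0" using X ij by (intro mu_eq_0) simp
  moreover have "of_nat (2 * i) * com (dv e1) (mu e1 e2 (i - 1) j X)
      = mul (of_nat (2 * i) * der e1 (s (i - 1) j))"
    using ij by (cases i) (simp_all add: s del: of_nat_Suc of_nat_mult mult_Suc_right)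
  moreover have "of_nat (2 * j) * com (dv e2) (mu e1 e2 i (j - 1) X)
      = mul (of_nat (2 * j) * der e2 (s i (j - 1)))"
    using ij by (cases j) (simp_all add: s del: of_nat_Suc of_nat_mult mult_Suc_right)
  ultimately show ?thesis
    unfolding mu_com_L by (simp add: algebra_simps)
qed

text \<open>The symbol of an operator commuting with \<open>L\<close> is polynomial in the coordinates.\<close>

lemma commuting_hom_neg_eq_0:
  assumes X: "ordlt (Suc m) X" and c: "com L X = 0"
    and hom: "com eul X = of_int d * X" and neg: "d + int m < 0"
  shows "ordlt m X"
proof -
  define s where "s = (\<lambda>i j. app (mu e1 e2 i j X) 1)"
  have mu: "mu e1 e2 i j X = mul (s i j)" if "i + j = m" for i j
    using ordlt_1D[OF ordlt_mu[of 1 i j X e1 e2]] X that by (simp add: s_def add.commute)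
  have rel: "of_nat i * der e1 (s (i - 1) j) + of_nat j * der e2 (s i (j - 1)) = 0"
    if "i + j = Suc m" for i j
  proof -
    have "mul (2 * (of_nat i * der e1 (s (i - 1) j) + of_nat j * der e2 (s i (j - 1)))) = 0"
      using mu_com_L_top[OF X that] c by (simp only: s_def mu_0)
    then show ?thesis by (simp only: mul_eq_0_iff mult_eq_0_iff) simp
  qed
  \<comment> \<open>The coefficient at i = 0 is constant along \<open>e2\<close>. The relation
    expresses the \<open>e2\<close>-derivative of the next coefficient through the
    \<open>e1\<close>-derivative of this one, so one more derivative along \<open>e2\<close>
    suffices. \<open>n1\<close> runs in the opposite direction.\<close>
  have n2: "(der e2 ^^ Suc i) (s i j) = 0" if "i + j = m" for i j
    using that
  proof (induction i arbitrary: j)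
    case 0
    then show ?case using rel[of 0 "Suc j"] by (simp del: of_nat_Suc)
  next
    case (Suc i)
    have "(of_nat (Suc j) :: ratfun) * der e2 (s (Suc i) j) = - (of_nat (Suc i) * der e1 (s i (Suc j)))"
      using rel[of "Suc i" "Suc j"] Suc.prems by (simp add: add_eq_0_iff del: of_nat_Suc)
    then have *: "der e2 (s (Suc i) j)
        = rconst (- of_nat (Suc i) / of_nat (Suc j)) * der e1 (s i (Suc j))"
      by (intro rconst_solve) (simp_all only: rconst_of_nat rconst_simps of_nat_eq_0_iff mult_minus_left nat.distinct not_False_eq_True)
    have "(der e2 ^^ Suc i) (der e1 (s i (Suc j))) = 0"
      using Suc.IH[of "Suc j"] Suc.prems by (simp only: der_funpow_commute) simp
    then have "(der e2 ^^ Suc i) (der e2 (s (Suc i) j)) = 0" unfolding * der_funpow_rconst_mult by simp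
    then show ?case by (simp add: der_funpow_commute)
  qed
  have n1: "(der e1 ^^ Suc j) (s i j) = 0" if "i + j = m" for i j
    using that
  proof (induction j arbitrary: i)
    case 0
    then show ?case using rel[of "Suc i" 0] by (simp del: of_nat_Suc)
  next
    case (Suc j)
    have "(of_nat (Suc i) :: ratfun) * der e1 (s i (Suc j)) = - (of_nat (Suc j) * der e2 (s (Suc i) j))"
      using rel[of "Suc i" "Suc j"] Suc.prems
      by (simp add: add_eq_0_iff2 del: of_nat_Suc)
    then have *: "der e1 (s i (Suc j))
        = rconst (- of_nat (Suc j) / of_nat (Suc i)) * der e2 (s (Suc i) j)"
      by (intro rconst_solve) (simp_all only: rconst_of_nat rconst_simps of_nat_eq_0_iff mult_minus_left nat.distinct not_False_eq_True)
    have "(der e1 ^^ Suc j) (der e2 (s (Suc i) j)) = 0"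
      using Suc.IH[of "Suc i"] Suc.prems by (simp only: der_funpow_commute) simp
    then have "(der e1 ^^ Suc j) (der e1 (s i (Suc j))) = 0" unfolding * der_funpow_rconst_mult by simp
    then show ?case by (simp add: der_funpow_commute)
  qed
  have "s i j = 0" if ij: "i + j = m" for i j
  proof (rule homogeneous_neg_eq_0[OF _ _ n1[OF ij] n2[OF ij]])
    have "com eul (mul (s i j)) = of_int (d + int m) * mul (s i j)"
      using com_eul_mu[OF hom, of e1 e2 i j] mu[OF ij] ij by (simp add: add.assoc flip: of_nat_add)
    then have "app (com eul (mul (s i j))) 1 = app (of_int (d + int m) * mul (s i j)) 1" by simp
    then show "app eul (s i j) = of_int (d + int m) * s i j" by (simp add: distrib_right)
    show "d + int m < 0" by (rule neg)
  qed
  then show ?thesis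
  proof (intro ordlt_muI[of e1 e2])
    show "\<exists>c d. u = c *s e1 + d *s e2" for u
      using plane_expand[of u] by blast
  qed (simp add: mu)
qed

end

section \<open>Rational functions near a mirror\<close>

definition perp :: "plane \<Rightarrow> plane" where
  "perp v = (\<chi> i. if i = 1 then - v $ 2 else v $ 1)"

lemma perp_nth [simp]: "perp v $ 1 = - v $ 2" "perp v $ 2 = v $ 1"
  by (simp_all add: perp_def)

lemma bil_perp [simp]: "bil v (perp v) = 0" "bil (perp v) v = 0" "bil (perp v) (perp v) = bil v v"
  by (simp_all add: bil_eq)

lemma bil_simps:
  "bil (v + w) u = bil v u + bil w u" "bil u (v + w) = bil u v + bil u w"
  "bil (v - w) u = bil v u - bil w u" "bil u (v - w) = bil u v - bil u w"
  "bil (c *s v) u = c * bil v u" "bil u (c *s v) = c * bil u v"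
  "bil (- v) u = - bil v u" "bil u (- v) = - bil u v"
  for u v w :: plane
  by (simp_all add: bil_eq algebra_simps)

lemma bil_commute: "bil v w = bil w v" for v w :: plane
  by (simp add: bil_eq mult.commute)

lemma bil_reflection_self_adjoint: "bil (reflection e v) w = bil v (reflection e w)" for e v w :: plane
  by (simp add: reflection_def bil_simps) (simp add: bil_eq field_simps)

lemma reflection_involution: "bil e e \<noteq> 0 \<Longrightarrow> reflection e (reflection e v) = v" for e v :: plane
  by (simp add: reflection_def bil_simps vec_eq_iff field_simps)

lemma line_poly: "\<exists>r. \<forall>a. poly r a = eval2 q (a *s v)"
proof (induction q rule: poly2_induct)
  case (1 c)
  show ?case by (rule exI[of _ "[:c:]"]) simp
next
  case 2
  show ?case by (rule exI[of _ "[:0, v $ 1:]"]) simp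
next
  case 3
  show ?case by (rule exI[of _ "[:0, v $ 2:]"]) simp
next
  case (4 p q)
  then show ?case by (metis eval2_simps(3) poly_add)
next
  case (5 p q)
  then show ?case by (metis eval2_simps(6) poly_mult)
qed

text \<open>Over the complex numbers every non-isotropic vector is a multiple of such an
  \<open>e\<close> (\<open>unit_vector\<close>). Then \<open>e\<close>, \<open>perp e\<close> is an
  orthonormal frame, and \<open>perp e\<close> spans the mirror.\<close>

locale mirror =
  fixes e :: plane
  assumes unit: "bil e e = 1"
begin

section \<open>The local ring of a mirror\<close>

definition vanishes :: "poly2 \<Rightarrow> bool" where
  "vanishes q \<longleftrightarrow> (\<forall>a. eval2 q (a *s perp e) = 0)"

text \<open>The local ring at the generic point of the mirror, a discrete valuation ring with
  uniformiser \<open>lin e\<close>.\<close>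

definition reg :: "ratfun \<Rightarrow> bool" where
  "reg f \<longleftrightarrow> (\<exists>p q. f = to_fract p / to_fract q \<and> \<not> vanishes q)"

lemma vanishes_0 [simp]: "vanishes 0"
  by (simp add: vanishes_def)

lemma vanishes_1 [simp]: "\<not> vanishes 1"
  by (simp add: vanishes_def)

text \<open>The restriction to the mirror is a polynomial in one variable
  (\<open>line_poly\<close>), and there are no zero divisors among those: the ideal of the mirror is
  prime.\<close>

lemma vanishes_mult [simp]: "vanishes (p * q) \<longleftrightarrow> vanishes p \<or> vanishes q"
proof -
  obtain r s where rs: "\<And>a. poly r a = eval2 p (a *s perp e)" "\<And>a. poly s a = eval2 q (a *s perp e)"
    using line_poly by metis
  have "vanishes p \<longleftrightarrow> r = 0" "vanishes q \<longleftrightarrow> s = 0"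
    by (simp_all add: vanishes_def flip: rs poly_all_0_iff_0)
  moreover have "vanishes (p * q) \<longleftrightarrow> r * s = 0"
    by (simp add: vanishes_def flip: rs poly_all_0_iff_0 poly_mult)
  ultimately show ?thesis by simp
qed

lemma plane_decomp: "v = bil e v *s e + bil (perp e) v *s perp e"
  using unit by (simp add: vec_eq_iff forall_2 bil_eq algebra_simps) algebra

lemma vanishes_linp: "vanishes (linp v) \<longleftrightarrow> v = bil e v *s e"
proof
  assume "vanishes (linp v)"
  then have "bil v (1 *s perp e) = 0" unfolding vanishes_def eval2_linp by blast
  then show "v = bil e v *s e" using plane_decomp[of v] by (simp add: bil_commute)
next
  assume "v = bil e v *s e"
  then have "bil v (a *s perp e) = 0" for a by (metis bil_simps(5,6) bil_perp(1) mult_zero_right)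
  then show "vanishes (linp v)" by (simp add: vanishes_def)
qed

text \<open>In the coordinates of the frame, division by the equation of the mirror leaves a
  remainder in the tangential coordinate alone. Its values are those of \<open>p\<close> on the
  mirror, so it is 0 here.\<close>

lemma vanishes_dvd:
  assumes "vanishes p"
  shows "\<exists>p'. p = linp e * p'"
proof -
  have "\<exists>p' r. \<forall>v. eval2 p v = bil e v * eval2 p' v + poly r (bil (perp e) v)"
  proof (induction p rule: poly2_induct)
    case (1 c)
    show ?case by (rule exI[of _ 0], rule exI[of _ "[:c:]"]) simp
  next
    case 2
    have h: "v $ 1 = bil e v * e $ 1 + bil (perp e) v * perp e $ 1" for v
      by (subst (1) plane_decomp[of v]) simp
    have "eval2 [:[:0, 1:]:] v = bil e v * eval2 [:[:e $ 1:]:] v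
        + poly [:0, perp e $ 1:] (bil (perp e) v)" for v
      using h[of v] by (simp del: perp_nth)
    then show ?case by blast
  next
    case 3
    have h: "v $ 2 = bil e v * e $ 2 + bil (perp e) v * perp e $ 2" for v
      by (subst (1) plane_decomp[of v]) simp
    have "eval2 [:0, 1:] v = bil e v * eval2 [:[:e $ 2:]:] v
        + poly [:0, perp e $ 2:] (bil (perp e) v)" for v
      using h[of v] by (simp del: perp_nth)
    then show ?case by blast
  next
    case (4 p q)
    then obtain p' r q' s where
      "\<And>v. eval2 p v = bil e v * eval2 p' v + poly r (bil (perp e) v)"
      "\<And>v. eval2 q v = bil e v * eval2 q' v + poly s (bil (perp e) v)" by blast
    then show ?case
      by (intro exI[of _ "p' + q'"] exI[of _ "r + s"]) (simp add: algebra_simps)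
  next
    case (5 p q)
    then obtain p' r q' s where
      "\<And>v. eval2 p v = bil e v * eval2 p' v + poly r (bil (perp e) v)"
      "\<And>v. eval2 q v = bil e v * eval2 q' v + poly s (bil (perp e) v)" by blast
    then show ?case
      \<comment> \<open>\<open>p - linp e * p'\<close> is the remainder of \<open>p\<close> written
        as a polynomial on the plane; it multiplies the quotient \<open>q'\<close>.\<close>
      by (intro exI[of _ "p' * q + (p - linp e * p') * q'"] exI[of _ "r * s"])
        (simp add: algebra_simps)
  qed
  then obtain p' r where pr: "\<And>v. eval2 p v = bil e v * eval2 p' v + poly r (bil (perp e) v)"
    by blast
  have "poly r a = 0" for a
    using pr[of "a *s perp e"] assms unit by (simp add: vanishes_def bil_simps)
  then have "eval2 p v = eval2 (linp e * p') v" for v using pr by simp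
  then show ?thesis using eval2_eqI by blast
qed

lemma reg_fracI: "\<not> vanishes q \<Longrightarrow> reg (to_fract p / to_fract q)"
  by (auto simp: reg_def)

lemma reg_cases:
  assumes "reg f"
  obtains p q where "f = to_fract p / to_fract q" "\<not> vanishes q" "to_fract q \<noteq> 0"
  using assms by (metis reg_def to_fract_eq_0_iff vanishes_0)

lemma reg_to_fract: "reg (to_fract p)"
  using reg_fracI[of 1 p] by simp

lemma reg_poly_fn: "poly_fn f \<Longrightarrow> reg f"
  by (auto simp: poly_fn_def reg_to_fract)

lemma reg_rconst [simp]: "reg (rconst c)"
  by (simp add: rconst_def reg_to_fract)

lemma reg_lin [simp]: "reg (lin v)"
  by (simp add: reg_to_fract flip: to_fract_linp)

lemma reg_0 [simp]: "reg 0" and reg_1 [simp]: "reg 1"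
  using reg_rconst[of 0] reg_rconst[of 1] by simp_all

lemma reg_of_nat [simp]: "reg (of_nat n)"
  using reg_rconst[of "of_nat n"] by (simp del: reg_rconst)

lemma reg_numeral [simp]: "reg (numeral n)"
  using reg_rconst[of "numeral n"] by (simp del: reg_rconst)

lemma reg_add [intro]:
  assumes "reg f" "reg g" shows "reg (f + g)"
proof -
  obtain p q r s where "f = to_fract p / to_fract q" "\<not> vanishes q" "to_fract q \<noteq> 0"
    "g = to_fract r / to_fract s" "\<not> vanishes s" "to_fract s \<noteq> 0"
    using assms by (metis reg_cases)
  moreover from this have "f + g = to_fract (p * s + r * q) / to_fract (q * s)"
    by (simp add: field_simps)
  ultimately show ?thesis by (metis reg_fracI vanishes_mult)
qed

lemma reg_mult [intro]:
  assumes "reg f" "reg g" shows "reg (f * g)"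
proof -
  obtain p q r s where "f = to_fract p / to_fract q" "\<not> vanishes q" "to_fract q \<noteq> 0"
    "g = to_fract r / to_fract s" "\<not> vanishes s" "to_fract s \<noteq> 0"
    using assms by (metis reg_cases)
  moreover from this have "f * g = to_fract (p * r) / to_fract (q * s)"
    by simp
  ultimately show ?thesis by (metis reg_fracI vanishes_mult)
qed

lemma reg_minus [intro]: "reg f \<Longrightarrow> reg (- f)"
  using reg_mult[of "- 1" f] reg_rconst[of "- 1"] by (simp del: reg_rconst)

lemma reg_diff [intro]: "reg f \<Longrightarrow> reg g \<Longrightarrow> reg (f - g)"
  using reg_add[of f "- g"] reg_minus by simp

lemma reg_power [intro]: "reg f \<Longrightarrow> reg (f ^ n)"
  by (induction n) auto

lemma reg_sum: "(\<And>x. x \<in> A \<Longrightarrow> reg (f x)) \<Longrightarrow> reg (sum f A)"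
  by (induction A rule: infinite_finite_induct) auto

lemma reg_prod: "(\<And>x. x \<in> A \<Longrightarrow> reg (f x)) \<Longrightarrow> reg (prod f A)"
  by (induction A rule: infinite_finite_induct) auto

lemma reg_inverse_lin:
  assumes "v \<noteq> bil e v *s e"
  shows "reg (inverse (lin v))"
  using reg_fracI[of "linp v" 1] assms by (simp add: vanishes_linp to_fract_linp divide_inverse)

lemma reg_der [intro]:
  assumes "reg f" shows "reg (der v f)"
proof -
  obtain p q where f: "f = to_fract p / to_fract q" "\<not> vanishes q" "to_fract q \<noteq> 0"
    using assms by (rule reg_cases)
  have poly: "\<exists>r'. der v (to_fract r) = to_fract r'" for r
    by (metis der_to_fract)
  obtain p' q' where pq: "der v (to_fract p) = to_fract p'" "der v (to_fract q) = to_fract q'"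
    using poly by metis
  have eq: "der v f = to_fract (p' * q - p * q') / to_fract (q * q)"
    unfolding f(1) der_divide[OF f(3)] pq by simp
  show ?thesis unfolding eq by (rule reg_fracI) (simp add: f(2))
qed

lemma e_nonzero [simp]: "e \<noteq> 0"
  using unit by (auto simp: bil_eq)

section \<open>The reflection acting on rational functions\<close>

definition psub :: "poly2 \<Rightarrow> poly2" where
  "psub p = (THE q. \<forall>v. eval2 q v = eval2 p (reflection e v))"

text \<open>Polynomials with equal values are equal, which gives uniqueness. Existence only has to
  be seen on the coordinates, where the self-adjoint reflection turns linear forms into linear
  forms.\<close>

lemma eval2_psub: "eval2 (psub p) v = eval2 p (reflection e v)"
proof -
  have "\<exists>q. \<forall>v. eval2 q v = eval2 p (reflection e v)"
  proof (induction p rule: poly2_induct)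
    case (1 c)
    show ?case by (rule exI[of _ "[:[:c:]:]"]) simp
  next
    case 2
    have "eval2 (linp (reflection e e1)) v = reflection e v $ 1" for v
      by (simp add: bil_reflection_self_adjoint)
    then show ?case by (intro exI[of _ "linp (reflection e e1)"]) simp
  next
    case 3
    have "eval2 (linp (reflection e e2)) v = reflection e v $ 2" for v
      by (simp add: bil_reflection_self_adjoint)
    then show ?case by (intro exI[of _ "linp (reflection e e2)"]) simp
  next
    case (4 p q)
    then show ?case by (metis eval2_simps(3))
  next
    case (5 p q)
    then show ?case by (metis eval2_simps(6))
  qed
  then have "\<exists>!q. \<forall>v. eval2 q v = eval2 p (reflection e v)"
    by (metis eval2_eqI)
  from theI'[OF this] show ?thesis by (simp add: psub_def)
qed

lemma psub_hom:
  "psub (p + q) = psub p + psub q" "psub (p * q) = psub p * psub q" "psub [:[:c:]:] = [:[:c:]:]"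
  "psub (linp v) = linp (reflection e v)" "psub (psub p) = p"
  by (rule eval2_eqI; simp add: eval2_psub bil_reflection_self_adjoint reflection_involution unit)+

lemma psub_0 [simp]: "psub 0 = 0"
  by (rule eval2_eqI) (simp add: eval2_psub)

lemma psub_eq_0_iff [simp]: "psub p = 0 \<longleftrightarrow> p = 0"
  by (metis psub_0 psub_hom(5))

lemma reflection_perp: "reflection e (a *s perp e) = a *s perp e"
  by (simp add: reflection_def bil_simps)

lemma reflection_e: "reflection e e = - e"
  using unit by (simp add: reflection_def vec_eq_iff)

lemma vanishes_psub [simp]: "vanishes (psub p) \<longleftrightarrow> vanishes p"
  by (simp add: vanishes_def eval2_psub reflection_perp)

definition rs :: "ratfun \<Rightarrow> ratfun" where
  "rs f = (THE g. \<exists>p q. q \<noteq> 0 \<and> f = to_fract p / to_fract q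
      \<and> g = to_fract (psub p) / to_fract (psub q))"

lemma rs_frac:
  assumes "q \<noteq> 0"
  shows "rs (to_fract p / to_fract q) = to_fract (psub p) / to_fract (psub q)"
  unfolding rs_def
proof (rule the_equality)
  fix g
  assume "\<exists>p' q'. q' \<noteq> 0 \<and> to_fract p / to_fract q = to_fract p' / to_fract q'
      \<and> g = to_fract (psub p') / to_fract (psub q')"
  then obtain p' q' where *: "q' \<noteq> 0" "to_fract p / to_fract q = to_fract p' / to_fract q'"
    "g = to_fract (psub p') / to_fract (psub q')" by blast
  then have "to_fract (p * q') = to_fract (p' * q)"
    using assms by (simp add: field_simps)
  then have "p * q' = p' * q" by (simp only: to_fract_eq_iff)
  then have "psub p * psub q' = psub p' * psub q" by (simp flip: psub_hom)
  then have "to_fract (psub p) * to_fract (psub q') = to_fract (psub p') * to_fract (psub q)"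
    by (simp flip: to_fract_mult)
  then show "g = to_fract (psub p) / to_fract (psub q)"
    unfolding *(3) using *(1) assms by (simp add: frac_eq_eq)
qed (use assms in blast)

lemma rs_to_fract: "rs (to_fract p) = to_fract (psub p)"
proof -
  have "psub 1 = 1" using psub_hom(3)[of 1] by (simp flip: one_pCons)
  then show ?thesis using rs_frac[of 1 p] by simp
qed

lemma rs_rconst [simp]: "rs (rconst c) = rconst c"
  by (simp add: rconst_def rs_to_fract psub_hom)

lemma rs_0 [simp]: "rs 0 = 0" and rs_1 [simp]: "rs 1 = 1"
  using rs_rconst[of 0] rs_rconst[of 1] by simp_all

lemma rs_of_nat [simp]: "rs (of_nat n) = of_nat n"
  using rs_rconst[of "of_nat n"] by (simp del: rs_rconst)

lemma rs_lin: "rs (lin v) = lin (reflection e v)"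
  by (simp add: rs_to_fract psub_hom flip: to_fract_linp)

lemma rs_lin_e [simp]: "rs (lin e) = - lin e"
  by (simp add: rs_lin reflection_e lin_minus)

lemma rs_add: "rs (f + g) = rs f + rs g"
proof -
  obtain p q r s where pq: "q \<noteq> 0" "f = to_fract p / to_fract q" "s \<noteq> 0" "g = to_fract r / to_fract s"
    by (metis ratfun_cases)
  then have fg: "f + g = to_fract (p * s + r * q) / to_fract (q * s)"
    by (simp add: field_simps)
  have "rs (f + g) = to_fract (psub (p * s + r * q)) / to_fract (psub (q * s))"
    unfolding fg by (rule rs_frac) (use pq in simp)
  also have "\<dots> = to_fract (psub p) / to_fract (psub q) + to_fract (psub r) / to_fract (psub s)"
    using pq by (simp add: psub_hom add_frac_eq)
  also have "\<dots> = rs f + rs g"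
    using pq by (simp add: rs_frac)
  finally show ?thesis .
qed

lemma rs_mult: "rs (f * g) = rs f * rs g"
proof -
  obtain p q r s where pq: "q \<noteq> 0" "f = to_fract p / to_fract q" "s \<noteq> 0" "g = to_fract r / to_fract s"
    by (metis ratfun_cases)
  then have "f * g = to_fract (p * r) / to_fract (q * s)" by simp
  then show ?thesis using pq rs_frac[of "q * s" "p * r"] by (simp add: psub_hom rs_frac)
qed

lemma rs_minus: "rs (- f) = - rs f"
  using rs_add[of f "- f"] by (simp add: add_eq_0_iff2)

lemma rs_diff: "rs (f - g) = rs f - rs g"
  using rs_add[of f "- g"] by (simp add: rs_minus)

lemma rs_inverse: "rs (inverse f) = inverse (rs f)"
proof (cases "f = 0")
  case False
  then have "rs f * rs (inverse f) = 1" by (simp flip: rs_mult)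
  then show ?thesis by (metis inverse_unique)
qed simp

lemma rs_divide: "rs (f / g) = rs f / rs g"
  by (simp add: divide_inverse rs_mult rs_inverse)

lemma rs_power: "rs (f ^ n) = rs f ^ n"
  by (induction n) (simp_all add: rs_mult)

lemma rs_sum: "rs (sum f A) = (\<Sum>x\<in>A. rs (f x))"
  by (induction A rule: infinite_finite_induct) (simp_all add: rs_add)

lemma rs_prod: "rs (prod f A) = (\<Prod>x\<in>A. rs (f x))"
  by (induction A rule: infinite_finite_induct) (simp_all add: rs_mult)

lemma rs_rs [simp]: "rs (rs f) = f"
proof -
  obtain p q where "q \<noteq> 0" "f = to_fract p / to_fract q" by (rule ratfun_cases)
  then show ?thesis by (simp add: rs_frac psub_hom)
qed

lemma reg_rs [intro]: "reg f \<Longrightarrow> reg (rs f)"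
  by (elim reg_cases) (auto simp: rs_frac intro: reg_fracI)

lemma reg_div_e: "\<not> vanishes q \<Longrightarrow> vanishes p \<Longrightarrow> reg (to_fract p / to_fract q / lin e)"
  by (drule vanishes_dvd) (auto simp: to_fract_linp reg_fracI)

text \<open>A function and its reflection agree on the mirror, so the numerator of their difference
  is divisible by its equation.\<close>

lemma reg_rs_diff:
  assumes "reg f" shows "reg ((f - rs f) / lin e)"
proof -
  obtain p q where f: "f = to_fract p / to_fract q" "\<not> vanishes q" "to_fract q \<noteq> 0"
    using assms by (rule reg_cases)
  have "f - rs f = to_fract (p * psub q - psub p * q) / to_fract (q * psub q)"
    using f by (simp add: rs_frac diff_frac_eq)
  moreover have "vanishes (p * psub q - psub p * q)"
    by (simp add: vanishes_def eval2_psub reflection_perp)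
  then have "reg (to_fract (p * psub q - psub p * q) / to_fract (q * psub q) / lin e)"
    using f(2) by (intro reg_div_e) simp_all
  ultimately show ?thesis by simp
qed

text \<open>Such an \<open>f\<close> is half of \<open>f - rs f\<close>.\<close>

lemma reg_odd:
  assumes "reg f" "rs f = - f" shows "reg (f / lin e)"
proof -
  have "reg (rconst (1/2) * ((f - rs f) / lin e))"
    by (rule reg_mult[OF reg_rconst reg_rs_diff[OF assms(1)]])
  moreover have "rconst (1/2) * 2 = (1::ratfun)"
    by (simp flip: rconst_numeral rconst_simps(6))
  then have "rconst (1/2) * ((f - rs f) / lin e) = f / lin e"
    unfolding assms(2) by (simp flip: mult_2 mult.assoc)
  ultimately show ?thesis by simp
qed

lemma der_rs: "der v (rs f) = rs (der (reflection e v) f)"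
proof (induction f rule: ratfun_induct)
  case (lin u)
  then show ?case by (simp add: rs_lin bil_reflection_self_adjoint)
next
  case (inverse f)
  then show ?case by (simp add: rs_inverse der_inverse rs_minus rs_divide rs_power)
qed (simp_all add: rs_add rs_mult der_add der_mult)

lemma der_e_rs: "der e (rs f) = - rs (der e f)"
proof -
  have "der (- e) f = - der e f" using der_dir_scale[of "- 1" e f] by simp
  then show ?thesis by (simp add: der_rs reflection_e rs_minus)
qed

lemma der_perp_rs: "der (perp e) (rs f) = rs (der (perp e) f)"
  using reflection_perp[of 1] by (simp add: der_rs)

lemma reg_on_lineD:
  assumes "regular_on_line (c *s e) f" "c \<noteq> 0"
  shows "reg f"
proof -
  obtain p q v where *: "f = Fract p q" "bil (c *s e) v = 0" "eval2 q v \<noteq> 0"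
    using assms by (auto simp: regular_on_line_def)
  then have "bil e v = 0" using assms(2) by (simp add: bil_simps)
  then have "v = bil (perp e) v *s perp e" using plane_decomp[of v] by simp
  then have "\<not> vanishes q" using *(3) by (metis vanishes_def)
  then show ?thesis using *(1) by (auto simp: reg_def Fract_conv_to_fract)
qed

text \<open>Since the ideal of the mirror is prime, a pole can only be cancelled by powers of its equation.\<close>

lemma cancel_pole:
  assumes "reg (s * lin e ^ m)" "s * (lin e ^ n * to_fract q) = to_fract p" "\<not> vanishes q"
  shows "\<exists>p'. s * (lin e ^ m * to_fract q) = to_fract p'"
  using assms(2)
proof (induction n arbitrary: p)
  case 0
  have "s * (lin e ^ m * to_fract q) = (s * (lin e ^ 0 * to_fract q)) * lin e ^ m"
    by (simp add: mult_ac)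
  also have "\<dots> = to_fract (p * linp e ^ m)"
    unfolding 0 by (simp add: to_fract_power to_fract_linp)
  finally show ?case by blast
next
  case (Suc n)
  show ?case
  proof (cases "Suc n \<le> m")
    case True
    then have "lin e ^ m = lin e ^ (m - Suc n) * lin e ^ Suc n"
      by (metis le_add_diff_inverse2 power_add)
    then have "s * (lin e ^ m * to_fract q) = lin e ^ (m - Suc n) * to_fract p"
      using Suc.prems by (simp add: mult_ac)
    also have "\<dots> = to_fract (linp e ^ (m - Suc n) * p)"
      by (simp add: to_fract_power to_fract_linp)
    finally show ?thesis by blast
  next
    case False
    then have le: "m \<le> n" by simp
    obtain a b where ab: "s * lin e ^ m = to_fract a / to_fract b" "\<not> vanishes b" "to_fract b \<noteq> 0"
      using assms(1) by (rule reg_cases)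
    have pow: "lin e ^ k = to_fract (linp e ^ k)" for k
      by (simp add: to_fract_power to_fract_linp)
    have "lin e ^ Suc n = lin e ^ m * lin e ^ (Suc n - m)"
      by (metis le le_SucI le_add_diff_inverse power_add)
    then have "to_fract p = (s * lin e ^ m) * lin e ^ (Suc n - m) * to_fract q"
      using Suc.prems by (simp add: mult_ac)
    \<comment> \<open>The exponent \<open>Suc n - m\<close> is positive, so the product
      \<open>p * b\<close> vanishes on the mirror. Since \<open>b\<close> does not, \<open>p\<close>
      does, and one power can be cancelled.\<close>
    then have "to_fract (p * b) = to_fract (a * linp e ^ (Suc n - m) * q)"
      using ab by (simp add: pow field_simps)
    then have "p * b = a * linp e ^ (Suc n - m) * q" by (simp only: to_fract_eq_iff)
    moreover have "vanishes (linp e ^ (Suc n - m))"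
    proof -
      have "vanishes (linp e)" by (simp add: vanishes_linp unit)
      moreover have "Suc n - m = Suc (n - m)" using le by simp
      ultimately show ?thesis by simp
    qed
    ultimately have "vanishes (p * b)" by simp
    then obtain p' where "p = linp e * p'" using ab(2) vanishes_dvd by auto
    then have "s * (lin e ^ n * to_fract q) = to_fract p'"
      using Suc.prems by (simp add: to_fract_linp mult_ac)
    then show ?thesis by (rule Suc.IH)
  qed
qed

lemma lap_unit: "lap = dv e * dv e + dv (perp e) * dv (perp e)"
proof (rule endo_eqI)
  fix f
  define a b where "a = rconst (e $ 1)" and "b = rconst (e $ 2)"
  have ab: "a * a + b * b = 1"
    using unit by (simp add: a_def b_def bil_eq flip: rconst_simps)
  have d: "der e g = a * der e1 g + b * der e2 g" "der (perp e) g = - b * der e1 g + a * der e2 g" for g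
    using dv_expand[of e] dv_expand[of "perp e"] app_simps(8)[of e g] app_simps(8)[of "perp e" g]
    by (simp_all add: a_def b_def)
  have c: "der v (a * g) = a * der v g" "der v (b * g) = b * der v g"
    "der v (- b * g) = - b * der v g" for v g
    by (simp_all add: a_def b_def der_rconst_mult der_minus)
  have "app (dv e * dv e + dv (perp e) * dv (perp e)) f
      = (a * a + b * b) * (der e1 (der e1 f) + der e2 (der e2 f))"
    by (simp only: app_simps d der_add c der_commute[of e2 e1]) (simp add: algebra_simps)
  then show "app lap f = app (dv e * dv e + dv (perp e) * dv (perp e)) f"
    by (simp add: ab lap_def)
qed

section \<open>The locus condition at a mirror\<close>

lemma der_e_power: "der e (lin e ^ n) = of_nat n * (lin e ^ n / lin e)"
proof (cases n)
  case (Suc m)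
  have "der e (lin e ^ n) = of_nat n * lin e ^ m"
    unfolding Suc by (simp only: der_power) (simp add: unit)
  then show ?thesis by (simp add: Suc)
qed simp

lemma der_perp_power: "der (perp e) (lin e ^ n) = 0"
proof (cases n)
  case (Suc m)
  then show ?thesis by (simp only: der_power) simp
qed simp

text \<open>Quasi-invariants in the sense of Chalykh and Veselov. The usual exponent is
  \<open>2 * k + 1\<close>: an odd function divisible by the even power gains the missing factor
  from \<open>reg_odd\<close>.\<close>

definition quasi_inv :: "nat \<Rightarrow> ratfun \<Rightarrow> bool" where
  "quasi_inv k h \<longleftrightarrow> reg h \<and> reg ((h - rs h) / lin e ^ (2 * k))"

lemma rs_even_power: "rs (lin e ^ (2 * k)) = lin e ^ (2 * k)"
  by (simp add: rs_power)

lemma quasi_inv_diff: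
  assumes "quasi_inv k g" "quasi_inv k h"
  shows "quasi_inv k (g - h)"
proof -
  have eq: "(g - h - rs (g - h)) / lin e ^ (2 * k)
      = (g - rs g) / lin e ^ (2 * k) - (h - rs h) / lin e ^ (2 * k)"
    by (simp add: rs_diff flip: diff_divide_distrib)
  show ?thesis
    unfolding quasi_inv_def eq using assms unfolding quasi_inv_def by (metis reg_diff)
qed

text \<open>
  The gauged operator is the conjugate of \<open>lap - mul w\<close> by the power \<open>lin e ^ k\<close>, see
  \<open>gauge\<close>.  On an odd function \<open>lin e ^ (2 * k + 1) * b\<close> its two singular terms cancel.
\<close>

lemma quasi_inv_gauged:
  assumes h: "quasi_inv k h" and v: "reg v" "reg ((v - rs v) / lin e ^ (2 * k))"
  defines "h' \<equiv> der e (der e h) - of_nat (2 * k) * (der e h / lin e) + der (perp e) (der (perp e) h) - v * h"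
  shows "quasi_inv k h'"
proof -
  define T where "T = lin e ^ (2 * k)"
  have T: "T \<noteq> 0" "rs T = T" "reg T" "der e T = of_nat (2 * k) * (T / lin e)"
    "der (perp e) T = 0"
    using reg_power[OF reg_lin] by (simp_all add: T_def rs_even_power der_e_power der_perp_power)
  define q where "q = h - rs h"
  \<comment> \<open>\<open>q\<close> is odd and \<open>T\<close> even, so \<open>q / T\<close> is an
    odd regular function and another factor \<open>lin e\<close> splits off.\<close>
  define b where "b = q / T / lin e"
  have b: "reg b" "q = lin e * T * b"
  proof -
    have "rs (q / T) = - (q / T)"
      by (simp add: q_def rs_divide rs_diff T(2) minus_divide_left)
    moreover have "reg (q / T)" using h by (simp add: quasi_inv_def q_def T_def)
    ultimately show "reg b" unfolding b_def by (intro reg_odd)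
    show "q = lin e * T * b" using T(1) by (simp add: b_def)
  qed
  have q1: "der e q = T * (of_nat (2 * k + 1) * b + lin e * der e b)"
    unfolding b(2) using T(1)
    by (simp add: der_mult T unit algebra_simps)
  have q2: "der e (der e q) = of_nat (2 * k) * (T / lin e) * (of_nat (2 * k + 1) * b + lin e * der e b)
      + T * (of_nat (2 * k + 2) * der e b + lin e * der e (der e b))"
    unfolding q1 by (simp add: der_mult der_add T unit algebra_simps del: of_nat_mult)
  have q12: "der e (der e q) - of_nat (2 * k) * (der e q / lin e)
      = T * (of_nat (2 * k + 2) * der e b + lin e * der e (der e b))"
    unfolding q2 unfolding q1 by simp
  have q3: "der (perp e) (der (perp e) q) = T * (lin e * der (perp e) (der (perp e) b))"
    unfolding b(2) by (simp add: der_mult T algebra_simps)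
  have rsh': "rs h' = der e (der e (rs h)) - of_nat (2 * k) * (der e (rs h) / lin e)
      + der (perp e) (der (perp e) (rs h)) - rs v * rs h"
    by (simp add: h'_def rs_diff rs_add rs_mult rs_divide der_e_rs der_perp_rs der_minus
        del: of_nat_mult)
  define z where "z = (v - rs v) / T"
  have z: "v - rs v = T * z" using T(1) by (simp add: z_def)
  have "h' - rs h' = der e (der e q) - of_nat (2 * k) * (der e q / lin e)
      + der (perp e) (der (perp e) q) - v * q - (v - rs v) * rs h"
    unfolding rsh' unfolding h'_def q_def
    by (simp add: der_diff diff_divide_distrib algebra_simps)
  also have "\<dots> = T * (of_nat (2 * k + 2) * der e b + lin e * der e (der e b)
      + lin e * der (perp e) (der (perp e) b) - v * (lin e * b) - z * rs h)"
    unfolding q12 q3 z by (simp add: b(2) algebra_simps)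
  finally have "(h' - rs h') / T = of_nat (2 * k + 2) * der e b + lin e * der e (der e b)
      + lin e * der (perp e) (der (perp e) b) - v * (lin e * b) - z * rs h"
    using T(1) by simp
  moreover have "reg \<dots>"
    using b(1) v h
    by (intro reg_diff reg_add reg_mult reg_der reg_of_nat reg_lin reg_rs)
      (simp_all add: z_def T_def quasi_inv_def)
  ultimately have 1: "reg ((h' - rs h') / T)" by simp
  have reg_h: "reg h" using h by (simp add: quasi_inv_def)
  \<comment> \<open>For k = 0 the factor vanishes. Otherwise split twice the derivative into its
    difference and its sum with its reflection: the difference is divisible by \<open>lin e\<close>
    anyway, and the sum is \<open>der e q\<close>, which contains the factor
    \<open>T\<close>.\<close>
  have r: "reg (of_nat (2 * k) * (der e h / lin e))"
  proof (cases k)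
    case (Suc k')
    have "reg ((der e h - rs (der e h)) / lin e)"
      using reg_h by (intro reg_rs_diff reg_der)
    moreover have "der e h + rs (der e h) = der e q"
      by (simp add: q_def der_diff der_e_rs)
    moreover have "reg (der e q / lin e)"
    proof -
      have "T = lin e * (lin e * lin e ^ (2 * k'))" by (simp add: T_def Suc)
      then have "der e q / lin e
          = (lin e * lin e ^ (2 * k')) * (of_nat (2 * k + 1) * b + lin e * der e b)"
        unfolding q1 by simp
      moreover have "reg \<dots>"
        using b(1) by (intro reg_mult reg_add reg_der reg_of_nat reg_lin reg_power)
      ultimately show ?thesis by simp
    qed
    ultimately have "reg (of_nat k * ((der e h - rs (der e h)) / lin e + (der e h + rs (der e h)) / lin e))"
      by (intro reg_mult reg_add reg_of_nat) simp_all
    also have "of_nat k * ((der e h - rs (der e h)) / lin e + (der e h + rs (der e h)) / lin e)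
        = of_nat (2 * k) * (der e h / lin e)"
      by (simp add: diff_divide_distrib add_divide_distrib)
    finally show ?thesis .
  qed simp
  have "reg h'"
    unfolding h'_def
    by (rule reg_diff[OF reg_add[OF reg_diff[OF reg_der[OF reg_der[OF reg_h]] r]
          reg_der[OF reg_der[OF reg_h]]] reg_mult[OF v(1) reg_h]])
  then show ?thesis using 1 by (simp add: quasi_inv_def T_def)
qed

text \<open>The double pole disappears because the exponent a = -k solves a (a - 1) = k (k + 1);
  only a simple pole in front of the normal derivative remains.\<close>

lemma gauge:
  fixes k :: nat
  assumes w: "w = rconst (of_nat k * (of_nat k + 1)) / (lin e)\<^sup>2 + v" and f: "f = h / lin e ^ k"
  shows "lin e ^ k * app (lap - mul w) f = der e (der e h) - of_nat (2 * k) * (der e h / lin e)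
    + der (perp e) (der (perp e) h) - v * h"
proof -
  define t where "t = lin e"
  define T where "T = t ^ k"
  define K :: ratfun where "K = of_nat k"
  have T: "t \<noteq> 0" "T \<noteq> 0" "der e T = K * (T / t)" "der (perp e) T = 0" "der e t = 1"
    "der v K = 0" for v
    by (simp_all add: T_def t_def K_def der_e_power der_perp_power unit)
  have h: "h = T * f" using f T(2) by (simp add: T_def t_def)
  have h1: "der e h = K * (T / t) * f + T * der e f"
    by (simp add: h der_mult T)
  have h2: "der e (der e h) = K * K * (T / (t * t)) * f - K * (T / (t * t)) * f
      + 2 * (K * (T / t) * der e f) + T * der e (der e f)"
    unfolding h1 using T(1) by (simp add: der_mult der_add T der_divide field_simps)
  have h3: "der (perp e) (der (perp e) h) = T * der (perp e) (der (perp e) f)"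
    by (simp add: h der_mult T)
  have w: "w = K * (K + 1) / (t * t) + v"
    by (simp add: w K_def t_def power2_eq_square)
  have "lin e ^ k * app (lap - mul w) f
      = T * (der e (der e f) + der (perp e) (der (perp e) f) - w * f)"
    by (simp add: lap_unit T_def t_def)
  also have "\<dots> = der e (der e h) - 2 * K * (der e h / t)
    + der (perp e) (der (perp e) h) - v * h"
    unfolding h3 h2 unfolding h1 unfolding h w using T(1) by (simp add: field_simps)
  finally show ?thesis by (simp add: K_def t_def)
qed

text \<open>The rungs preserve the space \<open>F\<close>, which contains \<open>lin e ^ k\<close>
  times every regular function and consists of functions with a pole of order at most k. So they map
  the former to the latter, and so do their commutators with linear forms. For the symbol, a
  multiplication, this bounds the pole order by \<open>2 * k\<close>.\<close>

lemma locus_symbol: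
  fixes k :: nat
  assumes w: "w = rconst (of_nat k * (of_nat k + 1)) / (lin e)\<^sup>2 + v"
    and v: "reg v" "reg ((v - rs v) / lin e ^ (2 * k))" and g: "reg (g / lin e ^ (2 * k))"
    and X: "X = (com (lap - mul w) ^^ n) (mul g)"
    and ord: "ordlt (Suc (i + j)) X"
  shows "reg (app (mu e1 e2 i j X) 1 * lin e ^ (2 * k))"
proof -
  define F where "F f \<longleftrightarrow> quasi_inv k (lin e ^ k * f)" for f
  have F_diff: "F (f - f')" if "F f" "F f'" for f f'
    using quasi_inv_diff that by (simp add: F_def right_diff_distrib)
  have F_L: "F (app (lap - mul w) f)" if "F f" for f
    using quasi_inv_gauged[OF _ v, of "lin e ^ k * f"] gauge[OF w, of f "lin e ^ k * f"] that
    unfolding F_def by simp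
  \<comment> \<open>The factor \<open>lin e ^ (2 * k)\<close> of \<open>g\<close> is even, so the
    remaining factor only has to be regular for the product to be quasi-invariant.\<close>
  have F_g: "F (g * f)" if "F f" for f
  proof -
    let ?h = "lin e ^ k * f" and ?u = "g / lin e ^ (2 * k)"
    have "lin e ^ k * (g * f) = lin e ^ (2 * k) * (?u * ?h)" by simp
    moreover have "quasi_inv k (lin e ^ (2 * k) * (?u * ?h))"
    proof -
      have eq: "(lin e ^ (2 * k) * (?u * ?h) - rs (lin e ^ (2 * k) * (?u * ?h))) / lin e ^ (2 * k)
          = ?u * ?h - rs (?u * ?h)"
        by (simp only: rs_mult[of "lin e ^ (2 * k)"] rs_even_power flip: right_diff_distrib) simp
      have r: "reg (?u * ?h)" using g that unfolding F_def quasi_inv_def by (blast intro: reg_mult)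
      show ?thesis
        unfolding quasi_inv_def eq
        by (rule conjI[OF reg_mult[OF reg_power[OF reg_lin] r] reg_diff[OF r reg_rs[OF r]]])
    qed
    ultimately show ?thesis by (simp only: F_def)
  qed
  have F_X: "F (app ((com (lap - mul w) ^^ n) (mul g)) f)" if "F f" for f n
    using that
  proof (induction n arbitrary: f)
    case (Suc n)
    have "app ((com (lap - mul w) ^^ Suc n) (mul g)) f
        = app (lap - mul w) (app ((com (lap - mul w) ^^ n) (mul g)) f)
        - app ((com (lap - mul w) ^^ n) (mul g)) (app (lap - mul w) f)"
      by (simp only: funpow.simps comp_apply com_def[of _ "(com _ ^^ n) (mul g)"] app_simps)
    then show ?case
      using F_diff[OF F_L[OF Suc.IH[OF Suc.prems]] Suc.IH[OF F_L[OF Suc.prems]]] by (simp only:)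
  qed (use F_g in simp)
  define G where "G D \<longleftrightarrow> (\<forall>b. reg b \<longrightarrow> reg (lin e ^ k * app D (lin e ^ k * b)))" for D
  have "G X"
    unfolding G_def
  proof (intro allI impI)
    fix b assume b: "reg b"
    have eq: "lin e ^ k * (lin e ^ k * b) = lin e ^ (2 * k) * b"
      by (simp add: mult_2 power_add mult.assoc)
    have eq': "(lin e ^ (2 * k) * b - rs (lin e ^ (2 * k) * b)) / lin e ^ (2 * k) = b - rs b"
      by (simp only: rs_mult[of "lin e ^ (2 * k)"] rs_even_power flip: right_diff_distrib) simp
    have "F (lin e ^ k * b)"
      unfolding F_def eq quasi_inv_def eq'
      by (rule conjI[OF reg_mult[OF reg_power[OF reg_lin] b] reg_diff[OF b reg_rs[OF b]]])
    then have "F (app X (lin e ^ k * b))" unfolding X by (rule F_X)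
    then show "reg (lin e ^ k * app X (lin e ^ k * b))" by (simp add: F_def quasi_inv_def)
  qed
  have G_ad: "G (ad u D)" if "G D" for u D
    unfolding G_def
  proof (intro allI impI)
    fix b assume b: "reg b"
    have "lin e ^ k * app (ad u D) (lin e ^ k * b)
        = lin e ^ k * app D (lin e ^ k * (lin u * b)) - lin u * (lin e ^ k * app D (lin e ^ k * b))"
      by (simp add: ad_def com_def right_diff_distrib mult_ac)
    moreover have "reg \<dots>"
    proof (rule reg_diff)
      show "reg (lin e ^ k * app D (lin e ^ k * (lin u * b)))"
        using that reg_mult[OF reg_lin b] unfolding G_def by blast
      show "reg (lin u * (lin e ^ k * app D (lin e ^ k * b)))"
        using that b unfolding G_def by (intro reg_mult[OF reg_lin]) blast
    qed
    ultimately show "reg (lin e ^ k * app (ad u D) (lin e ^ k * b))" by simp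
  qed
  have "G ((ad u ^^ n) D)" if "G D" for u D n
    using that by (induction n) (simp_all add: G_ad)
  then have "G (mu e1 e2 i j X)" using \<open>G X\<close> by (simp add: mu_def)
  moreover have "mu e1 e2 i j X = mul (app (mu e1 e2 i j X) 1)"
    using ordlt_1D[OF ordlt_mu[of 1 i j X e1 e2]] ord by simp
  ultimately have "reg (lin e ^ k * app (mul (app (mu e1 e2 i j X) 1)) (lin e ^ k * 1))"
    using reg_1 G_def by metis
  moreover have "lin e ^ k * app (mul s) (lin e ^ k * 1) = s * lin e ^ (2 * k)" for s
    by (simp only: mult_2 power_add app_simps mult_1_right) (simp only: mult_ac)
  ultimately show ?thesis by (simp only:)
qed

section \<open>Reflection symmetry at a mirror\<close>

definition even_fn :: "ratfun \<Rightarrow> bool" where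
  "even_fn a \<longleftrightarrow> reg a \<and> rs a = a"

lemma even_fn_const [simp]: "even_fn (rconst c)" "even_fn 0" "even_fn 1" "even_fn 2"
  using rs_rconst[of 2] by (simp_all add: even_fn_def del: rs_rconst) simp

text \<open>The normal derivative of an even function is odd, hence divisible by
  \<open>lin e\<close>.\<close>

lemma even_fn_closed:
  assumes "even_fn a"
  shows "even_fn b \<Longrightarrow> even_fn (a + b)" "even_fn b \<Longrightarrow> even_fn (a * b)"
    "even_fn (der (perp e) a)" "even_fn (lin e * der e a)" "even_fn (der e a / lin e)"
    "even_fn (der e (der e a))" "even_fn ((lin e)\<^sup>2)" "even_fn (- a)"
proof -
  have a: "reg a" "rs a = a" using assms by (simp_all add: even_fn_def)
  have odd: "rs (der e a) = - der e a" using der_e_rs[of a] a(2) by (metis minus_minus)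
  show "even_fn b \<Longrightarrow> even_fn (a + b)" "even_fn b \<Longrightarrow> even_fn (a * b)" "even_fn (- a)"
    using a by (auto simp: even_fn_def rs_add rs_mult rs_minus)
  show "even_fn (der (perp e) a)" using a der_perp_rs[of a] by (auto simp: even_fn_def)
  show "even_fn (lin e * der e a)" using a by (auto simp: even_fn_def rs_mult odd)
  show "even_fn (der e a / lin e)" using a reg_odd[OF _ odd] by (auto simp: even_fn_def rs_divide odd)
  show "even_fn (der e (der e a))" using a der_e_rs[of "der e a"] by (auto simp: even_fn_def odd der_minus)
  show "even_fn ((lin e)\<^sup>2)" by (auto simp: even_fn_def rs_power)
qed

end

text \<open>
  \<open>L0\<close>, \<open>Er\<close> and \<open>dy\<close> generate over the even regular functions a filtered algebra
  whose principal symbols have no poles, although \<open>L0\<close> itself has one.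
\<close>

locale radial = mirror +
  fixes c :: complex
begin

definition L0 :: endo where
  "L0 = dv e * dv e - mul (rconst c / (lin e)\<^sup>2)"

definition Er :: endo where
  "Er = mul (lin e) * dv e"

abbreviation dy :: endo where
  "dy \<equiv> dv (perp e)"

text \<open>The index is a weight: 0 for functions, 1 for \<open>dy\<close> and \<open>Er\<close>, 2
  for \<open>L0\<close>. Generators are multiplied from the left only; closure under products is
  \<open>filt_times\<close>.\<close>

inductive filt :: "nat \<Rightarrow> endo \<Rightarrow> bool" where
  filt_mul: "even_fn a \<Longrightarrow> filt m (mul a)"
| filt_add: "filt m D \<Longrightarrow> filt m D' \<Longrightarrow> filt m (D + D')"
| filt_mul_times: "even_fn a \<Longrightarrow> filt m D \<Longrightarrow> filt m (mul a * D)"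
| filt_dy: "filt m D \<Longrightarrow> filt (Suc m) (dy * D)"
| filt_Er: "filt m D \<Longrightarrow> filt (Suc m) (Er * D)"
| filt_L0: "filt m D \<Longrightarrow> filt (Suc (Suc m)) (L0 * D)"
| filt_Suc: "filt m D \<Longrightarrow> filt (Suc m) D"

lemma filt_mono: "filt m D \<Longrightarrow> m \<le> n \<Longrightarrow> filt n D"
  by (induction n) (auto simp: le_Suc_eq intro: filt_Suc)

lemma filt_basic: "filt n 1" "filt n 0" "filt (Suc n) dy" "filt (Suc n) Er" "filt (Suc (Suc n)) L0"
proof -
  show 1: "filt n 1" "filt n 0" for n using filt_mul[of 1 n] filt_mul[of 0 n] by simp_all
  show "filt (Suc n) dy" "filt (Suc n) Er" "filt (Suc (Suc n)) L0"
    using filt_dy[OF 1(1)] filt_Er[OF 1(1)] filt_L0[OF 1(1)] by simp_all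
qed

lemma filt_times:
  assumes "filt m D" "filt n D'"
  shows "filt (m + n) (D * D')"
  using assms(1)
proof induction
  case (filt_mul a m)
  then show ?case
    using filt_mul_times[OF _ filt_mono[OF assms(2)], of a "m + n"] by simp
qed (auto simp: distrib_right mult.assoc intro: filt.intros)

lemma der_perp_pole: "der (perp e) (rconst c / (lin e)\<^sup>2) = 0"
  by (simp add: divide_inverse der_mult der_inverse power2_eq_square)

text \<open>The first order term \<open>der e a * dv e\<close> is not of an allowed form. Dividing
  its coefficient by \<open>lin e\<close> turns \<open>dv e\<close> into \<open>Er\<close>, and the
  quotient is again even and regular if \<open>a\<close> is.\<close>

lemma com_L0_mul: "com L0 (mul a) = mul 2 * (mul (der e a / lin e) * Er) + mul (der e (der e a))"
  by (simp add: L0_def com_diff_left com_dv2_mul Er_def flip: mult.assoc mul_simps)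

lemma com_dy2_mul: "com (dy * dy) (mul a) = mul 2 * (mul (der (perp e) a) * dy) + mul (der (perp e) (der (perp e) a))"
  by (simp add: com_dv2_mul)

lemma com_dy_L0: "com dy L0 = 0"
  by (simp add: L0_def com_diff_right com_mult_right der_perp_pole)

lemma com_dy_Er: "com dy Er = 0"
  by (simp add: Er_def com_mult_right)

text \<open>\<open>L0\<close> has degree -2 in the normal coordinate, whose Euler operator is
  \<open>Er\<close>.\<close>

lemma com_L0_Er: "com L0 Er = 2 * L0"
proof -
  have 1: "com (dv e * dv e) Er = 2 * (dv e * dv e)"
  proof -
    have "com (dv e * dv e) (dv e) = 0" by (simp add: com_def mult.assoc)
    then show ?thesis by (simp add: Er_def com_mult_right com_dv2_mul unit mult.assoc)
  qed
  define r where "r = inverse (lin e)"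
  have r: "der e r = - (r * r)" "lin e * r = 1"
    by (simp_all add: r_def der_inverse unit power2_eq_square divide_inverse)
  have u: "rconst c / (lin e)\<^sup>2 = rconst c * (r * r)"
    by (simp add: divide_inverse power2_eq_square r_def)
  have "lin e * der e (rconst c * (r * r)) = - (2 * rconst c * (lin e * r) * (r * r))"
    by (simp add: der_mult r(1) algebra_simps)
  then have "lin e * der e (rconst c / (lin e)\<^sup>2) = - (2 * (rconst c / (lin e)\<^sup>2))"
    by (simp add: u r(2))
  then have "com (mul (rconst c / (lin e)\<^sup>2)) Er = - mul (- (2 * (rconst c / (lin e)\<^sup>2)))"
    by (simp only: Er_def com_mult_right com_mul_mul com_mul_dv mult_zero_left add_0 mult_minus_right
        flip: mul_simps(6))
  then have "com (mul (rconst c / (lin e)\<^sup>2)) Er = 2 * mul (rconst c / (lin e)\<^sup>2)"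
    by (simp only: mul_simps minus_minus mul_numeral)
  then show ?thesis using 1 by (simp add: L0_def com_diff_left algebra_simps)
qed

text \<open>This relation keeps normal forms down to one factor \<open>Er\<close>. The square of
  \<open>lin e\<close> clears the pole of \<open>L0\<close> and leaves the constant
  \<open>c\<close>.\<close>

lemma Er_Er: "Er * Er = mul ((lin e)\<^sup>2) * L0 + mul (rconst c) + Er"
  by (rule endo_eqI) (simp add: Er_def L0_def der_mult unit algebra_simps power2_eq_square)

context
  fixes v :: ratfun
  assumes v: "even_fn v"
begin

abbreviation Lv :: endo where
  "Lv \<equiv> L0 + dy * dy - mul v"

text \<open>In every case the weight exceeds that of the generator by at most 1, although
  \<open>Lv\<close> itself has weight 2: the analogue of \<open>ordlt_com\<close> for
  weights.\<close>

lemma com_Lv_generators: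
  "even_fn a \<Longrightarrow> filt 1 (com Lv (mul a))" "filt 0 (com Lv dy)" "filt 2 (com Lv Er)"
  "filt 1 (com Lv L0)"
proof -
  have L0a: "filt 1 (com L0 (mul a))" if "even_fn a" for a
    unfolding com_L0_mul using even_fn_closed[OF that] filt_basic[of 0]
    by (intro filt_add filt_mul_times filt_mul) simp_all
  have dya: "filt 1 (com (dy * dy) (mul a))" if "even_fn a" for a
    unfolding com_dy2_mul using even_fn_closed[OF that] filt_basic[of 0]
      even_fn_closed(3)[OF even_fn_closed(3)[OF that]]
    by (intro filt_add filt_mul_times filt_mul) simp_all
  show "filt 1 (com Lv (mul a))" if "even_fn a"
    using filt_add[OF L0a[OF that] dya[OF that]] by (simp add: com_add_left com_diff_left)
  have L0dy: "com L0 dy = 0" using com_dy_L0 com_anti[of L0 dy] by simp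
  then have "com Lv dy = mul (der (perp e) v)"
    by (simp add: com_add_left com_diff_left com_mult_left com_mul_dv)
  then show "filt 0 (com Lv dy)" using even_fn_closed(3)[OF v] by (simp add: filt_mul)
  have "com Lv Er = mul 2 * L0 + mul (lin e * der e v)"
    by (simp add: com_add_left com_diff_left com_mult_left com_L0_Er com_dy_Er)
      (simp add: Er_def com_mult_right com_mul_dv)
  moreover have "filt 2 (mul 2 * L0 + mul (lin e * der e v))"
    using even_fn_closed(4)[OF v] filt_basic(5)[of 0]
    by (intro filt_add filt_mul_times filt_mul) (simp_all add: numeral_2_eq_2)
  ultimately show "filt 2 (com Lv Er)" by simp
  have "com Lv L0 = com L0 (mul v)"
    using com_anti[of "mul v" L0] by (simp add: com_add_left com_diff_left com_mult_left com_dy_L0)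
  then show "filt 1 (com Lv L0)" using L0a[OF v] by simp
qed

text \<open>\<open>com Lv\<close> is a derivation, so the bounds for the generators pass to words in
  them.\<close>

lemma filt_com_Lv:
  assumes "filt m D"
  shows "filt (Suc m) (com Lv D)"
  using assms
proof induction
  case (filt_mul a m)
  then show ?case using filt_mono[OF com_Lv_generators(1)] by simp
next
  case (filt_add m D D')
  then show ?case by (simp only: com_add_right filt.filt_add)
next
  case (filt_mul_times a m D)
  then show ?case
    using filt_times[OF com_Lv_generators(1) filt_mul_times(2), of a]
    by (auto simp only: com_mult_right plus_1_eq_Suc intro: filt.intros)
next
  case (filt_dy m D)
  have "filt (Suc (Suc m)) (com Lv dy * D)"
    using filt_mono[OF filt_times[OF com_Lv_generators(2) filt_dy(1)]] by simp
  then show ?case unfolding com_mult_right using filt_dy.IH by (intro filt_add filt.filt_dy)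
next
  case (filt_Er m D)
  have "filt (Suc (Suc m)) (com Lv Er * D)"
    using filt_times[OF com_Lv_generators(3) filt_Er(1)] by simp
  then show ?case unfolding com_mult_right using filt_Er.IH by (intro filt_add filt.filt_Er)
next
  case (filt_L0 m D)
  have "filt (Suc (Suc (Suc m))) (com Lv L0 * D)"
    using filt_mono[OF filt_times[OF com_Lv_generators(4) filt_L0(1)]] by simp
  then show ?case unfolding com_mult_right using filt_L0.IH by (intro filt_add filt.filt_L0)
next
  case (filt_Suc m D)
  show ?case by (rule filt.filt_Suc) (rule filt_Suc.IH)
qed

end

section \<open>Normal forms in the filtered algebra\<close>

definition B :: "nat \<Rightarrow> nat \<Rightarrow> endo" where
  "B p l = (if even p then 1 else Er) * (L0 ^ (p div 2) * dy ^ l)"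

lemma filt_L0_dy: "filt (2 * i + l) (L0 ^ i * dy ^ l)"
proof (induction i)
  case 0
  show ?case
    by (induction l) (simp_all add: filt_basic filt_dy)
next
  case (Suc i)
  then show ?case using filt_L0[OF Suc] by (simp add: mult.assoc)
qed

lemma filt_B: "filt (p + l) (B p l)"
proof (cases "even p")
  case True
  then show ?thesis using filt_L0_dy[of "p div 2" l] by (simp add: B_def)
next
  case False
  then have "Suc (2 * (p div 2) + l) = p + l" by presburger
  then have "filt (p + l) (Er * (L0 ^ (p div 2) * dy ^ l))"
    using filt_Er[OF filt_L0_dy[of "p div 2" l]] by (simp only:)
  then show ?thesis using False by (simp add: B_def)
qed

lemma dy_B: "dy * B p l = B p (Suc l)"
proof -
  have "dy * L0 ^ i = L0 ^ i * dy" for i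
    by (rule power_commuting_commutes[symmetric]) (use com_dy_L0 in \<open>simp add: com_eq_0_iff\<close>)
  then have "dy * (L0 ^ i * dy ^ l) = L0 ^ i * dy ^ Suc l" for i
    by (simp flip: mult.assoc)
  moreover have "dy * (Er * X) = Er * (dy * X)" for X
    using com_dy_Er by (simp add: com_eq_0_iff flip: mult.assoc)
  ultimately show ?thesis by (simp add: B_def)
qed

text \<open>\<open>B p l\<close> has order p across the mirror and l along it. For odd p it already
  contains an \<open>Er\<close>, and the square is rewritten by \<open>Er_Er\<close>, at the price
  of the coefficient \<open>(lin e)\<^sup>2\<close>.\<close>

lemma Er_B:
  "\<exists>b R. even_fn b \<and> filt (p + l) R \<and> Er * B p l = mul b * B (Suc p) l + R"
proof (cases "even p")
  case True
  then have "Er * B p l = mul 1 * B (Suc p) l + 0" by (simp add: B_def)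
  then show ?thesis using filt_basic(2) even_fn_const(3) by blast
next
  case False
  define X where "X = L0 ^ (p div 2) * dy ^ l"
  have "even (Suc p)" "Suc p div 2 = Suc (p div 2)" using False by presburger+
  then have "Er * B p l = mul ((lin e)\<^sup>2) * B (Suc p) l + (mul (rconst c) * X + B p l)"
    using False by (simp add: B_def Er_Er distrib_right X_def flip: mult.assoc)
  moreover have "filt (p + l) X"
    unfolding X_def by (rule filt_mono[OF filt_L0_dy]) auto
  then have "filt (p + l) (mul (rconst c) * X + B p l)"
    by (intro filt_add filt_mul_times filt_B) simp_all
  ultimately show ?thesis using even_fn_closed(7)[OF even_fn_const(2)] by blast
qed

lemma L0_B:
  "\<exists>R. filt (Suc (p + l)) R \<and> L0 * B p l = B (Suc (Suc p)) l + R"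
proof (cases "even p")
  case True
  then have "L0 * B p l = B (Suc (Suc p)) l + 0" by (simp add: B_def mult.assoc)
  then show ?thesis using filt_basic(2) by blast
next
  case False
  have L0Er: "L0 * Er = Er * L0 + mul 2 * L0"
    using com_L0_Er by (simp add: com_def algebra_simps)
  have *: "even (Suc p)" "Suc p div 2 = Suc (p div 2)" using False by presburger+
  have "L0 * B p l = (L0 * Er) * (L0 ^ (p div 2) * dy ^ l)"
    using False by (simp add: B_def mult.assoc)
  also have "\<dots> = B (Suc (Suc p)) l + mul 2 * B (Suc p) l"
    unfolding L0Er using False * by (simp add: B_def distrib_right mult.assoc)
  finally show ?thesis
    using filt_mul_times[OF even_fn_const(4) filt_B[of "Suc p" l]] by auto
qed

text \<open>The counterpart of \<open>ordlt\<close> for weights: weight below m, where only the zero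
  operator lies below 0.\<close>

definition lower :: "nat \<Rightarrow> endo \<Rightarrow> bool" where
  "lower m D \<longleftrightarrow> (case m of 0 \<Rightarrow> D = 0 | Suc n \<Rightarrow> filt n D)"

lemma lower_simps [simp]: "lower 0 D \<longleftrightarrow> D = 0" "lower (Suc n) D \<longleftrightarrow> filt n D"
  by (simp_all add: lower_def)

lemma lower_add: "lower m D \<Longrightarrow> lower m E \<Longrightarrow> lower m (D + E)"
  by (cases m) (auto intro: filt_add)

lemma lower_mul_times: "even_fn a \<Longrightarrow> lower m D \<Longrightarrow> lower m (mul a * D)"
  by (cases m) (auto intro: filt_mul_times)

definition normal :: "nat \<Rightarrow> endo \<Rightarrow> bool" where
  "normal m D \<longleftrightarrow> (\<exists>a R. (\<forall>p. even_fn (a p)) \<and> lower m R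
      \<and> D = (\<Sum>p\<le>m. mul (a p) * B p (m - p)) + R)"

lemma normal_lower: "lower m R \<Longrightarrow> normal m R"
  unfolding normal_def by (intro exI[of _ "\<lambda>p. 0"] exI[of _ R]) simp

lemma normal_add:
  assumes "normal m D" "normal m E"
  shows "normal m (D + E)"
proof -
  obtain a R where 1: "\<And>p. even_fn (a p)" "lower m R"
    "D = (\<Sum>p\<le>m. mul (a p) * B p (m - p)) + R"
    using assms(1) unfolding normal_def by blast
  obtain b S where 2: "\<And>p. even_fn (b p)" "lower m S"
    "E = (\<Sum>p\<le>m. mul (b p) * B p (m - p)) + S"
    using assms(2) unfolding normal_def by blast
  note * = 1 2
  have "D + E = (\<Sum>p\<le>m. mul (a p + b p) * B p (m - p)) + (R + S)"
    unfolding *(3,6) by (simp add: distrib_right sum.distrib)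
  moreover have "even_fn (a p + b p)" for p using * even_fn_closed(1) by blast
  ultimately show ?thesis unfolding normal_def using lower_add[OF *(2,5)]
    by (intro exI[of _ "\<lambda>p. a p + b p"] exI[of _ "R + S"]) simp
qed

lemma normal_mul_times:
  assumes b: "even_fn b" and "normal m D"
  shows "normal m (mul b * D)"
proof -
  obtain a R where *: "\<And>p. even_fn (a p)" "lower m R"
    "D = (\<Sum>p\<le>m. mul (a p) * B p (m - p)) + R"
    using assms(2) unfolding normal_def by blast
  have "mul b * D = (\<Sum>p\<le>m. mul (b * a p) * B p (m - p)) + mul b * R"
    unfolding *(3) by (simp add: distrib_left sum_distrib_left mult.assoc)
  moreover have "even_fn (b * a p)" for p using * b even_fn_closed(2) by blast
  ultimately show ?thesis unfolding normal_def using lower_mul_times[OF b *(2)]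
    by (intro exI[of _ "\<lambda>p. b * a p"] exI[of _ "mul b * R"]) simp
qed

lemma normal_sum: "(\<And>x. x \<in> A \<Longrightarrow> normal m (D x)) \<Longrightarrow> normal m (sum D A)"
proof (induction A rule: infinite_finite_induct)
  case (insert x A)
  then show ?case by (simp add: normal_add)
qed (auto intro!: normal_lower simp: lower_def filt_basic split: nat.split)

lemma normal_B: "normal (p + l) (B p l)"
proof -
  have "(\<Sum>q\<le>p + l. mul (if q = p then 1 else 0) * B q (p + l - q))
      = (\<Sum>q\<le>p + l. if q = p then B p l else 0)"
    by (rule sum.cong) auto
  then have "B p l = (\<Sum>q\<le>p + l. mul (if q = p then 1 else 0) * B q (p + l - q)) + 0"
    by simp
  moreover have "lower (p + l) 0" by (simp add: lower_def filt_basic split: nat.split)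
  moreover have "\<forall>q. even_fn (if q = p then 1 else 0)" by simp
  ultimately show ?thesis unfolding normal_def
    by (intro exI[of _ "\<lambda>q. if q = p then 1 else 0"] exI[of _ 0]) blast
qed

text \<open>One step for all three generators; \<open>G\<close> has weight d + 1. Moving
  \<open>G\<close> past a coefficient costs a commutator of weight at most d, which falls into the
  remainder.\<close>

lemma normal_step:
  assumes com: "\<And>a. even_fn a \<Longrightarrow> filt d (com G (mul a))"
    and B: "\<And>p l. normal (Suc (p + l + d)) (G * B p l)"
    and filt: "\<And>n R. filt n R \<Longrightarrow> filt (Suc (n + d)) (G * R)"
    and D: "normal m D"
  shows "normal (Suc (m + d)) (G * D)"
proof -
  obtain a R where *: "\<And>p. even_fn (a p)" "lower m R"
    "D = (\<Sum>p\<le>m. mul (a p) * B p (m - p)) + R"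
    using D unfolding normal_def by blast
  have "normal (Suc (m + d)) (G * (mul (a p) * B p (m - p)))" if "p \<le> m" for p
  proof -
    have eq: "G * (mul (a p) * B p (m - p)) = mul (a p) * (G * B p (m - p)) + com G (mul (a p)) * B p (m - p)"
      by (simp add: com_def algebra_simps)
    show ?thesis
      unfolding eq
    proof (rule normal_add)
      show "normal (Suc (m + d)) (mul (a p) * (G * B p (m - p)))"
        using B[of p "m - p"] that *(1) by (intro normal_mul_times) simp_all
      have "filt (d + (p + (m - p))) (com G (mul (a p)) * B p (m - p))"
        by (intro filt_times com filt_B *)
      then show "normal (Suc (m + d)) (com G (mul (a p)) * B p (m - p))"
        using that by (intro normal_lower) (simp add: add.commute)
    qed
  qed
  then have "normal (Suc (m + d)) (\<Sum>p\<le>m. G * (mul (a p) * B p (m - p)))"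
    by (intro normal_sum) simp
  moreover have "normal (Suc (m + d)) (G * R)"
  proof (rule normal_lower)
    show "lower (Suc (m + d)) (G * R)"
      using *(2) filt by (cases m) (auto simp: filt_basic)
  qed
  ultimately show ?thesis
    unfolding *(3) distrib_left sum_distrib_left by (rule normal_add)
qed

lemma filt_normal:
  assumes "filt m D"
  shows "normal m D"
  using assms
proof induction
  case (filt_mul a m)
  show ?case
  proof (cases m)
    case 0
    then show ?thesis using normal_mul_times[OF filt_mul normal_B[of 0 0]] by (simp add: B_def)
  next
    case (Suc n)
    then show ?thesis using filt.filt_mul[OF filt_mul] by (intro normal_lower) simp
  qed
next
  case (filt_dy m D)
  have "normal (Suc (m + 0)) (dy * D)"
  proof (rule normal_step[OF _ _ _ filt_dy.IH])
    show "filt 0 (com dy (mul a))" if "even_fn a" for a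
      using even_fn_closed(3)[OF that] by (simp add: filt.filt_mul)
    show "normal (Suc (p + l + 0)) (dy * B p l)" for p l
      using normal_B[of p "Suc l"] by (simp add: dy_B)
  qed (simp add: filt.filt_dy)
  then show ?case by simp
next
  case (filt_Er m D)
  have "normal (Suc (m + 0)) (Er * D)"
  proof (rule normal_step[OF _ _ _ filt_Er.IH])
    show "filt 0 (com Er (mul a))" if "even_fn a" for a
      using even_fn_closed(4)[OF that] filt.filt_mul[of "lin e * der e a" 0]
      by (simp add: Er_def com_mult_left)
    show "normal (Suc (p + l + 0)) (Er * B p l)" for p l
    proof -
      obtain b R where b: "even_fn b" "filt (p + l) R" "Er * B p l = mul b * B (Suc p) l + R"
        using Er_B by blast
      have "normal (Suc (p + l)) (mul b * B (Suc p) l)"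
        using normal_mul_times[OF b(1) normal_B[of "Suc p" l]] by simp
      then show ?thesis unfolding b(3) using normal_lower[of "Suc (p + l)" R] b(2)
        by (simp add: normal_add)
    qed
  qed (simp add: filt.filt_Er)
  then show ?case by simp
next
  case (filt_L0 m D)
  have "normal (Suc (m + 1)) (L0 * D)"
  proof (rule normal_step[OF _ _ _ filt_L0.IH])
    show "filt 1 (com L0 (mul a))" if "even_fn a" for a
      unfolding com_L0_mul using even_fn_closed[OF that] filt_basic(4)[of 0]
      by (intro filt_add filt_mul_times filt.filt_mul) simp_all
    show "normal (Suc (p + l + 1)) (L0 * B p l)" for p l
    proof -
      obtain R where R: "filt (Suc (p + l)) R" "L0 * B p l = B (Suc (Suc p)) l + R"
        using L0_B by blast
      then show ?thesis using normal_lower[of "Suc (Suc (p + l))" R] normal_B[of "Suc (Suc p)" l]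
        by (simp add: normal_add)
    qed
  qed (simp add: filt.filt_L0)
  then show ?case by simp
next
  case (filt_Suc m D)
  then show ?case by (intro normal_lower) simp
qed (auto intro: normal_add normal_mul_times)

lemma ordlt_Er: "ordlt 2 Er"
  using ordlt_mul_times[OF ordlt_dv[of 0 e], of "lin e"] by (simp add: Er_def numeral_2_eq_2)

lemma ordlt_L0: "ordlt 3 L0"
  unfolding L0_def using ordlt_dv_power[of 2 e] ordlt_mul[of 2]
  by (intro ordlt_diff) (simp_all add: power2_eq_square numeral_3_eq_3 numeral_2_eq_2)

lemma filt_ordlt: "filt m D \<Longrightarrow> ordlt (Suc m) D"
proof (induction rule: filt.induct)
  case (filt_dy m D)
  then show ?case using ordlt_times[OF ordlt_dv[of 0 "perp e"] filt_dy.IH] by simp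
next
  case (filt_Er m D)
  then show ?case using ordlt_times[OF ordlt_Er filt_Er.IH] by simp
next
  case (filt_L0 m D)
  then show ?case using ordlt_times[OF ordlt_L0 filt_L0.IH] by (simp add: numeral_3_eq_3)
qed (auto intro: ordlt_mul ordlt_add ordlt_mul_times ordlt_Suc)

lemma lower_ordlt: "lower m D \<Longrightarrow> ordlt m D"
  by (cases m) (auto intro: filt_ordlt)

lemma L0_power_symbol: "ordlt (2 * i) (L0 ^ i - dv e ^ (2 * i))"
proof (induction i)
  case (Suc i)
  have eq: "L0 ^ Suc i - dv e ^ (2 * Suc i)
      = L0 * (L0 ^ i - dv e ^ (2 * i)) + (L0 - dv e * dv e) * dv e ^ (2 * i)"
    by (simp add: algebra_simps)
  have "L0 - dv e * dv e = mul (- (rconst c / (lin e)\<^sup>2))"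
    unfolding mul_simps by (simp add: L0_def)
  then have "ordlt (Suc 0) (L0 - dv e * dv e)" by (simp only: ordlt_mul)
  then have "ordlt (2 * Suc i) ((L0 - dv e * dv e) * dv e ^ (2 * i))"
    using ordlt_times[OF _ ordlt_dv_power[of "2 * i" e]] ordlt_Suc by fastforce
  moreover have "ordlt (2 * Suc i) (L0 * (L0 ^ i - dv e ^ (2 * i)))"
    using ordlt_times[OF ordlt_L0 Suc.IH] by simp
  ultimately show ?case unfolding eq by (intro ordlt_add)
qed simp

text \<open>The leading coefficient of \<open>B p l\<close>; the factor \<open>lin e\<close> comes
  from the single \<open>Er\<close> present for odd p.\<close>

definition tau :: "nat \<Rightarrow> ratfun" where
  "tau p = (if even p then 1 else lin e)"

lemma B_symbol: "ordlt (p + l) (B p l - mul (tau p) * (dv e ^ p * dy ^ l))"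
proof -
  define i where "i = p div 2"
  have D: "ordlt (2 * i + l) ((L0 ^ i - dv e ^ (2 * i)) * dy ^ l)"
    using ordlt_times[OF L0_power_symbol ordlt_dv_power[of l "perp e"], of i] by simp
  show ?thesis
  proof (cases "even p")
    case True
    then have "p = 2 * i" by (simp add: i_def)
    then show ?thesis using D by (simp add: B_def tau_def left_diff_distrib)
  next
    case False
    then have p: "p = Suc (2 * i)" unfolding i_def by presburger
    have "B p l - mul (tau p) * (dv e ^ p * dy ^ l) = Er * ((L0 ^ i - dv e ^ (2 * i)) * dy ^ l)"
      unfolding p by (simp add: B_def tau_def algebra_simps) (simp add: Er_def mult.assoc)
    then show ?thesis using ordlt_times[OF ordlt_Er D] by (simp add: p)
  qed
qed

lemma ad_power:
  "ad e (dv e ^ Suc n) = of_nat (Suc n) * dv e ^ n" "ad e (dy ^ n) = 0"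
  "ad (perp e) (dy ^ Suc n) = of_nat (Suc n) * dy ^ n" "ad (perp e) (dv e ^ n) = 0"
proof -
  have *: "ad v (dv v ^ Suc n) = of_nat (Suc n) * dv v ^ n" if "bil v v = 1" for v n
  proof (induction n)
    case (Suc n)
    have "ad v (dv v ^ Suc (Suc n)) = dv v * ad v (dv v ^ Suc n) + dv v ^ Suc n"
      by (subst power_Suc) (simp add: that del: power_Suc)
    then show ?case unfolding Suc.IH by (simp add: mult_of_nat_commute algebra_simps)
  qed (simp add: that)
  show "ad e (dv e ^ Suc n) = of_nat (Suc n) * dv e ^ n"
    "ad (perp e) (dy ^ Suc n) = of_nat (Suc n) * dy ^ n"
    by (rule *; simp add: unit)+
  show "ad e (dy ^ n) = 0" "ad (perp e) (dv e ^ n) = 0"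
    using ad_of_nat[of _ 1] by (induction n) simp_all
qed

text \<open>Among monomials of the same total degree exactly one survives, so repeated commutators
  are coordinates on symbols.\<close>

lemma mu_monomial:
  "i + j = p + l \<Longrightarrow> mu e (perp e) i j (dv e ^ p * dy ^ l) = of_nat (if i = p then fact p * fact l else 0)"
proof (induction "i + j" arbitrary: i j p l)
  case 0
  then show ?case by simp
next
  case (Suc n)
  have mu_nat: "mu e (perp e) i j (of_nat k * X) = of_nat k * mu e (perp e) i j X" for i j k X
    using mu_mul_times[of e "perp e" i j "of_nat k"] by simp
  show ?case
  proof (cases i)
    case (Suc i')
    have "mu e (perp e) i j (dv e ^ p * dy ^ l) = mu e (perp e) i' j (ad e (dv e ^ p * dy ^ l))"
      by (simp only: Suc mu_ad)
    also have "\<dots> = of_nat (if i = p then fact p * fact l else 0)"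
    proof (cases p)
      case 0
      then show ?thesis using Suc ad_of_nat[of e 1] by (simp add: ad_power)
    next
      case p: (Suc p')
      have "ad e (dv e ^ p * dy ^ l) = of_nat (Suc p') * (dv e ^ p' * dy ^ l)"
        unfolding p ad_simps ad_power by (simp add: mult.assoc)
      then have "mu e (perp e) i' j (ad e (dv e ^ p * dy ^ l))
          = of_nat (Suc p') * of_nat (if i' = p' then fact p' * fact l else 0)"
        using Suc.hyps(1)[of i' j p' l] Suc.hyps(2) Suc.prems Suc p by (simp only: mu_nat)
      moreover have "Suc p' * (if i' = p' then fact p' * fact l else 0) = (if i = p then fact p * fact l else 0)"
        by (simp add: Suc p algebra_simps)
      ultimately show ?thesis by (simp only: flip: of_nat_mult)
    qed
    finally show ?thesis .
  next
    case 0
    then obtain j' where j: "j = Suc j'" using Suc.hyps(2) by (cases j) auto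
    have "mu e (perp e) i j (dv e ^ p * dy ^ l) = mu e (perp e) i j' (ad (perp e) (dv e ^ p * dy ^ l))"
      by (simp only: j mu_ad)
    also have "\<dots> = of_nat (if i = p then fact p * fact l else 0)"
    proof (cases l)
      case 0
      then show ?thesis using \<open>i = 0\<close> Suc.prems j ad_of_nat[of "perp e" 1] by (simp add: ad_power)
    next
      case l: (Suc l')
      have "ad (perp e) (dv e ^ p * dy ^ l) = of_nat (Suc l') * (dv e ^ p * dy ^ l')"
      proof -
        have "dv e ^ p * (of_nat (Suc l') * dy ^ l') = of_nat (Suc l') * (dv e ^ p * dy ^ l')"
          by (metis mult.assoc mult_of_nat_commute)
        then show ?thesis unfolding l ad_simps ad_power by (simp del: of_nat_Suc)
      qed
      then have "mu e (perp e) i j' (ad (perp e) (dv e ^ p * dy ^ l))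
          = of_nat (Suc l') * of_nat (if i = p then fact p * fact l' else 0)"
        using Suc.hyps(1)[of i j' p l'] Suc.hyps(2) Suc.prems l j by (simp only: mu_nat)
      moreover have "Suc l' * (if i = p then fact p * fact l' else 0) = (if i = p then fact p * fact l else 0)"
        by (simp add: l algebra_simps)
      ultimately show ?thesis by (simp only: flip: of_nat_mult)
    qed
    finally show ?thesis .
  qed
qed

lemma filt_symbol:
  assumes "filt m D"
  obtains a where "\<And>p. even_fn (a p)" "lower m (D - (\<Sum>p\<le>m. mul (a p) * B p (m - p)))"
    "ordlt m (D - (\<Sum>p\<le>m. mul (a p * tau p) * (dv e ^ p * dy ^ (m - p))))"
proof -
  obtain a R where *: "\<And>p. even_fn (a p)" "lower m R"
    "D = (\<Sum>p\<le>m. mul (a p) * B p (m - p)) + R"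
    using filt_normal[OF assms] unfolding normal_def by blast
  have eq: "D - (\<Sum>p\<le>m. mul (a p * tau p) * (dv e ^ p * dy ^ (m - p)))
      = (\<Sum>p\<le>m. mul (a p) * (B p (m - p) - mul (tau p) * (dv e ^ p * dy ^ (m - p)))) + R"
    unfolding *(3) by (simp add: right_diff_distrib sum_subtractf mult.assoc)
  have "ordlt m (mul (a p) * (B p (m - p) - mul (tau p) * (dv e ^ p * dy ^ (m - p))))" if "p \<le> m" for p
    using B_symbol[of p "m - p"] that by (intro ordlt_mul_times) simp
  then have "ordlt m (D - (\<Sum>p\<le>m. mul (a p * tau p) * (dv e ^ p * dy ^ (m - p))))"
    unfolding eq using lower_ordlt[OF *(2)] by (intro ordlt_add ordlt_sum) auto
  then show ?thesis using that[of a] * by simp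
qed

text \<open>If the order is below m, the leading terms of the normal form cancel. Their monomials
  are independent and \<open>tau\<close> is nonzero, so all coefficients \<open>a p\<close> vanish
  and only the lower remainder is left.\<close>

lemma filt_drop:
  assumes "filt m D" "ordlt m D"
  shows "lower m D"
proof -
  obtain a where a: "\<And>p. even_fn (a p)" "lower m (D - (\<Sum>p\<le>m. mul (a p) * B p (m - p)))"
    "ordlt m (D - (\<Sum>p\<le>m. mul (a p * tau p) * (dv e ^ p * dy ^ (m - p))))"
    using filt_symbol[OF assms(1)] by blast
  define S where "S = (\<Sum>p\<le>m. mul (a p * tau p) * (dv e ^ p * dy ^ (m - p)))"
  have S: "ordlt m S" using ordlt_diff[OF assms(2) a(3)] by (simp add: S_def)
  have "a q = 0" if "q \<le> m" for q
  proof -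
    have z: "mu e (perp e) q (m - q) S = 0" using mu_eq_0[of q "m - q" S] S that by simp
    have "mu e (perp e) q (m - q) S
        = (\<Sum>p\<le>m. mul (a p * tau p) * of_nat (if q = p then fact p * fact (m - p) else 0))"
      unfolding S_def mu_sum mu_mul_times using that by (intro sum.cong) (simp_all add: mu_monomial)
    also have "\<dots> = (\<Sum>p\<le>m. if q = p then mul (a q * tau q) * of_nat (fact q * fact (m - q)) else 0)"
      by (intro sum.cong) auto
    also have "\<dots> = mul (a q * tau q) * of_nat (fact q * fact (m - q))"
      using that by (simp only: sum.delta' finite_atMost atMost_iff if_True)
    also have "\<dots> = mul (a q * tau q * of_nat (fact q * fact (m - q)))"
      by (simp only: mul_simps(6) mul_of_nat)
    finally have "mul (a q * tau q * of_nat (fact q * fact (m - q))) = 0"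
      unfolding z by (rule sym)
    then have "a q * tau q * of_nat (fact q * fact (m - q)) = 0" by (simp only: mul_eq_0_iff)
    moreover have "tau q \<noteq> 0" by (simp add: tau_def)
    moreover have "(of_nat (fact q * fact (m - q)) :: ratfun) \<noteq> 0"
      by (simp only: of_nat_eq_0_iff) simp
    ultimately show ?thesis by simp
  qed
  then show ?thesis using a(2) by simp
qed

text \<open>The leading part \<open>S\<close> is built from derivatives and multiplications by
  regular functions. It preserves regular functions, and so do its commutators with linear forms;
  this reaches the frame \<open>e1\<close>, \<open>e2\<close> without a change of basis.\<close>

lemma filt_symbol_reg_top:
  assumes "filt (i + j) D"
  shows "reg (app (mu e1 e2 i j D) 1)"
proof -
  define m where "m = i + j"
  obtain a where a: "\<And>p. even_fn (a p)"
    "ordlt m (D - (\<Sum>p\<le>m. mul (a p * tau p) * (dv e ^ p * dy ^ (m - p))))"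
    using filt_symbol[OF assms[folded m_def]] by blast
  define S where "S = (\<Sum>p\<le>m. mul (a p * tau p) * (dv e ^ p * dy ^ (m - p)))"
  define G where "G D \<longleftrightarrow> (\<forall>f. reg f \<longrightarrow> reg (app D f))" for D
  have G_times: "G (D * E)" if "G D" "G E" for D E
    using that by (simp add: G_def)
  have G_power: "G (D ^ n)" if "G D" for D n
    using that by (induction n) (simp_all add: G_times, simp add: G_def)
  have G_dv: "G (dv v)" for v
    by (auto simp: G_def)
  have "reg (a p * tau p)" for p
    using a(1)[of p] by (auto simp: even_fn_def tau_def)
  then have "G (mul (a p * tau p))" for p
    unfolding G_def app_simps by (blast intro: reg_mult)
  then have "G (mul (a p * tau p) * (dv e ^ p * dy ^ (m - p)))" for p
    by (intro G_times G_power G_dv)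
  then have "G S"
    unfolding G_def S_def app_sum by (blast intro: reg_sum)
  have G_ad: "G (ad u D)" if "G D" for u D
    unfolding G_def ad_def com_def app_simps
  proof (intro allI impI)
    fix f assume f: "reg f"
    show "reg (app D (lin u * f) - lin u * app D f)"
      using that reg_mult[OF reg_lin f] f unfolding G_def by (intro reg_diff reg_mult[OF reg_lin]) blast+
  qed
  have "G ((ad u ^^ n) D)" if "G D" for u D n
    using that by (induction n) (simp_all add: G_ad)
  then have "G (mu e1 e2 i j S)" using \<open>G S\<close> by (simp add: mu_def)
  then have "reg (app (mu e1 e2 i j S) 1)" by (simp add: G_def)
  moreover have "mu e1 e2 i j (D - S) = 0"
    using a(2) by (intro mu_eq_0) (simp add: S_def m_def)
  ultimately show ?thesis by (simp add: mu_diff)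
qed

text \<open>As long as the weight exceeds i + j, \<open>filt_drop\<close> lowers it; once they agree
  the previous lemma applies. A weight below i + j makes the coefficient 0.\<close>

lemma filt_symbol_reg:
  assumes "filt m D" "ordlt (Suc (i + j)) D"
  shows "reg (app (mu e1 e2 i j D) 1)"
  using assms
proof (induction m arbitrary: D rule: less_induct)
  case (less m D)
  consider "m < i + j" | "m = i + j" | "i + j < m" by linarith
  then show ?case
  proof cases
    case 1
    then have "ordlt (i + j) D"
      using ordlt_mono[OF filt_ordlt[OF less.prems(1)]] by simp
    then show ?thesis by (simp add: mu_eq_0)
  next
    case 2
    then show ?thesis using filt_symbol_reg_top less.prems by simp
  next
    case 3
    then obtain n where n: "m = Suc n" by (cases m) auto
    have "lower m D" using filt_drop[OF less.prems(1) ordlt_mono[OF less.prems(2)]] 3 by simp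
    then show ?thesis using less.IH[of n D] less.prems n by simp
  qed
qed

text \<open>\<open>lap - mul w\<close> is \<open>Lv\<close>, whose commutators raise the weight by
  1, and \<open>g\<close> has weight 0. No integrality of a multiplicity enters, as \<open>c\<close>
  is arbitrary.\<close>

lemma reflection_symbol:
  assumes w: "w = rconst c / (lin e)\<^sup>2 + v" and v: "even_fn v" and g: "even_fn g"
    and X: "X = (com (lap - mul w) ^^ n) (mul g)" and ord: "ordlt (Suc (i + j)) X"
  shows "reg (app (mu e1 e2 i j X) 1)"
proof -
  have L: "lap - mul w = L0 + dy * dy - mul v"
    unfolding w mul_simps by (simp add: lap_unit L0_def)
  have "filt n ((com (lap - mul w) ^^ n) (mul g))"
  proof (induction n)
    case 0
    show ?case using g by (simp add: filt_mul)
  next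
    case (Suc n)
    then show ?case unfolding L using filt_com_Lv[OF v] by simp
  qed
  then show ?thesis using filt_symbol_reg ord X by blast
qed

end

section \<open>The ladder generated by a homogeneous polynomial\<close>

lemma minimal_ordlt:
  assumes "ordlt (Suc n) D" "D \<noteq> 0"
  obtains m where "m \<le> n" "ordlt (Suc m) D" "\<not> ordlt m D"
proof -
  have "\<exists>m\<le>n. ordlt (Suc m) D \<and> \<not> ordlt m D"
    using assms(1)
  proof (induction n)
    case (Suc n)
    then show ?case by (cases "ordlt (Suc n) D") (auto intro: le_SucI)
  qed (use assms(2) in simp)
  then show ?thesis using that by blast
qed

lemma poly_fn_closed:
  "poly_fn (rconst c)" "poly_fn (lin v)" "poly_fn f \<Longrightarrow> poly_fn g \<Longrightarrow> poly_fn (f + g)"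
  "poly_fn f \<Longrightarrow> poly_fn g \<Longrightarrow> poly_fn (f * g)" "poly_fn f \<Longrightarrow> poly_fn (der v f)"
  unfolding poly_fn_def
  by (metis rconst_def to_fract_linp to_fract_add to_fract_mult der_to_fract)+

lemma poly_fn_1 [simp]: "poly_fn 1"
  using poly_fn_closed(1)[of 1] by simp

lemma poly_fn_power: "poly_fn f \<Longrightarrow> poly_fn (f ^ n)"
  by (induction n) (simp_all add: poly_fn_closed)

lemma poly_fn_prod: "(\<And>x. x \<in> A \<Longrightarrow> poly_fn (f x)) \<Longrightarrow> poly_fn (prod f A)"
  by (induction A rule: infinite_finite_induct) (simp_all add: poly_fn_closed)

locale ladder = schroedinger +
  fixes g :: ratfun and N :: nat
  assumes poly_g: "poly_fn g" and hom_g: "app eul g = of_nat N * g"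
begin

definition X :: "nat \<Rightarrow> endo" where
  "X n = (com L ^^ n) (mul g)"

lemma X_simps: "X 0 = mul g" "X (Suc n) = com L (X n)"
  by (simp_all add: X_def)

lemma com_of_int_mult_right: "com D (of_int z * E) = of_int z * com D E"
  by (simp add: com_mult_right)

lemma ordlt_X: "ordlt (Suc n) (X n)"
proof (induction n)
  case (Suc n)
  then show ?case using ordlt_com[OF ordlt_L Suc] by (simp add: X_simps)
qed (simp add: X_simps ordlt_mul)

lemma com_eul_X: "com eul (X n) = of_int (int N - 2 * int n) * X n"
proof (induction n)
  case (Suc n)
  have "com eul (X (Suc n)) = com (com eul L) (X n) + com L (com eul (X n))"
    unfolding X_simps by (simp add: com_def algebra_simps)
  also have "\<dots> = - (2 * X (Suc n)) + of_int (int N - 2 * int n) * X (Suc n)"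
    unfolding Suc com_eul_L com_of_int_mult_right X_simps
    using com_diff_left[of 0 "2 * L" "X n"] by (simp add: com_mult_left)
  finally show ?case by (simp add: algebra_simps)
qed (simp add: X_simps hom_g)

text \<open>Each commutator with \<open>L\<close> acts on the symbol by 2 (xi, d/dx), so at order n
  the symbol is 2^n times the n-fold derivative of \<open>g\<close> along xi. The binomial
  coefficient and the \<open>i! j!\<close> of \<open>mu\<close> combine to
  \<open>fact n\<close>.\<close>

lemma mu_X: "i + j = n \<Longrightarrow>
    mu e1 e2 i j (X n) = mul (of_nat (2 ^ n * fact n) * (der e1 ^^ i) ((der e2 ^^ j) g))"
proof (induction n arbitrary: i j)
  case 0
  then show ?case by (simp add: X_simps)
next
  case (Suc n)
  define K :: complex where "K = of_nat (2 ^ n * fact n)"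
  have IH: "app (mu e1 e2 i j (X n)) 1 = rconst K * (der e1 ^^ i) ((der e2 ^^ j) g)" if "i + j = n" for i j
    unfolding Suc.IH[OF that] app_simps K_def rconst_of_nat by (simp only: mult_1_right)
  define h where "h = (der e1 ^^ i) ((der e2 ^^ j) g)"
  have 1: "of_nat i * der e1 (app (mu e1 e2 (i - 1) j (X n)) 1) = of_nat i * (rconst K * h)"
  proof (cases i)
    case (Suc i')
    then show ?thesis using Suc.prems by (simp add: IH der_rconst_mult h_def del: of_nat_Suc)
  qed simp
  have 2: "of_nat j * der e2 (app (mu e1 e2 i (j - 1) (X n)) 1) = of_nat j * (rconst K * h)"
  proof (cases j)
    case (Suc j')
    then show ?thesis using Suc.prems
      by (simp add: IH der_rconst_mult h_def der_funpow_commute del: of_nat_Suc)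
  qed simp
  have "mu e1 e2 i j (X (Suc n)) = mul (2 * (of_nat i * (rconst K * h) + of_nat j * (rconst K * h)))"
    unfolding X_simps mu_com_L_top[OF ordlt_X Suc.prems] 1 2 ..
  also have "2 * (of_nat i * (rconst K * h) + of_nat j * (rconst K * h)) = of_nat (2 * (i + j)) * rconst K * h"
    by (simp add: algebra_simps)
  also have "of_nat (2 * (i + j)) * rconst K = of_nat (2 ^ Suc n * fact (Suc n))"
    unfolding Suc.prems K_def rconst_of_nat of_nat_mult[symmetric] by (simp add: algebra_simps)
  finally show ?case by (simp only: h_def)
qed

lemma der_g_eq_0:
  assumes "i + j = Suc N"
  shows "(der e1 ^^ i) ((der e2 ^^ j) g) = 0"
proof -
  have "app eul ((der e1 ^^ i) ((der e2 ^^ j) g)) = of_int (int N - int j - int i) * (der e1 ^^ i) ((der e2 ^^ j) g)"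
    by (intro app_eul_der_funpow) (use hom_g in simp)
  moreover have "poly_fn ((der v ^^ n) f)" if "poly_fn f" for v n f
    using that by (induction n) (simp_all add: poly_fn_closed)
  then have "poly_fn ((der e1 ^^ i) ((der e2 ^^ j) g))" using poly_g by blast
  moreover have "int N - int j - int i < 0" using assms by simp
  ultimately show ?thesis by (intro homogeneous_poly_neg_eq_0)
qed

text \<open>The symbol of order n of rung n consists of n-th derivatives of \<open>g\<close>. They
  vanish at n = N + 1, and commutators with \<open>L\<close> propagate the gain of one
  order.\<close>

lemma ordlt_X_Suc_N: "ordlt (Suc N + n) (X (Suc N + n))"
proof (induction n)
  case 0
  show ?case
  proof (rule ordlt_muI[of e1 e2])
    show "\<exists>c d. u = c *s e1 + d *s e2" for u using plane_expand[of u] by blast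
  qed (simp add: mu_X der_g_eq_0)
next
  case (Suc n)
  then show ?case using ordlt_com[OF ordlt_L Suc] by (simp add: X_simps)
qed

text \<open>
  The symbol of the last non-zero rung has negative degree in the coordinates unless it is the
  rung \<open>N\<close>.
\<close>

lemma X_Suc_N_eq_0:
  assumes "X J = 0"
  shows "X (Suc N) = 0"
proof (rule ccontr)
  assume ne: "X (Suc N) \<noteq> 0"
  have mono: "X (J + n) = 0" for n
    by (induction n) (simp_all add: assms X_simps)
  have "\<exists>n. X (Suc N + n) \<noteq> 0 \<and> X (Suc (Suc N + n)) = 0"
  proof (rule ccontr)
    assume *: "\<not> ?thesis"
    have "X (Suc N + n) \<noteq> 0" for n
      by (induction n) (use ne * in auto)
    then show False using mono[of "Suc N"] by (simp add: add.commute)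
  qed
  then obtain n where n: "X (Suc N + n) \<noteq> 0" "com L (X (Suc N + n)) = 0"
    unfolding X_simps by blast
  have "ordlt (Suc (N + n)) (X (Suc N + n))" using ordlt_X_Suc_N[of n] by simp
  then obtain m where m: "m \<le> N + n" "ordlt (Suc m) (X (Suc N + n))" "\<not> ordlt m (X (Suc N + n))"
    using n(1) by (rule minimal_ordlt)
  have "int N - 2 * int (Suc N + n) + int m < 0" using m(1) by simp
  then show False using commuting_hom_neg_eq_0[OF m(2) n(2) com_eul_X] m(3) by blast
qed

section \<open>The sl_2 action on the rungs\<close>

definition cf :: "nat \<Rightarrow> int" where
  "cf j = - 4 * int j * (int N - int j + 1)"

lemma cf_0: "cf 0 = 0"
  by (simp add: cf_def)

text \<open>Moving \<open>rsq\<close> past one more commutator with \<open>L\<close> adds -4 (N - 2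
  j) by the sl_2 relation, and \<open>cf\<close> is the sum of these numbers. For j = 0 the
  truncated index is multiplied by 0.\<close>

lemma com_rsq_X: "com (mul rsq) (X j) = of_int (cf j) * X (j - 1)"
proof (induction j)
  case (Suc j)
  have "com (mul rsq) (X (Suc j)) = com (com (mul rsq) L) (X j) + com L (com (mul rsq) (X j))"
    unfolding X_simps by (simp add: com_def algebra_simps)
  also have "com (mul rsq) L = - (4 * eul + 4)"
    using com_anti[of "mul rsq" L] com_L_rsq by simp
  also have "com (- (4 * eul + 4)) (X j) = - (4 * com eul (X j))"
    using com_diff_left[of 0 "4 * eul + 4" "X j"] by (simp add: com_add_left com_mult_left)
  also have "com L (com (mul rsq) (X j)) = of_int (cf j) * X j"
    unfolding Suc com_of_int_mult_right by (cases j) (simp_all add: cf_0 X_simps)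
  also have "- (4 * com eul (X j)) + of_int (cf j) * X j = of_int (cf (Suc j)) * X j"
  proof -
    have "- (4 * com eul (X j)) + of_int (cf j) * X j
        = of_int (- (4 * (int N - 2 * int j)) + cf j) * X j"
      unfolding com_eul_X
      by (simp only: of_int_add of_int_minus of_int_mult of_int_numeral distrib_right
          mult_minus_left mult.assoc)
    also have "- (4 * (int N - 2 * int j)) + cf j = cf (Suc j)"
      by (simp add: cf_def algebra_simps)
    finally show ?thesis .
  qed
  finally show ?case by simp
qed (simp add: X_simps cf_def)

text \<open>The recursion makes \<open>com L\<close> of summand i + 1 of \<open>Q\<close> cancel the
  oscillator commutator of summand i; both are multiples of the rung N - 2 i - 1.\<close>

fun weight :: "complex \<Rightarrow> nat \<Rightarrow> complex" where
  "weight \<omega> 0 = 1"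
| "weight \<omega> (Suc i) = \<omega>\<^sup>2 * of_int (cf (N - 2 * i)) * weight \<omega> i"

text \<open>
  Under the adjoint action of the \<open>sl\<^sub>2\<close> spanned by \<open>L\<close>, \<open>rsq\<close> and the Euler operator
  the rungs span an irreducible module of dimension \<open>N + 1\<close>; \<open>Q\<close> is its vector killed by
  \<open>L - \<omega>\<^sup>2 rsq\<close>, which exists because \<open>N\<close> is even.
\<close>

definition Q :: "complex \<Rightarrow> endo" where
  "Q \<omega> = (\<Sum>i\<le>N div 2. mul (rconst (weight \<omega> i)) * X (N - 2 * i))"

lemma com_rconst_mult_right: "com D (mul (rconst c) * E) = mul (rconst c) * com D E"
  by (simp add: com_mult_right)

lemma com_Q:
  assumes "X (Suc N) = 0" "even N"
  shows "com (L - mul (rconst (\<omega>\<^sup>2) * rsq)) (Q \<omega>) = 0"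
proof -
  obtain M where N: "N = 2 * M" using assms(2) by blast
  define b where "b i = mul (rconst (weight \<omega> i))" for i
  have Q: "Q \<omega> = (\<Sum>i\<le>M. b i * X (N - 2 * i))"
  proof -
    have "N div 2 = M" using N by simp
    then show ?thesis by (simp only: Q_def b_def)
  qed
  have "com L (Q \<omega>) = (\<Sum>i\<le>M. b i * X (Suc (N - 2 * i)))"
    by (simp add: Q com_sum_right b_def com_rconst_mult_right X_simps)
  \<comment> \<open>The summand i = 0 is the rung N + 1, which vanishes.\<close>
  also have "\<dots> = (\<Sum>i<M. b (Suc i) * X (Suc (N - 2 * Suc i)))"
    by (subst sum.atMost_shift) (simp add: assms(1))
  also have "\<dots> = (\<Sum>i<M. mul (rconst (\<omega>\<^sup>2)) * (b i * (of_int (cf (N - 2 * i)) * X (N - 2 * i - 1))))"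
  proof (rule sum.cong[OF refl])
    fix i assume "i \<in> {..<M}"
    then have "Suc (N - 2 * Suc i) = N - 2 * i - 1" using N by auto
    moreover have "b (Suc i) = mul (rconst (\<omega>\<^sup>2)) * (b i * of_int (cf (N - 2 * i)))"
    proof -
      have "mul (rconst (of_int m)) = of_int m" for m by (rule endo_eqI) simp
      then have "b (Suc i) = mul (rconst (\<omega>\<^sup>2)) * (of_int (cf (N - 2 * i)) * b i)"
        by (simp only: b_def weight.simps rconst_simps(6) mul_simps(6) mult.assoc)
      then show ?thesis by (simp only: mult_of_int_commute)
    qed
    ultimately show "b (Suc i) * X (Suc (N - 2 * Suc i))
        = mul (rconst (\<omega>\<^sup>2)) * (b i * (of_int (cf (N - 2 * i)) * X (N - 2 * i - 1)))"
      by (simp only: mult.assoc)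
  qed
  \<comment> \<open>The added summand i = M is zero: as N is even it carries the factor
    \<open>cf 0\<close>.\<close>
  also have "\<dots> = (\<Sum>i\<le>M. mul (rconst (\<omega>\<^sup>2)) * (b i * (of_int (cf (N - 2 * i)) * X (N - 2 * i - 1))))"
  proof -
    have "N - 2 * M = 0" using N by simp
    then show ?thesis by (simp add: cf_0 flip: lessThan_Suc_atMost)
  qed
  also have "\<dots> = mul (rconst (\<omega>\<^sup>2)) * com (mul rsq) (Q \<omega>)"
    by (simp add: Q com_sum_right b_def com_rconst_mult_right com_rsq_X sum_distrib_left)
  finally show ?thesis
    by (simp only: com_diff_left mul_simps(6) com_mult_left com_mul_rconst mult_zero_left
        add_0_right diff_self)
qed

lemma ordlt_Q: "ordlt (Suc N) (Q \<omega>)"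
  unfolding Q_def by (intro ordlt_sum ordlt_mul_times ordlt_mono[OF ordlt_X]) simp

text \<open>Repeated commutators with the single form (v, x) evaluate the symbol at xi = v, up to
  the factorial of the order.\<close>

lemma ad_funpow_X: "(ad v ^^ n) (X n) = mul (of_nat (2 ^ n * fact n) * (der v ^^ n) g)"
proof (induction n)
  case (Suc n)
  have "(ad v ^^ Suc n) (X n) = 0"
    using mu_eq_0[of "Suc n" 0 "X n" v v] ordlt_X[of n] by (simp add: mu_def)
  then have "(ad v ^^ Suc n) (X (Suc n))
      = of_nat (2 * Suc n) * com (dv v) (mul (of_nat (2 ^ n * fact n) * (der v ^^ n) g))"
    unfolding X_simps ad_funpow_com_L Suc.IH[symmetric] by simp
  also have "\<dots> = mul (of_nat (2 * Suc n) * der v (of_nat (2 ^ n * fact n) * (der v ^^ n) g))"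
    unfolding com_dv_mul by (simp only: mul_simps(6) mul_of_nat)
  also have "der v (of_nat (2 ^ n * fact n) * (der v ^^ n) g) = of_nat (2 ^ n * fact n) * (der v ^^ Suc n) g"
    using der_rconst_mult[of v "of_nat (2 ^ n * fact n)"] by (simp only: rconst_of_nat funpow.simps comp_apply)
  also have "of_nat (2 * Suc n) * (of_nat (2 ^ n * fact n) * (der v ^^ Suc n) g)
      = of_nat (2 ^ Suc n * fact (Suc n)) * (der v ^^ Suc n) g"
    unfolding mult.assoc[symmetric] of_nat_mult[symmetric] by (simp add: algebra_simps)
  finally show ?case .
qed (simp add: X_simps)

lemma ad_funpow_Q: "(ad v ^^ N) (Q \<omega>) = mul (of_nat (2 ^ N * fact N) * (der v ^^ N) g)"
proof -
  have "mu v v N 0 (X (N - 2 * l)) = 0" if "l \<in> {..N div 2} - {0}" for l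
    using that by (intro mu_eq_0 ordlt_mono[OF ordlt_X]) auto
  then have "mu v v N 0 (Q \<omega>) = (\<Sum>l\<in>{0}. mul (rconst (weight \<omega> l)) * mu v v N 0 (X (N - 2 * l)))"
    unfolding Q_def mu_sum mu_mul_times by (intro sum.mono_neutral_right) auto
  then show ?thesis using ad_funpow_X[where v = v and n = N] by (simp add: mu_def)
qed

end

section \<open>The ladder of a locus configuration\<close>

lemma reflection_scale: "c \<noteq> 0 \<Longrightarrow> reflection (c *s e) = reflection e" for e :: plane
  by (simp add: fun_eq_iff reflection_def bil_simps vec_eq_iff field_simps)

lemma bil_reflection: "bil e e \<noteq> 0 \<Longrightarrow> bil (reflection e v) (reflection e w) = bil v w" for e v w :: plane
  by (simp add: bil_reflection_self_adjoint reflection_involution)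

lemma emb_bil: "bil (emb v) (emb w) = rconst (bil v w)"
  by (simp add: bil_eq emb_def)

text \<open>Self-adjointness moves the reflection from the generic point to the vector. Thus the
  reflected potential of the locus condition becomes \<open>rs pot\<close>.\<close>

lemma bil_emb_reflection_gen_pt:
  assumes "bil \<alpha> \<alpha> \<noteq> 0"
  shows "bil (emb \<beta>) (reflection (emb \<alpha>) gen_pt) = lin (reflection \<alpha> \<beta>)"
proof -
  have "bil (emb \<beta>) (reflection (emb \<alpha>) gen_pt)
      = lin \<beta> - (2 * lin \<alpha> / rconst (bil \<alpha> \<alpha>)) * rconst (bil \<alpha> \<beta>)"
    unfolding emb_bil[symmetric] lin_def
    by (simp add: reflection_def bil_eq algebra_simps add_divide_distrib)
  moreover have "rconst (2 * bil \<alpha> \<beta> / bil \<alpha> \<alpha>) = 2 * rconst (bil \<alpha> \<beta>) / rconst (bil \<alpha> \<alpha>)"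
    by (simp add: divide_inverse rconst_inverse)
  ultimately show ?thesis
    by (simp add: reflection_def lin_diff lin_scale)
qed

locale locus =
  fixes W :: "(plane \<Rightarrow> plane) set" and R Ap :: "plane set" and k :: "plane \<Rightarrow> complex"
  assumes root_system: "root_system W R" and locus: "locus_configuration W R Ap k"
begin

lemma finite_Ap: "finite Ap"
  and nonisotropic: "\<alpha> \<in> Ap \<Longrightarrow> bil \<alpha> \<alpha> \<noteq> 0"
  and nonparallel: "\<alpha> \<in> Ap \<Longrightarrow> \<beta> \<in> Ap \<Longrightarrow> \<alpha> \<noteq> \<beta> \<Longrightarrow> \<beta> \<noteq> c *s \<alpha>"
  and k_minus: "\<alpha> \<in> full Ap \<Longrightarrow> k (- \<alpha>) = k \<alpha>"
  using locus by (auto simp: locus_configuration_def configuration_def)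

definition coeff :: "plane \<Rightarrow> complex" where
  "coeff \<alpha> = k \<alpha> * (k \<alpha> + 1) * bil \<alpha> \<alpha>"

definition pot :: ratfun where
  "pot = potential Ap k gen_pt"

lemma pot_eq: "pot = (\<Sum>\<alpha>\<in>Ap. rconst (coeff \<alpha>) / (lin \<alpha>)\<^sup>2)"
  by (simp add: pot_def potential_def coeff_def lin_def)

text \<open>Without lines, \<open>S\<close> still has to be nonempty to make the polynomial \<open>g\<close> non-constant.\<close>

definition S :: "plane set" where
  "S = (if Ap = {} then {e1} else full Ap)"

text \<open>
  The summands with \<open>\<alpha> \<notin> R\<close> are the multiplicities themselves; all that matters about
  \<open>kap\<close> is that it is positive and bounds these.
\<close>

definition kap :: nat where
  "kap = Suc (\<Sum>\<alpha>\<in>Ap. nat \<lfloor>Re (k \<alpha>)\<rfloor>)"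

text \<open>The product contains both signs of every vector, so a reflection of the configuration
  permutes its factors exactly. The exponent provides the zeros demanded by
  \<open>locus_symbol\<close> and makes \<open>N\<close> even.\<close>

definition g :: ratfun where
  "g = (\<Prod>\<beta>\<in>S. lin \<beta>) ^ (2 * kap)"

definition N :: nat where
  "N = card S * (2 * kap)"

lemma finite_full: "finite (full Ap)"
  using finite_Ap by (simp add: full_def)

lemma finite_S: "finite S" and S_nonempty: "S \<noteq> {}"
  using finite_full by (auto simp: S_def full_def)

lemma nonisotropic_S: "\<beta> \<in> S \<Longrightarrow> bil \<beta> \<beta> \<noteq> 0"
  using nonisotropic by (auto simp: S_def full_def bil_simps split: if_splits)

lemma N_pos: "N > 0" and even_N: "even N"
  using finite_S S_nonempty by (auto simp: N_def kap_def card_gt_0_iff)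

lemma app_eul_inverse_lin: "app eul (inverse (lin v)) = - inverse (lin v)"
proof (cases "lin v = 0")
  case False
  then have "app eul (lin v * inverse (lin v)) = 0" by simp
  then have "lin v * app eul (inverse (lin v)) = - (lin v * inverse (lin v))"
    by (simp only: app_eul_mult app_eul_lin add_eq_0_iff)
  then show ?thesis using False by (simp add: field_simps)
qed simp

lemma pot_hom: "app eul pot = - (2 * pot)"
proof -
  have "app eul (sum f A) = (\<Sum>x\<in>A. app eul (f x))" for f :: "plane \<Rightarrow> ratfun" and A
    by (induction A rule: infinite_finite_induct) simp_all
  moreover have "app eul (rconst c / (lin v)\<^sup>2) = - (2 * (rconst c / (lin v)\<^sup>2))" for c v
    by (simp add: divide_inverse power2_eq_square app_eul_mult app_eul_inverse_lin algebra_simps)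
  ultimately show ?thesis by (simp add: pot_eq sum_distrib_left sum_negf)
qed

lemma hom_power: "app eul f = of_nat n * f \<Longrightarrow> app eul (f ^ m) = of_nat (n * m) * f ^ m"
  by (induction m) (simp_all add: app_eul_mult algebra_simps)

lemma hom_prod_lin: "finite A \<Longrightarrow> app eul (\<Prod>\<beta>\<in>A. lin \<beta>) = of_nat (card A) * (\<Prod>\<beta>\<in>A. lin \<beta>)"
  by (induction A rule: finite_induct) (simp_all add: app_eul_mult algebra_simps)

lemma g_hom: "app eul g = of_nat N * g"
  unfolding g_def N_def by (rule hom_power) (rule hom_prod_lin[OF finite_S])

lemma g_poly: "poly_fn g"
  unfolding g_def by (intro poly_fn_power poly_fn_prod poly_fn_closed)

sublocale ladder pot g N
  by unfold_locales (rule pot_hom g_poly g_hom)+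

subsection \<open>Pole orders of the symbols\<close>

lemma neg_notin: "\<alpha> \<in> Ap \<Longrightarrow> - \<alpha> \<notin> Ap"
proof
  assume *: "\<alpha> \<in> Ap" "- \<alpha> \<in> Ap"
  have "- \<alpha> = (-1) *s \<alpha>" by simp
  then have "\<alpha> = - \<alpha>" using nonparallel[OF *] by metis
  then have "\<alpha> = 0" by (simp add: vec_eq_iff)
  then show False using nonisotropic[OF *(1)] by (simp add: bil_eq)
qed

text \<open>The group permutes \<open>full Ap\<close>, but \<open>Ap\<close> only up to signs;
  invariance is therefore proved for twice the potential.\<close>

lemma sum_full:
  assumes "\<And>\<alpha>. \<alpha> \<in> Ap \<Longrightarrow> f (- \<alpha>) = f \<alpha>"
  shows "(\<Sum>\<alpha>\<in>full Ap. f \<alpha>) = 2 * (\<Sum>\<alpha>\<in>Ap. f \<alpha> :: ratfun)"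
proof -
  have "(\<Sum>\<alpha>\<in>full Ap. f \<alpha>) = (\<Sum>\<alpha>\<in>Ap. f \<alpha>) + (\<Sum>\<alpha>\<in>uminus ` Ap. f \<alpha>)"
    unfolding full_def using finite_Ap neg_notin by (intro sum.union_disjoint) auto
  also have "(\<Sum>\<alpha>\<in>uminus ` Ap. f \<alpha>) = (\<Sum>\<alpha>\<in>Ap. f \<alpha>)"
    using assms by (subst sum.reindex) (auto simp: inj_on_def)
  finally show ?thesis by simp
qed

lemma coeff_minus: "\<alpha> \<in> full Ap \<Longrightarrow> coeff (- \<alpha>) = coeff \<alpha>"
  by (simp add: coeff_def k_minus bil_simps)

lemma unit_vector:
  assumes "\<alpha> \<in> Ap"
  obtains c e where "\<alpha> = c *s e" "c \<noteq> 0" "bil e e = 1" "bil \<alpha> \<alpha> = c\<^sup>2"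
proof
  let ?c = "csqrt (bil \<alpha> \<alpha>)"
  show c: "?c \<noteq> 0" using nonisotropic[OF assms] by simp
  then show "\<alpha> = ?c *s (inverse ?c *s \<alpha>)" by (simp add: vec_eq_iff)
  have "?c * ?c = bil \<alpha> \<alpha>" using power2_csqrt[of "bil \<alpha> \<alpha>"] by (simp add: power2_eq_square)
  then show "bil (inverse ?c *s \<alpha>) (inverse ?c *s \<alpha>) = 1"
    using c by (simp add: bil_simps field_simps)
qed (simp)

lemma reflection_invariant:
  assumes \<alpha>: "\<alpha> \<in> Ap" "\<alpha> \<in> R"
  shows "bij_betw (reflection \<alpha>) (full Ap) (full Ap)"
    "\<And>\<beta>. \<beta> \<in> full Ap \<Longrightarrow> coeff (reflection \<alpha> \<beta>) = coeff \<beta>"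
proof -
  obtain Rp where Rp: "R = Rp \<union> uminus ` Rp" "\<And>\<alpha>. \<alpha> \<in> Rp \<Longrightarrow> reflection \<alpha> \<in> W"
    using root_system unfolding root_system_def by blast
  have "reflection \<alpha> \<in> W"
  proof (cases "\<alpha> \<in> Rp")
    case False
    then obtain \<gamma> where "\<gamma> \<in> Rp" "\<alpha> = - \<gamma>" using \<alpha>(2) Rp(1) by auto
    then have *: "\<alpha> = (-1) *s \<gamma>" "reflection \<gamma> \<in> W" using Rp by simp_all
    have "reflection \<alpha> = reflection \<gamma>" unfolding *(1) by (rule reflection_scale) simp
    then show ?thesis using *(2) by simp
  qed (use Rp in blast)
  then have W: "reflection \<alpha> ` full Ap = full Ap" "\<And>\<beta>. \<beta> \<in> full Ap \<Longrightarrow> k (reflection \<alpha> \<beta>) = k \<beta>"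
    using locus by (auto simp: locus_configuration_def)
  have "inj (reflection \<alpha>)"
    using nonisotropic[OF \<alpha>(1)] by (metis injI reflection_involution)
  then show "bij_betw (reflection \<alpha>) (full Ap) (full Ap)"
    using W(1) inj_on_subset[OF _ subset_UNIV] by (auto simp: bij_betw_def)
  show "coeff (reflection \<alpha> \<beta>) = coeff \<beta>" if "\<beta> \<in> full Ap" for \<beta>
    using W(2)[OF that] nonisotropic[OF \<alpha>(1)] by (simp add: coeff_def bil_reflection)
qed

lemma kap_ge:
  assumes "\<alpha> \<in> Ap" "k \<alpha> = of_nat m"
  shows "m \<le> kap"
proof -
  have "nat \<lfloor>Re (k \<alpha>)\<rfloor> \<le> (\<Sum>\<alpha>\<in>Ap. nat \<lfloor>Re (k \<alpha>)\<rfloor>)"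
    using assms(1) finite_Ap by (intro member_le_sum) auto
  then show ?thesis using assms(2) by (simp add: kap_def)
qed

text \<open>One exponent serves all lines. Along a mirror in \<open>R\<close> the symbol has no pole
  and the power of \<open>lin e\<close> is padding; along the other lines the pole order is at most
  \<open>2 * m\<close>, and \<open>kap\<close> bounds m.\<close>

lemma symbol_reg:
  assumes \<alpha>: "\<alpha> \<in> Ap" "\<alpha> = c *s e" "c \<noteq> 0" "bil e e = 1" "bil \<alpha> \<alpha> = c\<^sup>2"
    and ord: "ordlt (Suc (i + j)) (X n)"
  shows "mirror.reg e (app (mu e1 e2 i j (X n)) 1 * lin e ^ (2 * kap))"
proof -
  interpret mirror e by unfold_locales (rule \<alpha>)
  have lin_\<alpha>: "lin \<alpha> = rconst c * lin e" by (simp add: \<alpha>(2) lin_scale)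
  define v where "v = (\<Sum>\<beta>\<in>Ap - {\<alpha>}. rconst (coeff \<beta>) / (lin \<beta>)\<^sup>2)"
  have pole: "rconst (coeff \<alpha>) / (lin \<alpha>)\<^sup>2 = rconst (k \<alpha> * (k \<alpha> + 1)) / (lin e)\<^sup>2"
    using \<alpha>(3) by (simp add: coeff_def \<alpha>(5) lin_\<alpha> power_mult_distrib)
  have pot: "pot = rconst (k \<alpha> * (k \<alpha> + 1)) / (lin e)\<^sup>2 + v"
    unfolding pot_eq v_def by (subst sum.remove[OF finite_Ap \<alpha>(1)]) (simp only: pole)
  have "reg (rconst (coeff \<beta>) / (lin \<beta>)\<^sup>2)" if "\<beta> \<in> Ap - {\<alpha>}" for \<beta>
  proof -
    have "\<beta> \<noteq> bil e \<beta> *s e"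
    proof
      assume "\<beta> = bil e \<beta> *s e"
      then have "\<beta> = (bil e \<beta> / c) *s \<alpha>" using \<alpha>(2,3) by (simp add: vec_eq_iff)
      then show False using nonparallel[OF \<alpha>(1)] that by blast
    qed
    then have "reg (rconst (coeff \<beta>) * inverse (lin \<beta>) ^ 2)"
      by (intro reg_mult reg_power reg_inverse_lin reg_rconst)
    then show ?thesis by (simp add: divide_inverse power_inverse)
  qed
  then have v: "reg v" unfolding v_def by (rule reg_sum)
  have refl: "reflection \<alpha> = reflection e" unfolding \<alpha>(2) by (rule reflection_scale[OF \<alpha>(3)])
  have Xn: "X n = (com (lap - mul pot) ^^ n) (mul g)" by (simp add: X_def L_def)
  show ?thesis
  proof (cases "\<alpha> \<in> R")
    case True
    interpret radial e "k \<alpha> * (k \<alpha> + 1)" ..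
    note inv = reflection_invariant[OF \<alpha>(1) True, unfolded refl]
    have full: "pot * 2 = (\<Sum>\<beta>\<in>full Ap. rconst (coeff \<beta>) / (lin \<beta>)\<^sup>2)"
      unfolding pot_eq using sum_full[of "\<lambda>\<beta>. rconst (coeff \<beta>) / (lin \<beta>)\<^sup>2"]
      by (simp add: coeff_minus lin_minus full_def mult.commute)
    have "rs (pot * 2) = (\<Sum>\<beta>\<in>full Ap. rconst (coeff (reflection e \<beta>)) / (lin (reflection e \<beta>))\<^sup>2)"
      unfolding full rs_sum
    proof (rule sum.cong)
      fix \<beta> assume "\<beta> \<in> full Ap"
      then show "rs (rconst (coeff \<beta>) / (lin \<beta>)\<^sup>2) = rconst (coeff (reflection e \<beta>)) / (lin (reflection e \<beta>))\<^sup>2"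
        unfolding rs_divide rs_power rs_lin rs_rconst by (simp only: inv(2))
    qed simp
    also have "\<dots> = pot * 2"
      unfolding full by (rule sum.reindex_bij_betw[OF inv(1)])
    finally have rs_pot: "rs pot = pot" using rs_of_nat[of 2] by (simp add: rs_mult)
    have "rs v = v"
      using arg_cong[OF pot, of rs] rs_pot pot by (simp add: rs_add rs_mult rs_divide rs_power)
    then have ev: "even_fn v" using v by (simp add: even_fn_def)
    have "rs (\<Prod>\<beta>\<in>full Ap. lin \<beta>) = (\<Prod>\<beta>\<in>full Ap. lin \<beta>)"
      unfolding rs_prod rs_lin by (rule prod.reindex_bij_betw[OF inv(1)])
    then have "rs g = g" using \<alpha>(1) by (auto simp: g_def S_def rs_power)
    then have eg: "even_fn g" using reg_poly_fn[OF g_poly] by (simp add: even_fn_def)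
    have "reg (app (mu e1 e2 i j (X n)) 1)"
      using reflection_symbol[OF pot ev eg Xn ord] .
    then show ?thesis by (intro reg_mult reg_power reg_lin)
  next
    case False
    then obtain m where m: "k \<alpha> = of_nat m"
      "regular_on_line \<alpha> ((potential Ap k gen_pt - potential Ap k (reflection (emb \<alpha>) gen_pt))
             / (bil (emb \<alpha>) gen_pt) ^ (2 * m))"
      using locus \<alpha>(1) unfolding locus_configuration_def full_def by blast
    have "potential Ap k (reflection (emb \<alpha>) gen_pt) = rs pot"
      using nonisotropic[OF \<alpha>(1)]
      by (simp add: potential_def bil_emb_reflection_gen_pt pot_eq rs_sum rs_divide rs_power rs_lin
          refl coeff_def rs_mult rs_add)
    then have "reg ((pot - rs pot) / lin \<alpha> ^ (2 * m))"
      using reg_on_lineD[OF _ \<alpha>(3)] m(2) \<alpha>(2) by (simp add: pot_def lin_def)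
    then have "reg (rconst (c ^ (2 * m)) * ((pot - rs pot) / lin \<alpha> ^ (2 * m)))"
      by (intro reg_mult reg_rconst)
    moreover have "rconst (c ^ (2 * m)) * ((pot - rs pot) / lin \<alpha> ^ (2 * m)) = (pot - rs pot) / lin e ^ (2 * m)"
      using \<alpha>(3) by (simp add: lin_\<alpha> power_mult_distrib)
    \<comment> \<open>The polar term of the line itself is even and cancels.\<close>
    moreover have "pot - rs pot = v - rs v"
      unfolding pot by (simp add: rs_add rs_divide rs_power rs_mult)
    ultimately have vv: "reg ((v - rs v) / lin e ^ (2 * m))" by simp
    have le: "m \<le> kap" using kap_ge[OF \<alpha>(1) m(1)] .
    then have split: "lin e ^ (2 * kap) = lin e ^ (2 * m) * lin e ^ (2 * (kap - m))"
      by (simp flip: power_add distrib_left)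
    have "reg (g / lin e ^ (2 * m))"
    proof -
      have "\<alpha> \<in> S" using \<alpha>(1) by (auto simp: S_def full_def)
      then have "g = (lin \<alpha> * (\<Prod>\<beta>\<in>S - {\<alpha>}. lin \<beta>)) ^ (2 * kap)"
        unfolding g_def by (simp only: prod.remove[OF finite_S])
      then have "g / lin e ^ (2 * m)
          = rconst (c ^ (2 * kap)) * lin e ^ (2 * (kap - m)) * (\<Prod>\<beta>\<in>S - {\<alpha>}. lin \<beta>) ^ (2 * kap)"
        by (simp add: power_mult_distrib lin_\<alpha> split)
      moreover have "reg \<dots>"
        by (intro reg_mult reg_power reg_prod reg_lin reg_rconst)
      ultimately show ?thesis by simp
    qed
    moreover have "pot = rconst (of_nat m * (of_nat m + 1)) / (lin e)\<^sup>2 + v"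
      using pot m(1) by simp
    ultimately have "reg (app (mu e1 e2 i j (X n)) 1 * lin e ^ (2 * m))"
      using locus_symbol[OF _ v vv _ Xn ord] by blast
    then have "reg (app (mu e1 e2 i j (X n)) 1 * lin e ^ (2 * m) * lin e ^ (2 * (kap - m)))"
      by (rule reg_mult[OF _ reg_power[OF reg_lin]])
    then show ?thesis by (simp only: split mult.assoc)
  qed
qed

section \<open>From the single lines to a common denominator\<close>

definition disc :: ratfun where
  "disc = (\<Prod>\<alpha>\<in>Ap. lin \<alpha>)"

text \<open>Polynomials localised at the lines. The exponent is not controlled; its purpose is to
  exclude poles elsewhere, so that the local bounds at the lines become global.\<close>

definition locpoly :: "ratfun \<Rightarrow> bool" where
  "locpoly f \<longleftrightarrow> (\<exists>n. poly_fn (f * disc ^ n))"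

lemma Ap_nonzero: "\<alpha> \<in> Ap \<Longrightarrow> \<alpha> \<noteq> 0"
  using nonisotropic[of \<alpha>] by (auto simp: bil_eq)

lemma disc_nonzero: "disc \<noteq> 0"
  using finite_Ap Ap_nonzero by (simp add: disc_def)

lemma disc_poly: "poly_fn (disc ^ n)"
  unfolding disc_def by (intro poly_fn_power poly_fn_prod poly_fn_closed)

lemma locpoly_poly: "poly_fn f \<Longrightarrow> locpoly f"
  unfolding locpoly_def by (intro exI[of _ 0]) simp

lemma locpoly_mult: "locpoly f \<Longrightarrow> locpoly h \<Longrightarrow> locpoly (f * h)"
proof -
  assume "locpoly f" "locpoly h"
  then obtain m n where "poly_fn (f * disc ^ m)" "poly_fn (h * disc ^ n)"
    by (auto simp: locpoly_def)
  then have "poly_fn ((f * disc ^ m) * (h * disc ^ n))" by (rule poly_fn_closed(4))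
  then have "poly_fn (f * h * disc ^ (m + n))" by (simp add: power_add mult_ac)
  then show ?thesis unfolding locpoly_def by blast
qed

lemma locpoly_add: "locpoly f \<Longrightarrow> locpoly h \<Longrightarrow> locpoly (f + h)"
proof -
  assume "locpoly f" "locpoly h"
  then obtain m n where mn: "poly_fn (f * disc ^ m)" "poly_fn (h * disc ^ n)"
    by (auto simp: locpoly_def)
  have "poly_fn (f * disc ^ m * disc ^ n + h * disc ^ n * disc ^ m)"
    by (rule poly_fn_closed(3)[OF poly_fn_closed(4)[OF mn(1) disc_poly] poly_fn_closed(4)[OF mn(2) disc_poly]])
  then have "poly_fn ((f + h) * disc ^ (m + n))" by (simp add: power_add algebra_simps)
  then show ?thesis unfolding locpoly_def by blast
qed

lemma locpoly_minus: "locpoly f \<Longrightarrow> locpoly (- f)"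
  using locpoly_mult[OF locpoly_poly[OF poly_fn_closed(1)[of "-1"]], of f] by simp

lemma locpoly_diff: "locpoly f \<Longrightarrow> locpoly h \<Longrightarrow> locpoly (f - h)"
  using locpoly_add[of f "- h"] locpoly_minus by simp

lemma locpoly_sum: "(\<And>x. x \<in> A \<Longrightarrow> locpoly (f x)) \<Longrightarrow> locpoly (sum f A)"
  using locpoly_poly[OF poly_fn_closed(1)[of 0]]
  by (induction A rule: infinite_finite_induct) (auto intro: locpoly_add)

lemma locpoly_inverse_disc: "locpoly (inverse disc)"
  unfolding locpoly_def using disc_nonzero by (intro exI[of _ 1]) simp

lemma locpoly_der: "locpoly f \<Longrightarrow> locpoly (der v f)"
proof -
  assume "locpoly f"
  then obtain n where n: "poly_fn (f * disc ^ n)" by (auto simp: locpoly_def)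
  have "der v f * disc ^ n = der v (f * disc ^ n) - f * der v (disc ^ n)"
    by (simp add: der_mult)
  moreover have "locpoly (der v (f * disc ^ n) - f * der v (disc ^ n))"
    using n \<open>locpoly f\<close> by (intro locpoly_diff locpoly_mult) (auto intro: locpoly_poly poly_fn_closed disc_poly)
  ultimately have l: "locpoly (der v f * disc ^ n)" by simp
  have "locpoly (inverse disc ^ n)"
    using locpoly_inverse_disc locpoly_poly[OF poly_fn_1]
    by (induction n) (auto intro: locpoly_mult)
  then have "locpoly (der v f * disc ^ n * inverse disc ^ n)" using l by (rule locpoly_mult[rotated])
  then show ?thesis using disc_nonzero by (simp add: field_simps)
qed

lemma locpoly_pot: "locpoly pot"
  unfolding pot_eq
proof (rule locpoly_sum)
  fix \<alpha> assume \<alpha>: "\<alpha> \<in> Ap"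
  have "disc = lin \<alpha> * (\<Prod>\<beta>\<in>Ap - {\<alpha>}. lin \<beta>)"
    unfolding disc_def by (rule prod.remove[OF finite_Ap \<alpha>])
  then have "inverse (lin \<alpha>) = (\<Prod>\<beta>\<in>Ap - {\<alpha>}. lin \<beta>) * inverse disc"
    using disc_nonzero by (simp add: field_simps)
  moreover have "locpoly \<dots>"
    by (intro locpoly_mult locpoly_inverse_disc locpoly_poly poly_fn_prod poly_fn_closed)
  ultimately have "locpoly (inverse (lin \<alpha>))" by simp
  then have "locpoly (rconst (coeff \<alpha>) * (inverse (lin \<alpha>) * inverse (lin \<alpha>)))"
    by (intro locpoly_mult locpoly_poly[OF poly_fn_closed(1)])
  then show "locpoly (rconst (coeff \<alpha>) / (lin \<alpha>)\<^sup>2)"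
    by (simp add: divide_inverse power2_eq_square)
qed

text \<open>The localised ring is stable under derivatives and contains \<open>pot\<close>, so it is
  preserved by \<open>L\<close>, by the rungs and by their commutators with linear forms.\<close>

lemma locpoly_symbol: "locpoly (app (mu e1 e2 i j (X n)) 1)"
proof -
  define G where "G D \<longleftrightarrow> (\<forall>f. locpoly f \<longrightarrow> locpoly (app D f))" for D
  have G_mul: "G (mul f)" if "locpoly f" for f
    using that by (simp add: G_def locpoly_mult)
  have G_times: "G (D * E)" if "G D" "G E" for D E
    using that by (simp add: G_def)
  have G_diff: "G (D - E)" if "G D" "G E" for D E
    using that by (simp add: G_def locpoly_diff)
  have G_L: "G L"
    unfolding L_def lap_def by (intro G_diff G_mul locpoly_pot)
      (simp add: G_def locpoly_add locpoly_der)
  have G_com: "G (com D E)" if "G D" "G E" for D E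
    unfolding com_def using that by (intro G_diff G_times)
  have "G (X n)"
    by (induction n) (simp_all add: X_simps G_com G_L G_mul locpoly_poly g_poly)
  moreover have G_ad: "G (ad u D)" if "G D" for u D
    unfolding ad_def by (intro G_com G_mul that locpoly_poly poly_fn_closed)
  have "G ((ad u ^^ n) D)" if "G D" for u D n
    using that by (induction n) (simp_all add: G_ad)
  ultimately have "G (mu e1 e2 i j (X n))" by (simp add: mu_def)
  then show ?thesis using locpoly_poly[OF poly_fn_1] by (simp add: G_def)
qed

text \<open>The lines are treated one at a time: when a line joins \<open>B\<close>,
  \<open>cancel_pole\<close> changes its exponent from l to \<open>2 * kap\<close>, since the
  equations of the other lines do not vanish on it.\<close>

lemma symbol_denominator:
  assumes "ordlt (Suc (i + j)) (X n)"
  shows "poly_fn (app (mu e1 e2 i j (X n)) 1 * disc ^ (2 * kap))"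
proof -
  define s where "s = app (mu e1 e2 i j (X n)) 1"
  obtain l where l: "poly_fn (s * disc ^ l)"
    using locpoly_symbol unfolding locpoly_def s_def by blast
  have "poly_fn (s * ((\<Prod>\<alpha>\<in>B. lin \<alpha> ^ (2 * kap)) * (\<Prod>\<alpha>\<in>Ap - B. lin \<alpha> ^ l)))"
    if "finite B" "B \<subseteq> Ap" for B
    using that
  proof (induction B rule: finite_induct)
    case empty
    then show ?case using l by (simp add: disc_def prod_power_distrib)
  next
    case (insert \<alpha> B)
    then have \<alpha>: "\<alpha> \<in> Ap" by simp
    then obtain c e where ce: "\<alpha> = c *s e" "c \<noteq> 0" "bil e e = 1" "bil \<alpha> \<alpha> = c\<^sup>2"
      by (rule unit_vector)
    interpret mirror e by unfold_locales (rule ce)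
    have lin_\<alpha>: "lin \<alpha> = rconst c * lin e" by (simp add: ce(1) lin_scale)
    define q where "q = (\<Prod>\<beta>\<in>B. linp \<beta> ^ (2 * kap)) * (\<Prod>\<beta>\<in>Ap - insert \<alpha> B. linp \<beta> ^ l)"
    have q: "to_fract q = (\<Prod>\<beta>\<in>B. lin \<beta> ^ (2 * kap)) * (\<Prod>\<beta>\<in>Ap - insert \<alpha> B. lin \<beta> ^ l)"
    proof -
      have "to_fract (prod f A) = (\<Prod>x\<in>A. to_fract (f x))" for f :: "plane \<Rightarrow> poly2" and A
        by (induction A rule: infinite_finite_induct) simp_all
      then show ?thesis by (simp add: q_def to_fract_power to_fract_linp)
    qed
    have v_power: "\<not> vanishes (p ^ n)" if "\<not> vanishes p" for p n
      using that by (induction n) simp_all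
    have v_prod: "\<not> vanishes (prod f A)" if "\<And>x. x \<in> A \<Longrightarrow> \<not> vanishes (f x)" for f :: "plane \<Rightarrow> poly2" and A
      using that by (induction A rule: infinite_finite_induct) auto
    have "\<not> vanishes (linp \<beta>)" if "\<beta> \<in> Ap" "\<beta> \<noteq> \<alpha>" for \<beta>
      unfolding vanishes_linp
    proof
      assume "\<beta> = bil e \<beta> *s e"
      then have "\<beta> = (bil e \<beta> / c) *s \<alpha>" using ce by (simp add: vec_eq_iff)
      then show False using nonparallel[OF \<alpha>] that by blast
    qed
    then have nv: "\<not> vanishes q"
      unfolding q_def vanishes_mult using insert.hyps insert.prems by (auto intro!: v_prod v_power)
    have diff: "Ap - insert \<alpha> B = Ap - B - {\<alpha>}" by blast
    have "(\<Prod>\<beta>\<in>Ap - B. lin \<beta> ^ l) = lin \<alpha> ^ l * (\<Prod>\<beta>\<in>Ap - insert \<alpha> B. lin \<beta> ^ l)"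
      unfolding diff using finite_Ap \<alpha> insert.hyps by (intro prod.remove) auto
    then have "poly_fn (s * (lin \<alpha> ^ l * to_fract q))"
      using insert.IH insert.prems by (simp add: q mult_ac)
    then have "poly_fn (rconst (inverse c ^ l) * (s * (lin \<alpha> ^ l * to_fract q)))"
      by (rule poly_fn_closed(4)[OF poly_fn_closed(1)])
    moreover have "rconst (inverse c ^ l) * (s * (lin \<alpha> ^ l * to_fract q)) = s * (lin e ^ l * to_fract q)"
      using ce(2) by (simp add: lin_\<alpha> power_mult_distrib rconst_inverse power_inverse)
    ultimately have "poly_fn (s * (lin e ^ l * to_fract q))" by (simp only:)
    then obtain p where "s * (lin e ^ l * to_fract q) = to_fract p"
      by (auto simp: poly_fn_def)
    then have "poly_fn (s * (lin e ^ (2 * kap) * to_fract q))"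
      using cancel_pole[OF symbol_reg[OF \<alpha> ce assms, folded s_def] _ nv] by (auto simp: poly_fn_def)
    then have "poly_fn (rconst (c ^ (2 * kap)) * (s * (lin e ^ (2 * kap) * to_fract q)))"
      by (rule poly_fn_closed(4)[OF poly_fn_closed(1)])
    moreover have "rconst (c ^ (2 * kap)) * (s * (lin e ^ (2 * kap) * to_fract q))
        = s * (lin \<alpha> ^ (2 * kap) * to_fract q)"
      by (simp add: lin_\<alpha> power_mult_distrib mult_ac)
    ultimately have "poly_fn (s * (lin \<alpha> ^ (2 * kap) * to_fract q))" by (simp only:)
    then show ?case using insert.hyps by (simp add: q mult_ac)
  qed
  from this[OF finite_Ap subset_refl] show ?thesis
    by (simp add: s_def disc_def prod_power_distrib)
qed

lemma X_eventually_0: "\<exists>J. X J = 0"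
proof -
  \<comment> \<open>\<open>C\<close> is the degree of \<open>disc ^ (2 * kap)\<close>. A symbol
    coefficient at order m <= J has degree N - 2 J + m <= N - J, and \<open>J\<close> is the least
    number for which adding \<open>C\<close> to this bound gives a negative degree.\<close>
  define C where "C = card Ap * (2 * kap)"
  define J where "J = Suc (N + C)"
  have "X J = 0"
  proof (rule ccontr)
    assume "X J \<noteq> 0"
    with ordlt_X obtain m where m: "m \<le> J" "ordlt (Suc m) (X J)" "\<not> ordlt m (X J)"
      by (rule minimal_ordlt)
    then obtain i j where ij: "i + j = m" "mu e1 e2 i j (X J) \<noteq> 0"
      using ordlt_muI[of e1 e2 m "X J"] plane_expand by metis
    define s where "s = app (mu e1 e2 i j (X J)) 1"
    have s: "mu e1 e2 i j (X J) = mul s"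
      using ordlt_1D[OF ordlt_mu[of 1 i j "X J" e1 e2]] m(2) ij(1) by (simp add: s_def add.commute)
    then have "s \<noteq> 0" using ij(2) by auto
    have "com eul (mul s) = of_int (int N - 2 * int J + int i + int j) * mul s"
      using com_eul_mu[OF com_eul_X, of e1 e2 i j J] unfolding s .
    then have "app (com eul (mul s)) 1 = app (of_int (int N - 2 * int J + int i + int j) * mul s) 1"
      by (simp only:)
    then have hs: "app eul s = of_int (int N - 2 * int J + int i + int j) * s"
      by (simp only: com_eul_mul app_simps app_of_int mult_1_right)
    have hd: "app eul (disc ^ (2 * kap)) = of_nat C * disc ^ (2 * kap)"
      unfolding disc_def C_def by (rule hom_power) (rule hom_prod_lin[OF finite_Ap])
    have "app eul (s * disc ^ (2 * kap))
        = of_int (int N - 2 * int J + int i + int j + int C) * (s * disc ^ (2 * kap))"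
      unfolding app_eul_mult hs hd by (simp only: of_int_add of_int_of_nat_eq) (simp only: algebra_simps)
    moreover have "int N - 2 * int J + int i + int j + int C < 0"
    proof -
      have "int m \<le> int N + int C + 1" "int i + int j = int m" using m(1) ij(1) by (auto simp: J_def)
      then show ?thesis unfolding J_def by simp
    qed
    ultimately have "s * disc ^ (2 * kap) = 0"
      using symbol_denominator[of i j J] m(2) ij(1) by (intro homogeneous_poly_neg_eq_0) (simp_all add: s_def)
    then show False using \<open>s \<noteq> 0\<close> disc_nonzero by simp
  qed
  then show ?thesis by blast
qed

lemma X_Suc_N: "X (Suc N) = 0"
  using X_eventually_0 X_Suc_N_eq_0 by blast

end

section \<open>Symbols of differential operators\<close>

definition endo_of :: "diffop \<Rightarrow> endo" where
  "endo_of P = (\<Sum>(i, j)\<in>Poly_Mapping.keys P. mul (Poly_Mapping.lookup P (i, j)) * (dv e1 ^ i * dv e2 ^ j))"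

lemma app_power: "app (D ^ n) f = (app D ^^ n) f"
  by (induction n) simp_all

lemma app_endo_of: "app (endo_of P) = act P"
proof
  fix f
  have "app (dv e1) = pd1" "app (dv e2) = pd2"
    by (simp_all add: fun_eq_iff e1_def e2_def der_axis)
  then show "app (endo_of P) f = act P f"
    by (simp add: endo_of_def act_def app_power case_prod_unfold)
qed

lemma commuteI: "com (endo_of P) (endo_of P') = 0 \<Longrightarrow> commute P P'"
  unfolding commute_def app_endo_of[symmetric] com_eq_0_iff fun_eq_iff comp_apply
  by (metis app_simps(6))

lemma endo_of_superset:
  assumes "finite A" "Poly_Mapping.keys P \<subseteq> A"
  shows "endo_of P = (\<Sum>(i, j)\<in>A. mul (Poly_Mapping.lookup P (i, j)) * (dv e1 ^ i * dv e2 ^ j))"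
  unfolding endo_of_def using assms by (intro sum.mono_neutral_left) (auto simp: in_keys_iff)

lemma endo_of_add: "endo_of (P + P') = endo_of P + endo_of P'"
proof -
  let ?A = "Poly_Mapping.keys P \<union> Poly_Mapping.keys P'"
  show ?thesis
    by (subst (1 2 3) endo_of_superset[of ?A])
      (auto simp: keys_add lookup_add distrib_right case_prod_unfold sum.distrib)
qed

lemma endo_of_single: "endo_of (Poly_Mapping.single (i, j) c) = mul c * (dv e1 ^ i * dv e2 ^ j)"
  by (subst endo_of_superset[of "{(i, j)}"]) auto

text \<open>The way back to coefficient families: the integrals arise from ring operations on
  endomorphisms and must be recognised as differential operators.\<close>

definition is_diffop :: "endo \<Rightarrow> bool" where
  "is_diffop D \<longleftrightarrow> (\<exists>P. endo_of P = D)"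

lemma is_diffop_add: "is_diffop D \<Longrightarrow> is_diffop E \<Longrightarrow> is_diffop (D + E)"
  unfolding is_diffop_def by (metis endo_of_add)

lemma is_diffop_monomial: "is_diffop (mul c * (dv e1 ^ i * dv e2 ^ j))"
  unfolding is_diffop_def by (metis endo_of_single)

lemma is_diffop_mul: "is_diffop (mul c)"
  using is_diffop_monomial[of c 0 0] by simp

lemma is_diffop_sum: "(\<And>x. x \<in> A \<Longrightarrow> is_diffop (D x)) \<Longrightarrow> is_diffop (sum D A)"
  using is_diffop_mul[of 0]
  by (induction A rule: infinite_finite_induct) (auto intro: is_diffop_add)

lemma is_diffop_left:
  assumes "\<And>c i j. is_diffop (G * (mul c * (dv e1 ^ i * dv e2 ^ j)))" "is_diffop D"
  shows "is_diffop (G * D)"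
proof -
  obtain P where "endo_of P = D" using assms(2) by (auto simp: is_diffop_def)
  then have "G * D = (\<Sum>(i, j)\<in>Poly_Mapping.keys P. G * (mul (Poly_Mapping.lookup P (i, j)) * (dv e1 ^ i * dv e2 ^ j)))"
    by (auto simp: endo_of_def sum_distrib_left case_prod_unfold)
  then show ?thesis using assms(1) by (auto intro!: is_diffop_sum)
qed

lemma is_diffop_mul_times: "is_diffop D \<Longrightarrow> is_diffop (mul f * D)"
  by (rule is_diffop_left) (metis is_diffop_monomial mul_simps(6) mult.assoc)

lemma is_diffop_dv_times: "is_diffop D \<Longrightarrow> is_diffop (dv e1 * D)" "is_diffop D \<Longrightarrow> is_diffop (dv e2 * D)"
proof -
  have dv_mul': "dv v * (mul c * Y) = mul c * (dv v * Y) + mul (der v c) * Y" for v c Y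
    by (simp only: mult.assoc[symmetric] dv_mul distrib_right)
  have "dv e2 * dv e1 ^ i = dv e1 ^ i * dv e2" for i
    by (rule power_commuting_commutes[symmetric]) (rule dv_commute)
  then have c: "dv e2 * (dv e1 ^ i * Y) = dv e1 ^ i * (dv e2 * Y)" for i Y
    by (simp only: mult.assoc[symmetric])
  have 2: "dv e2 * (mul c * (dv e1 ^ i * dv e2 ^ j))
      = mul c * (dv e1 ^ i * dv e2 ^ Suc j) + mul (der e2 c) * (dv e1 ^ i * dv e2 ^ j)" for c i j
    by (simp only: dv_mul' c power_Suc)
  have 1: "dv e1 * (mul c * (dv e1 ^ i * dv e2 ^ j))
      = mul c * (dv e1 ^ Suc i * dv e2 ^ j) + mul (der e1 c) * (dv e1 ^ i * dv e2 ^ j)" for c i j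
    by (simp only: dv_mul' mult.assoc power_Suc)
  show "is_diffop D \<Longrightarrow> is_diffop (dv e1 * D)" "is_diffop D \<Longrightarrow> is_diffop (dv e2 * D)"
    by (rule is_diffop_left; simp only: 1 2 is_diffop_add is_diffop_monomial)+
qed

lemma is_diffop_times:
  assumes "is_diffop D" "is_diffop E"
  shows "is_diffop (D * E)"
proof -
  obtain P where P: "endo_of P = D" using assms(1) by (auto simp: is_diffop_def)
  have "is_diffop (dv e2 ^ j * E)" for j
    using assms(2) by (induction j) (simp_all add: is_diffop_dv_times mult.assoc)
  then have "is_diffop (dv e1 ^ i * (dv e2 ^ j * E))" for i j
    by (induction i) (simp_all add: is_diffop_dv_times mult.assoc)
  then have "is_diffop (mul c * (dv e1 ^ i * dv e2 ^ j) * E)" for c i j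
    by (simp add: is_diffop_mul_times mult.assoc)
  then show ?thesis
    unfolding P[symmetric] endo_of_def sum_distrib_right by (auto intro!: is_diffop_sum)
qed

lemma is_diffop_diff: "is_diffop D \<Longrightarrow> is_diffop E \<Longrightarrow> is_diffop (D - E)"
  using is_diffop_add[of D "mul (- 1) * E"] is_diffop_mul_times[of E "- 1"] by simp

lemma is_diffop_com: "is_diffop D \<Longrightarrow> is_diffop E \<Longrightarrow> is_diffop (com D E)"
  unfolding com_def by (intro is_diffop_diff is_diffop_times)

section \<open>Values of symbols at constant vectors\<close>

definition ev :: "plane \<Rightarrow> symb \<Rightarrow> ratfun" where
  "ev v p = (\<Sum>(i, j)\<in>Poly_Mapping.keys p. Poly_Mapping.lookup p (i, j) * rconst (v $ 1 ^ i * v $ 2 ^ j))"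

lemma ev_superset:
  assumes "finite A" "Poly_Mapping.keys p \<subseteq> A"
  shows "ev v p = (\<Sum>(i, j)\<in>A. Poly_Mapping.lookup p (i, j) * rconst (v $ 1 ^ i * v $ 2 ^ j))"
  unfolding ev_def using assms by (intro sum.mono_neutral_left) (auto simp: in_keys_iff)

lemma ev_add: "ev v (p + q) = ev v p + ev v q"
proof -
  let ?A = "Poly_Mapping.keys p \<union> Poly_Mapping.keys q"
  show ?thesis
    by (subst (1 2 3) ev_superset[of ?A])
      (auto simp: keys_add lookup_add distrib_right case_prod_unfold sum.distrib)
qed

lemma ev_single: "ev v (Poly_Mapping.single (i, j) c) = c * rconst (v $ 1 ^ i * v $ 2 ^ j)"
  by (subst ev_superset[of "{(i, j)}"]) auto

lemma ev_0 [simp]: "ev v 0 = 0"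
  by (simp add: ev_def)

lemma ev_sum: "ev v (sum f A) = (\<Sum>x\<in>A. ev v (f x))"
  by (induction A rule: infinite_finite_induct) (simp_all add: ev_add)

lemma poly_mapping_sum_single:
  "p = (\<Sum>x\<in>Poly_Mapping.keys p. Poly_Mapping.single x (Poly_Mapping.lookup p x))"
proof (rule poly_mapping_eqI)
  fix y
  show "Poly_Mapping.lookup p y
      = Poly_Mapping.lookup (\<Sum>x\<in>Poly_Mapping.keys p. Poly_Mapping.single x (Poly_Mapping.lookup p x)) y"
    by (auto simp: lookup_sum lookup_single when_def in_keys_iff)
qed

lemma ev_mult: "ev v (p * q) = ev v p * ev v q"
proof -
  let ?s = "\<lambda>r x. Poly_Mapping.single x (Poly_Mapping.lookup r x) :: symb"
  have s: "ev v (?s p x * ?s q y) = ev v (?s p x) * ev v (?s q y)" for x y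
    by (cases x; cases y) (simp add: mult_single ev_single power_add algebra_simps)
  have "ev v (p * q) = ev v ((\<Sum>x\<in>Poly_Mapping.keys p. ?s p x) * (\<Sum>y\<in>Poly_Mapping.keys q. ?s q y))"
    by (simp flip: poly_mapping_sum_single)
  also have "\<dots> = (\<Sum>x\<in>Poly_Mapping.keys p. ev v (?s p x)) * (\<Sum>y\<in>Poly_Mapping.keys q. ev v (?s q y))"
    by (simp only: sum_product ev_sum s)
  also have "\<dots> = ev v p * ev v q"
    by (simp flip: ev_sum poly_mapping_sum_single)
  finally show ?thesis .
qed

lemma ev_const: "ev v (Poly_Mapping.single 0 c) = c"
  using ev_single[of v 0 0 c] by (simp add: zero_prod_def)

lemma ev_power: "ev v (p ^ n) = ev v p ^ n"
  using ev_const[of v 1] by (induction n) (simp_all add: ev_mult)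

lemma poly_vanish:
  fixes c :: "nat \<Rightarrow> 'a::idom"
  assumes "infinite A" "\<And>x. x \<in> A \<Longrightarrow> (\<Sum>i\<le>n. c i * x ^ i) = 0" "i \<le> n"
  shows "c i = 0"
proof -
  define p where "p = (\<Sum>i\<le>n. monom (c i) i)"
  have "A \<subseteq> {x. poly p x = 0}"
    using assms(2) by (auto simp: p_def poly_sum poly_monom)
  then have "p = 0" using assms(1) poly_roots_finite finite_subset by blast
  then have "coeff p i = 0" by simp
  then show ?thesis using assms(3) by (simp add: p_def coeff_sum)
qed

lemma ad_funpow_mul_times: "(ad v ^^ n) (mul f * D) = mul f * (ad v ^^ n) D"
  using mu_mul_times[of v v n 0 f D] by (simp add: mu_def)

lemma ad_funpow_sum: "(ad v ^^ n) (sum D A) = (\<Sum>x\<in>A. (ad v ^^ n) (D x))"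
  by (induction A rule: infinite_finite_induct) simp_all

lemma ad_funpow_eq_0: "ordlt n D \<Longrightarrow> (ad v ^^ n) D = 0"
  using mu_eq_0[of n 0 D v v] by (simp add: mu_def)

lemma ad_dv_power: "ad v (dv w ^ Suc n) = mul (rconst (of_nat (Suc n) * bil w v)) * dv w ^ n"
proof (induction n)
  case 0
  show ?case using ad_of_nat[of v 1] by simp
next
  case (Suc n)
  have "ad v (dv w ^ Suc (Suc n)) = dv w * ad v (dv w ^ Suc n) + mul (rconst (bil w v)) * dv w ^ Suc n"
    by (subst power_Suc) (simp only: ad_simps)
  also have "dv w * ad v (dv w ^ Suc n) = mul (rconst (of_nat (Suc n) * bil w v)) * dv w ^ Suc n"
    unfolding Suc.IH by (simp only: mult.assoc[symmetric] mul_rconst_commute power_Suc)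
  finally show ?case
    by (simp only: distrib_right[symmetric] mul_simps(3)[symmetric] rconst_simps(3)[symmetric])
      (simp add: algebra_simps)
qed

text \<open>\<open>ad v\<close> differentiates symbols in xi along v, and n such derivatives of a
  form of degree n give n! times its value at v.\<close>

lemma ad_funpow_monomial:
  "i + j = n \<Longrightarrow> (ad v ^^ n) (dv e1 ^ i * dv e2 ^ j) = mul (rconst (fact n * (v $ 1 ^ i * v $ 2 ^ j)))"
proof (induction n arbitrary: i j)
  case (Suc n)
  have 1: "(ad v ^^ n) (ad v (dv e1 ^ i) * dv e2 ^ j)
      = mul (rconst (of_nat i * fact n * (v $ 1 ^ i * v $ 2 ^ j)))"
  proof (cases i)
    case 0
    then show ?thesis using ad_of_nat[of v 1] by simp
  next
    case (Suc i')
    have "ad v (dv e1 ^ i) * dv e2 ^ j = mul (rconst (of_nat i * v $ 1)) * (dv e1 ^ i' * dv e2 ^ j)"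
      unfolding Suc ad_dv_power by (simp only: mult.assoc bil_axis)
    then have "(ad v ^^ n) (ad v (dv e1 ^ i) * dv e2 ^ j)
        = mul (rconst (of_nat i * v $ 1) * rconst (fact n * (v $ 1 ^ i' * v $ 2 ^ j)))"
      using Suc.IH[of i' j] Suc Suc.prems by (simp only: ad_funpow_mul_times mul_simps(6))
    also have "rconst (of_nat i * v $ 1) * rconst (fact n * (v $ 1 ^ i' * v $ 2 ^ j))
        = rconst (of_nat i * fact n * (v $ 1 ^ i * v $ 2 ^ j))"
      unfolding rconst_simps(6)[symmetric] by (rule arg_cong[of _ _ rconst]) (simp add: Suc)
    finally show ?thesis .
  qed
  have 2: "(ad v ^^ n) (dv e1 ^ i * ad v (dv e2 ^ j))
      = mul (rconst (of_nat j * fact n * (v $ 1 ^ i * v $ 2 ^ j)))"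
  proof (cases j)
    case 0
    then show ?thesis using ad_of_nat[of v 1] by simp
  next
    case (Suc j')
    have "dv e1 ^ i * ad v (dv e2 ^ j) = mul (rconst (of_nat j * v $ 2)) * (dv e1 ^ i * dv e2 ^ j')"
      unfolding Suc ad_dv_power by (simp only: mult.assoc[symmetric] mul_rconst_commute bil_axis)
    then have "(ad v ^^ n) (dv e1 ^ i * ad v (dv e2 ^ j))
        = mul (rconst (of_nat j * v $ 2) * rconst (fact n * (v $ 1 ^ i * v $ 2 ^ j')))"
      using Suc.IH[of i j'] Suc Suc.prems by (simp only: ad_funpow_mul_times mul_simps(6))
    also have "rconst (of_nat j * v $ 2) * rconst (fact n * (v $ 1 ^ i * v $ 2 ^ j'))
        = rconst (of_nat j * fact n * (v $ 1 ^ i * v $ 2 ^ j))"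
      unfolding rconst_simps(6)[symmetric] by (rule arg_cong[of _ _ rconst]) (simp add: Suc)
    finally show ?thesis .
  qed
  have "(ad v ^^ Suc n) (dv e1 ^ i * dv e2 ^ j)
      = (ad v ^^ n) (dv e1 ^ i * ad v (dv e2 ^ j) + ad v (dv e1 ^ i) * dv e2 ^ j)"
    by (simp only: funpow_Suc_right comp_apply ad_simps)
  also have "\<dots> = mul (rconst ((of_nat j * fact n + of_nat i * fact n) * (v $ 1 ^ i * v $ 2 ^ j)))"
    by (simp only: ad_funpow_add 1 2 mul_simps(3)[symmetric] rconst_simps(3)[symmetric] distrib_right)
  also have "of_nat j * fact n + of_nat i * fact n = (fact (Suc n) :: complex)"
    unfolding Suc.prems[symmetric] distrib_right[symmetric] of_nat_add[symmetric]
    using Suc.prems by (simp add: add.commute)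
  finally show ?case .
qed simp

lemma ordlt_monomial: "ordlt (Suc (i + j)) (mul c * (dv e1 ^ i * dv e2 ^ j))"
  using ordlt_mul_times[OF ordlt_times[OF ordlt_dv_power[of i e1] ordlt_dv_power[of j e2]]] by simp

lemma order_ge: "(i, j) \<in> Poly_Mapping.keys P \<Longrightarrow> i + j \<le> diffop_order P"
  unfolding diffop_order_def by (intro Max_ge) force+

lemma ev_principal_symbol:
  "ev v (principal_symbol P)
    = (\<Sum>(i, j)\<in>{(i, j)\<in>Poly_Mapping.keys P. i + j = diffop_order P}.
        Poly_Mapping.lookup P (i, j) * rconst (v $ 1 ^ i * v $ 2 ^ j))"
  unfolding principal_symbol_def ev_sum by (intro sum.cong refl) (auto simp: ev_single)

lemma ad_funpow_order:
  "(ad v ^^ diffop_order P) (endo_of P) = mul (rconst (fact (diffop_order P)) * ev v (principal_symbol P))"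
proof -
  define m where "m = diffop_order P"
  have low: "(ad v ^^ m) (dv e1 ^ i * dv e2 ^ j) = 0" if "(i, j) \<in> Poly_Mapping.keys P" "i + j \<noteq> m" for i j
  proof -
    have "Suc (i + j) \<le> m" using that order_ge m_def by fastforce
    then show ?thesis
      using ordlt_mono[OF ordlt_monomial[of i j 1]] by (intro ad_funpow_eq_0) simp
  qed
  have "(ad v ^^ m) (endo_of P) = (\<Sum>(i, j)\<in>Poly_Mapping.keys P.
      mul (Poly_Mapping.lookup P (i, j)) * (ad v ^^ m) (dv e1 ^ i * dv e2 ^ j))"
    unfolding endo_of_def by (simp add: ad_funpow_sum case_prod_unfold ad_funpow_mul_times)
  also have "\<dots> = (\<Sum>(i, j)\<in>{(i, j)\<in>Poly_Mapping.keys P. i + j = m}.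
      mul (Poly_Mapping.lookup P (i, j)) * (ad v ^^ m) (dv e1 ^ i * dv e2 ^ j))"
    by (intro sum.mono_neutral_right) (auto, metis low mult_zero_right)
  also have "\<dots> = (\<Sum>(i, j)\<in>{(i, j)\<in>Poly_Mapping.keys P. i + j = m}.
      mul (rconst (fact m) * (Poly_Mapping.lookup P (i, j) * rconst (v $ 1 ^ i * v $ 2 ^ j))))"
    by (intro sum.cong refl)
      (auto simp only: ad_funpow_monomial mul_simps(6)[symmetric] rconst_simps(6) mult_ac)
  also have "\<dots> = mul (rconst (fact m) * ev v (principal_symbol P))"
  proof -
    have "mul (sum f A) = (\<Sum>x\<in>A. mul (f x))" for f :: "nat \<times> nat \<Rightarrow> ratfun" and A
      by (induction A rule: infinite_finite_induct) simp_all
    then show ?thesis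
      unfolding ev_principal_symbol m_def[symmetric] sum_distrib_left
      by (simp add: case_prod_unfold)
  qed
  finally show ?thesis by (simp only: m_def)
qed

lemma ev_principal_symbol_nonzero:
  assumes "P \<noteq> 0"
  shows "\<exists>v. ev v (principal_symbol P) \<noteq> 0"
proof (rule ccontr)
  assume "\<not> ?thesis"
  then have z: "ev v (principal_symbol P) = 0" for v by simp
  define m where "m = diffop_order P"
  have "Poly_Mapping.keys P \<noteq> {}" using assms by simp
  then have "m \<in> (\<lambda>(i, j). i + j) ` Poly_Mapping.keys P"
    unfolding m_def diffop_order_def by (intro Max_in) auto
  then obtain i j where ij: "(i, j) \<in> Poly_Mapping.keys P" "i + j = m" by auto
  have "(\<Sum>i\<le>m. Poly_Mapping.lookup P (i, m - i) * rconst x ^ i) = 0" for x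
  proof -
    \<comment> \<open>Dehomogenisation: the symbol becomes a polynomial in one variable over the
      function field, with every constant as a root.\<close>
    define v :: plane where "v = (\<chi> i. if i = 1 then x else 1)"
    have "ev v (principal_symbol P) = (\<Sum>(i, j)\<in>(\<lambda>i. (i, m - i)) ` {..m}.
        Poly_Mapping.lookup P (i, j) * rconst (v $ 1 ^ i * v $ 2 ^ j))"
      unfolding ev_principal_symbol m_def[symmetric]
      by (intro sum.mono_neutral_left) (auto simp: in_keys_iff image_iff)
    also have "\<dots> = (\<Sum>i\<le>m. Poly_Mapping.lookup P (i, m - i) * rconst x ^ i)"
      by (subst sum.reindex) (auto simp: inj_on_def v_def)
    finally show ?thesis using z by simp
  qed
  then have 0: "(\<Sum>i\<le>m. Poly_Mapping.lookup P (i, m - i) * y ^ i) = 0" if "y \<in> range rconst" for y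
    using that by blast
  have inf: "infinite (range rconst)"
    using infinite_UNIV_char_0 by (subst finite_image_iff) (auto simp: inj_on_def)
  have "i \<le> m" using ij(2) by simp
  then have "Poly_Mapping.lookup P (i, m - i) = 0"
    using poly_vanish[where c = "\<lambda>i. Poly_Mapping.lookup P (i, m - i)" and i = i, OF inf 0] by simp
  moreover have "m - i = j" using ij(2) by simp
  ultimately show False using ij(1) by (simp add: in_keys_iff)
qed

text \<open>\<open>ord\<close> and \<open>ne\<close> fix the order in the sense of commutators. It
  agrees with \<open>diffop_order P\<close>: a larger one would give a symbol that is zero
  everywhere, a smaller one contradicts \<open>ne\<close>.\<close>

lemma ev_principal_symbol_eq:
  assumes D: "endo_of P = D" and ord: "ordlt (Suc m) D" and ne: "(ad u ^^ m) D \<noteq> 0"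
  shows "mul (rconst (fact m) * ev v (principal_symbol P)) = (ad v ^^ m) D"
proof -
  have "P \<noteq> 0"
  proof
    assume "P = 0"
    then have "D = 0" using D by (simp add: endo_of_def)
    then show False using ne by simp
  qed
  then obtain w where w: "ev w (principal_symbol P) \<noteq> 0" using ev_principal_symbol_nonzero by blast
  have "diffop_order P = m"
  proof (rule ccontr)
    assume "diffop_order P \<noteq> m"
    then consider "m < diffop_order P" | "diffop_order P < m" by linarith
    then show False
    proof cases
      case 1
      then have "(ad w ^^ diffop_order P) D = 0"
        using ordlt_mono[OF ord] by (intro ad_funpow_eq_0) simp
      then have "rconst (fact (diffop_order P)) * ev w (principal_symbol P) = 0"
        using ad_funpow_order[where v = w and P = P] D by (metis mul_eq_0_iff)
      then show False using w by simp
    next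
      case 2
      have "ordlt m (endo_of P)"
        unfolding endo_of_def case_prod_unfold
      proof (rule ordlt_sum)
        fix x assume "x \<in> Poly_Mapping.keys P"
        then have "fst x + snd x \<le> diffop_order P" using order_ge[of "fst x" "snd x" P] by simp
        then show "ordlt m (mul (Poly_Mapping.lookup P (fst x, snd x)) * (dv e1 ^ fst x * dv e2 ^ snd x))"
          using 2 by (intro ordlt_mono[OF ordlt_monomial]) simp
      qed
      then show False using ne D ad_funpow_eq_0 by metis
    qed
  qed
  then show ?thesis using ad_funpow_order[where v = v and P = P] D by simp
qed

section \<open>Algebraic independence of the symbols\<close>

lemma eval2_sum: "eval2 (sum f A) v = (\<Sum>x\<in>A. eval2 (f x) v)"
  by (induction A rule: infinite_finite_induct) simp_all

lemma eval2_power: "eval2 (p ^ n) v = eval2 p v ^ n"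
  by (induction n) simp_all

lemma lin_powers_independent:
  assumes w: "w \<noteq> 0" and z: "(\<Sum>j\<le>n. rconst (c j) * (lin w)\<^sup>2 ^ j) = 0" and j: "j \<le> n"
  shows "c j = 0"
proof -
  obtain u where u: "bil w u = 1"
  proof (cases "w $ 1 = 0")
    case True
    then have "w $ 2 \<noteq> 0" using w by (auto simp: vec_eq_iff forall_2)
    then show ?thesis using that[of "inverse (w $ 2) *s e2"] by (simp add: bil_simps)
  next
    case False
    then show ?thesis using that[of "inverse (w $ 1) *s e1"] by (simp add: bil_simps)
  qed
  define T where "T = (\<Sum>j\<le>n. [:[:c j:]:] * (linp w)\<^sup>2 ^ j)"
  have "to_fract T = (\<Sum>j\<le>n. rconst (c j) * (lin w)\<^sup>2 ^ j)"
    unfolding T_def to_fract_sum by (simp only: to_fract_mult to_fract_power to_fract_linp rconst_def)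
  then have "T = 0" using z by simp
  have "(\<Sum>j\<le>n. c j * y ^ j) = 0" for y
  proof -
    \<comment> \<open>At this point the square of the linear form takes the prescribed value
      y.\<close>
    have "eval2 T (csqrt y *s u) = 0" using \<open>T = 0\<close> by simp
    then show ?thesis
      by (simp only: T_def eval2_sum eval2_simps eval2_power eval2_linp bil_simps u mult_1_right power2_csqrt)
  qed
  then show ?thesis
    using poly_vanish[where A = UNIV and n = n and c = c] infinite_UNIV_char_0 j by blast
qed

text \<open>The quadratic form splits into two linear factors; this one is the pairing of \<beta>
  with the isotropic vector (1, i).\<close>

lemma nonisotropic_factor:
  fixes \<beta> :: plane
  assumes "bil \<beta> \<beta> \<noteq> 0"
  shows "\<beta> $ 1 + \<i> * \<beta> $ 2 \<noteq> 0"
proof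
  assume "\<beta> $ 1 + \<i> * \<beta> $ 2 = 0"
  moreover have "bil \<beta> \<beta> = (\<beta> $ 1 + \<i> * \<beta> $ 2) * (\<beta> $ 1 - \<i> * \<beta> $ 2)"
    by (simp add: bil_eq algebra_simps)
  ultimately show False using assms by simp
qed

text \<open>Only \<open>b\<close> involves the point of the plane, through the square of a linear
  form whose powers are independent. This leaves, for each exponent j, a relation between
  \<open>bil v v\<close> and the form \<open>c\<close>. Induction on the exponent of
  \<open>bil v v\<close> divides by it and restricts to an isotropic line, on which \<open>c\<close>
  takes every nonzero value.\<close>

lemma alg_indep3I:
  fixes S :: "plane set"
  assumes a: "\<And>v. ev v a = rconst (bil v v)" and b: "\<And>v. ev v b = (lin (perp v))\<^sup>2"
    and c: "\<And>v. ev v c = rconst (c0 * (\<Prod>\<beta>\<in>S. bil v \<beta>) ^ r)"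
    and c0: "c0 \<noteq> 0" and r: "r > 0" and S: "finite S" "S \<noteq> {}" "\<And>\<beta>. \<beta> \<in> S \<Longrightarrow> bil \<beta> \<beta> \<noteq> 0"
  shows "alg_indep3 a b c"
  unfolding alg_indep3_def
proof (intro allI impI)
  fix P :: "(nat \<times> nat \<times> nat) \<Rightarrow>\<^sub>0 complex"
  define p where "p i j l = Poly_Mapping.lookup P (i, j, l)" for i j l
  define h where "h v = c0 * (\<Prod>\<beta>\<in>S. bil v \<beta>) ^ r" for v
  assume z: "(\<Sum>(i, j, l)\<in>Poly_Mapping.keys P.
      Poly_Mapping.single 0 (rconst (Poly_Mapping.lookup P (i, j, l))) * a ^ i * b ^ j * c ^ l) = 0"
  have ev0: "(\<Sum>(i, j, l)\<in>Poly_Mapping.keys P.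
      rconst (p i j l) * rconst (bil v v) ^ i * (lin (perp v))\<^sup>2 ^ j * rconst (h v) ^ l) = 0" for v
  proof -
    have "ev v (\<Sum>(i, j, l)\<in>Poly_Mapping.keys P.
        Poly_Mapping.single 0 (rconst (p i j l)) * a ^ i * b ^ j * c ^ l) = 0"
      using z by (simp only: p_def ev_0)
    then show ?thesis
      by (simp only: ev_sum case_prod_unfold ev_mult ev_power ev_const a b c h_def)
  qed
  obtain n where n: "Poly_Mapping.keys P \<subseteq> {..n} \<times> {..n} \<times> {..n}"
  proof
    let ?n = "\<Sum>(i, j, l)\<in>Poly_Mapping.keys P. i + j + l"
    show "Poly_Mapping.keys P \<subseteq> {..?n} \<times> {..?n} \<times> {..?n}"
    proof
      fix x assume x: "x \<in> Poly_Mapping.keys P"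
      obtain i j l where ijl: "x = (i, j, l)" by (cases x)
      have "(case x of (i, j, l) \<Rightarrow> i + j + l) \<le> ?n"
        using x by (intro member_le_sum) auto
      then show "x \<in> {..?n} \<times> {..?n} \<times> {..?n}" by (simp add: ijl)
    qed
  qed
  have "(\<Sum>i\<le>n. \<Sum>l\<le>n. p i j l * bil v v ^ i * h v ^ l) = 0" if "v \<noteq> 0" "j \<le> n" for v j
  proof -
    have "(\<Sum>(i, j, l)\<in>{..n} \<times> {..n} \<times> {..n}.
        rconst (p i j l) * rconst (bil v v) ^ i * (lin (perp v))\<^sup>2 ^ j * rconst (h v) ^ l) = 0"
      unfolding ev0[of v, symmetric]
      using n by (intro sum.mono_neutral_right) (auto simp: p_def in_keys_iff)
    then have "(\<Sum>i\<le>n. \<Sum>j\<le>n. \<Sum>l\<le>n.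
        rconst (p i j l) * rconst (bil v v) ^ i * (lin (perp v))\<^sup>2 ^ j * rconst (h v) ^ l) = 0"
      by (simp only: sum.cartesian_product prod.case)
    then have "(\<Sum>j\<le>n. \<Sum>i\<le>n. \<Sum>l\<le>n.
        rconst (p i j l) * rconst (bil v v) ^ i * (lin (perp v))\<^sup>2 ^ j * rconst (h v) ^ l) = 0"
      by (subst sum.swap)
    also have "(\<Sum>j\<le>n. \<Sum>i\<le>n. \<Sum>l\<le>n.
          rconst (p i j l) * rconst (bil v v) ^ i * (lin (perp v))\<^sup>2 ^ j * rconst (h v) ^ l)
        = (\<Sum>j\<le>n. rconst (\<Sum>i\<le>n. \<Sum>l\<le>n. p i j l * bil v v ^ i * h v ^ l) * (lin (perp v))\<^sup>2 ^ j)"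
      by (intro sum.cong refl)
        (simp only: rconst_sum sum_distrib_left sum_distrib_right rconst_simps(6) rconst_power mult_ac)
    finally have "(\<Sum>j\<le>n. rconst (\<Sum>i\<le>n. \<Sum>l\<le>n. p i j l * bil v v ^ i * h v ^ l) * (lin (perp v))\<^sup>2 ^ j) = 0" .
    moreover have "perp v \<noteq> 0" using that(1) by (auto simp: vec_eq_iff forall_2)
    ultimately show ?thesis
      using lin_powers_independent[where w = "perp v" and n = n
          and c = "\<lambda>j. \<Sum>i\<le>n. \<Sum>l\<le>n. p i j l * bil v v ^ i * h v ^ l"] that(2)
      by (simp only: not_False_eq_True)
  qed
  note vanish = this
  have "p i j l = 0" if "i \<le> n" "j \<le> n" "l \<le> n" for i j l
    using that(1,3)
  proof (induction i arbitrary: l rule: less_induct)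
    case (less i)
    text \<open>
      The point of parameter \<open>s = 0\<close> is isotropic: there the symbol of the Laplacian vanishes, to
      first order in \<open>s\<close>, whereas \<open>h\<close> does not vanish.
    \<close>
    define pt :: "complex \<Rightarrow> complex \<Rightarrow> plane" where
      "pt x s = (\<chi> m. if m = 1 then x else x * (\<i> + s))" for x s
    define q where "q x s = x\<^sup>2 * (s * (2 * \<i> + s))" for x s
    have q: "bil (pt x s) (pt x s) = q x s" for x s
      by (simp add: pt_def bil_eq q_def power2_eq_square algebra_simps)
    define H where "H x s = c0 * (\<Prod>\<beta>\<in>S. x * (\<beta> $ 1 + (\<i> + s) * \<beta> $ 2)) ^ r" for x s
    have H: "h (pt x s) = H x s" for x s
      by (simp add: h_def H_def pt_def bil_eq algebra_simps)
    define F where "F x s = (\<Sum>i'\<in>{i..n}. \<Sum>l\<le>n. p i' j l * q x s ^ (i' - i) * H x s ^ l)" for x s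
    have F0: "F x s = 0" if "x \<noteq> 0" "s \<noteq> 0" "s \<noteq> - 2 * \<i>" for x s
    proof -
      have "pt x s \<noteq> 0" using that(1) by (auto simp: pt_def vec_eq_iff forall_2)
      then have "0 = (\<Sum>i'\<le>n. \<Sum>l\<le>n. p i' j l * q x s ^ i' * H x s ^ l)"
        using vanish[OF _ \<open>j \<le> n\<close>, of "pt x s"] by (simp add: q H)
      also have "\<dots> = (\<Sum>i'\<in>{i..n}. \<Sum>l\<le>n. p i' j l * q x s ^ i' * H x s ^ l)"
        using less.IH less.prems(1) by (intro sum.mono_neutral_right) (auto intro!: sum.neutral)
      also have "\<dots> = q x s ^ i * F x s"
        unfolding F_def sum_distrib_left
      proof (intro sum.cong refl)
        fix i' l assume "i' \<in> {i..n}"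
        then have "q x s ^ i' = q x s ^ i * q x s ^ (i' - i)" by (simp flip: power_add)
        then show "p i' j l * q x s ^ i' * H x s ^ l = q x s ^ i * (p i' j l * q x s ^ (i' - i) * H x s ^ l)"
          by simp
      qed
      finally have "q x s ^ i * F x s = 0" by simp
      moreover have "2 * \<i> + s \<noteq> 0" using that(3) by (simp add: add_eq_0_iff)
      then have "q x s \<noteq> 0" using that by (simp add: q_def)
      ultimately show ?thesis by simp
    qed
    \<comment> \<open>At s = 0 the factor \<open>q\<close> vanishes, so dividing by its power was
      possible only nearby; continuity supplies the value. The two values of s excluded in
      \<open>F0\<close> are the isotropic directions.\<close>
    have F00: "F x 0 = 0" if "x \<noteq> 0" for x
    proof -
      have "isCont (F x) 0"
        unfolding F_def q_def H_def by (intro continuous_intros)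
      then have "(F x \<longlongrightarrow> F x 0) (at 0)" by (simp add: isCont_def)
      moreover have "eventually (\<lambda>s. F x s = 0) (at 0)"
        unfolding eventually_at
      proof (intro exI[of _ 1] conjI ballI impI)
        fix s :: complex assume s: "s \<noteq> 0 \<and> dist s 0 < 1"
        then have "s \<noteq> - 2 * \<i>" by (auto simp: norm_mult)
        then show "F x s = 0" using F0[OF that] s by blast
      qed simp
      then have "(F x \<longlongrightarrow> 0) (at 0)" by (rule tendsto_eventually)
      ultimately show ?thesis by (rule tendsto_unique[rotated]) simp
    qed
    define h0 where "h0 = c0 * (\<Prod>\<beta>\<in>S. \<beta> $ 1 + \<i> * \<beta> $ 2) ^ r"
    have h0: "h0 \<noteq> 0" using c0 S(1,3) nonisotropic_factor by (auto simp: h0_def)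
    have H0: "H x 0 = h0 * x ^ (card S * r)" for x
      by (simp add: H_def h0_def prod.distrib power_mult_distrib power_mult)
    have F_eq: "F x 0 = (\<Sum>l\<le>n. p i j l * H x 0 ^ l)" for x
    proof -
      have "F x 0 = (\<Sum>i'\<in>{i}. \<Sum>l\<le>n. p i' j l * q x 0 ^ (i' - i) * H x 0 ^ l)"
        unfolding F_def using less.prems(1)
        by (intro sum.mono_neutral_right) (auto simp: q_def intro!: sum.neutral)
      then show ?thesis by simp
    qed
    have "(\<Sum>l\<le>n. p i j l * y ^ l) = 0" if "y \<in> - {0}" for y
    proof -
      \<comment> \<open>\<open>H x 0\<close> is \<open>h0\<close> times a power of x with positive
        exponent, so complex roots reach every nonzero y.\<close>
      have "card S * r \<noteq> 0" using S r by (simp add: card_gt_0_iff)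
      then obtain x where x: "y / h0 = x ^ (card S * r)" using exists_complex_root by blast
      have "x \<noteq> 0" using x that h0 \<open>card S * r \<noteq> 0\<close> by (auto simp: power_0_left)
      moreover have "H x 0 = y" using x h0 by (simp add: H0 field_simps)
      ultimately show ?thesis using F00[of x] by (simp add: F_eq)
    qed
    moreover have "infinite (- {0 :: complex})"
      using infinite_UNIV_char_0 by (simp add: finite_compl)
    ultimately show "p i j l = 0"
      using poly_vanish[where c = "p i j" and A = "- {0}"] less.prems by blast
  qed
  then have "Poly_Mapping.lookup P x = 0" for x
  proof (cases "x \<in> Poly_Mapping.keys P")
    case True
    obtain i j l where "x = (i, j, l)" by (cases x)
    then show ?thesis using \<open>\<And>l j i. _ \<Longrightarrow> _ \<Longrightarrow> _ \<Longrightarrow> p i j l = 0\<close>[of i j l] True n by (auto simp: p_def)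
  qed (simp add: in_keys_iff)
  then show "P = 0" by (intro poly_mapping_eqI) simp
qed

section \<open>The angular operator\<close>

definition rot :: endo where
  "rot = mul (lin e1) * dv e2 - mul (lin e2) * dv e1"

lemma app_rot: "app rot f = lin e1 * der e2 f - lin e2 * der e1 f"
  by (simp add: rot_def)

lemma com_rot_mul: "com rot (mul f) = mul (app rot f)"
  by (simp add: rot_def com_diff_left com_mult_left)

text \<open>Polar coordinates: \<open>eul\<close> is the radial part and \<open>rot\<close> the
  angular one. In dimension d there would be a further term (d - 2) \<open>eul\<close>.\<close>

lemma rsq_lap: "mul rsq * lap = eul * eul + rot * rot"
proof (rule endo_eqI)
  fix f
  show "app (mul rsq * lap) f = app (eul * eul + rot * rot) f"
    by (simp add: rsq_def lap_def eul_def rot_def der_add der_diff der_mult der_commute[of e2 e1]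
        power2_eq_square algebra_simps)
qed

lemma com_rot_eul: "com rot eul = 0"
proof -
  have "com eul rot = 0"
    by (simp add: rot_def com_diff_right com_mult_right)
  then show ?thesis using com_anti[of rot eul] by simp
qed

lemma ad_rot: "ad v rot = - mul (lin (perp v))"
  by (subst lin_expand) (simp add: rot_def mul_rconst_commute)

lemma rsq_nonzero: "rsq \<noteq> 0"
proof
  assume "rsq = 0"
  then have "app lap rsq = 0" by simp
  moreover have "app lap rsq = 4"
    by (simp add: lap_def der_rsq der_mult)
  ultimately show False by simp
qed

definition ang :: "ratfun \<Rightarrow> endo" where
  "ang w = rot * rot - mul (rsq * w)"

lemma ordlt_rot: "ordlt 2 rot"
  unfolding rot_def numeral_2_eq_2 by (intro ordlt_diff ordlt_mul_times ordlt_dv)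

lemma ordlt_3_mul: "ordlt 3 (mul f)"
  using ordlt_mul[of 2 f] by (simp add: numeral_3_eq_3 numeral_2_eq_2)

lemma ordlt_ang: "ordlt 3 (ang w)"
  unfolding ang_def using ordlt_times[OF ordlt_rot ordlt_rot]
  by (intro ordlt_diff ordlt_3_mul) simp

lemma ad_ang: "(ad v ^^ 2) (ang w) = mul (2 * (lin (perp v))\<^sup>2)"
proof -
  have "ad v (- D) = - ad v D" for D
    using ad_simps(5)[of v 0 D] by simp
  then show ?thesis
    by (simp add: ang_def numeral_2_eq_2 ad_rot) (simp add: mult_2)
qed

context schroedinger
begin

text \<open>After multiplication by \<open>rsq\<close> the operator is a combination of
  \<open>eul\<close>, \<open>ang w\<close> and functions of \<open>rsq\<close>, all of which commute
  with \<open>ang w\<close>. As \<open>rsq\<close> also commutes with \<open>ang w\<close> and is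
  invertible, it can be cancelled.\<close>

lemma com_ang: "com (ang w) (L - mul (rconst (\<omega>\<^sup>2) * rsq)) = 0"
proof -
  define H where "H = L - mul (rconst (\<omega>\<^sup>2) * rsq)"
  have "app eul (rsq * w) = 0"
    unfolding app_eul_mult app_eul_rsq hom_w by simp
  then have "com (mul (rsq * w)) eul = 0"
    using com_anti[of "mul (rsq * w)" eul] by (simp del: mul_simps)
  then have eul: "com (ang w) eul = 0"
    unfolding ang_def com_diff_left by (simp only: com_mult_left com_rot_eul) simp
  have "app rot rsq = 0"
    by (simp add: app_rot der_rsq algebra_simps)
  then have "com rot (mul rsq) = 0" by (simp add: com_rot_mul)
  then have rsq: "com (ang w) (mul rsq) = 0"
    unfolding ang_def com_diff_left by (simp only: com_mult_left com_mul_mul) simp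
  have swap: "mul rsq * mul (rconst a * rsq) = mul (rconst a) * (mul rsq * mul rsq)" for a
    unfolding mul_simps(6)[symmetric] by (simp only: mult_ac)
  have "mul rsq * H = eul * eul + ang w - mul (rconst (\<omega>\<^sup>2)) * (mul rsq * mul rsq)"
    unfolding H_def L_def ang_def right_diff_distrib rsq_lap swap by (simp add: algebra_simps)
  then have "com (ang w) (mul rsq * H) = 0"
    by (simp only: com_add_right com_diff_right com_mult_right eul rsq com_0 com_mul_rconst) simp
  then have "mul rsq * com (ang w) H = 0"
    by (simp only: com_mult_right rsq) simp
  then have "mul (inverse rsq) * (mul rsq * com (ang w) H) = 0" by simp
  then have "mul (inverse rsq * rsq) * com (ang w) H = 0" by (simp only: mul_simps(6) mult.assoc)
  then show ?thesis using rsq_nonzero by (simp add: H_def)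
qed

end

section \<open>Superintegrability\<close>

lemma der_funpow_const_mult:
  assumes "(der v ^^ p) f = rconst a" "(der v ^^ q) h = rconst b"
  shows "(der v ^^ (p + q)) (f * h) = rconst (of_nat ((p + q) choose p) * a * b)"
  using assms
proof (induction "p + q" arbitrary: p q f h a b rule: less_induct)
  case less
  show ?case
  proof (cases "p = 0 \<or> q = 0")
    case True
    then show ?thesis using less.prems der_funpow_rconst_mult[where n = q and f = h and c = a]
        der_funpow_rconst_mult[where n = p and f = f and c = b] by (auto simp: mult.commute)
  next
    case False
    then obtain p' q' where pq: "p = Suc p'" "q = Suc q'" by (auto simp: gr0_conv_Suc)
    have "(der v ^^ (p' + q)) (der v f * h) = rconst (of_nat ((p' + q) choose p') * a * b)"
      using less.prems by (intro less.hyps) (auto simp: pq der_funpow_commute)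
    moreover have "(der v ^^ (p + q')) (f * der v h) = rconst (of_nat ((p + q') choose p) * a * b)"
      using less.prems by (intro less.hyps) (auto simp: pq der_funpow_commute)
    moreover have "(der v ^^ (p + q)) (f * h)
        = (der v ^^ (p' + q)) (der v f * h) + (der v ^^ (p + q')) (f * der v h)"
    proof -
      have "(der v ^^ (p + q)) (f * h) = (der v ^^ (p' + q)) (der v (f * h))"
        by (simp add: pq der_funpow_commute)
      moreover have "p + q' = p' + q" by (simp add: pq)
      ultimately show ?thesis by (simp only: der_mult der_funpow_add)
    qed
    ultimately have "(der v ^^ (p + q)) (f * h)
        = rconst ((of_nat ((p' + q) choose p') + of_nat ((p + q') choose p)) * a * b)"
      by (simp only: distrib_right rconst_simps(3))
    also have "of_nat ((p' + q) choose p') + of_nat ((p + q') choose p) = (of_nat ((p + q) choose p) :: complex)"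
      unfolding of_nat_add[symmetric] pq by (simp add: add.commute)
    finally show ?thesis .
  qed
qed

text \<open>Divided by factorials, top derivatives multiply like values at v.\<close>

lemma der_funpow_fact_mult:
  assumes "(der v ^^ p) f = rconst (fact p * a)" "(der v ^^ q) h = rconst (fact q * b)"
  shows "(der v ^^ (p + q)) (f * h) = rconst (fact (p + q) * (a * b))"
proof -
  have "fact p * fact q * of_nat ((p + q) choose p) = (fact (p + q) :: complex)"
    using binomial_fact_lemma[of p "p + q"] by (metis diff_add_inverse le_add1 of_nat_fact of_nat_mult)
  then have eq: "of_nat ((p + q) choose p) * (fact p * a) * (fact q * b) = fact (p + q) * (a * b)"
    by (metis (no_types, lifting) mult.assoc mult.commute mult.left_commute)
  show ?thesis using der_funpow_const_mult[OF assms] unfolding eq .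
qed

text \<open>A form of degree n, differentiated n times along v, gives n! times its value at v; this
  turns the symbol of rung \<open>N\<close> into a multiple of \<open>g\<close> at xi.\<close>

lemma der_funpow_prod_lin:
  assumes "finite S"
  shows "(der v ^^ (card S * r)) ((\<Prod>\<beta>\<in>S. lin \<beta>) ^ r) = rconst (fact (card S * r) * (\<Prod>\<beta>\<in>S. bil v \<beta>) ^ r)"
proof -
  have 1: "(der v ^^ card S) (\<Prod>\<beta>\<in>S. lin \<beta>) = rconst (fact (card S) * (\<Prod>\<beta>\<in>S. bil v \<beta>))"
    using assms
  proof (induction S rule: finite_induct)
    case (insert \<beta> S)
    have "(der v ^^ (1 + card S)) (lin \<beta> * (\<Prod>\<beta>\<in>S. lin \<beta>))
        = rconst (fact (1 + card S) * (bil v \<beta> * (\<Prod>\<beta>\<in>S. bil v \<beta>)))"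
      by (rule der_funpow_fact_mult) (simp_all add: insert.IH del: rconst_simps)
    then show ?case using insert.hyps by (simp only: card.insert prod.insert plus_1_eq_Suc not_False_eq_True)
  qed simp
  show ?thesis
  proof (induction r)
    case (Suc r)
    show ?case
      using der_funpow_fact_mult[OF 1 Suc] by (simp only: power_Suc mult_Suc_right)
  qed simp
qed

context locus
begin

lemma endo_of_calogero_moser:
  "endo_of (calogero_moser Ap k \<omega>) = L - mul (rconst (\<omega>\<^sup>2) * rsq)"
proof (rule endo_eqI)
  fix f
  have "bil gen_pt gen_pt = rsq"
    by (simp add: rsq_def bil_eq gen_pt_def power2_eq_square coord_lin e1_def e2_def)
  then show "app (endo_of (calogero_moser Ap k \<omega>)) f = app (L - mul (rconst (\<omega>\<^sup>2) * rsq)) f"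
    unfolding app_endo_of act_calogero_moser L_def lap_def pot_def[symmetric]
    by (simp add: e1_def e2_def der_axis algebra_simps del: mul_simps mul_power rconst_power)
qed

lemma is_diffop_L: "is_diffop L"
  unfolding L_def lap_def
  by (intro is_diffop_diff is_diffop_add is_diffop_mul is_diffop_times)
    (use is_diffop_dv_times[OF is_diffop_mul[of 1]] in simp_all)

lemma is_diffop_X: "is_diffop (X n)"
  by (induction n) (simp_all add: X_simps is_diffop_mul is_diffop_com is_diffop_L)

lemma is_diffop_Q: "is_diffop (Q \<omega>)"
  unfolding Q_def by (intro is_diffop_sum is_diffop_mul_times is_diffop_X)

lemma is_diffop_ang: "is_diffop (ang w)"
  unfolding ang_def rot_def
  by (intro is_diffop_diff is_diffop_mul is_diffop_times)
    (use is_diffop_dv_times[OF is_diffop_mul[of 1]] in simp_all)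

lemma superintegrable: "superintegrable (calogero_moser Ap k \<omega>)"
proof -
  define H where "H = L - mul (rconst (\<omega>\<^sup>2) * rsq)"
  define LL where "LL = calogero_moser Ap k \<omega>"
  have LL: "endo_of LL = H" by (simp only: LL_def H_def endo_of_calogero_moser)
  obtain PM where PM: "endo_of PM = ang pot" using is_diffop_ang by (auto simp: is_diffop_def)
  obtain PQ where PQ: "endo_of PQ = Q \<omega>" using is_diffop_Q by (auto simp: is_diffop_def)
  have "commute PM LL"
    by (rule commuteI) (simp only: PM LL H_def com_ang)
  moreover have "commute PQ LL"
  proof (rule commuteI)
    have "com (Q \<omega>) H = - com H (Q \<omega>)" by (rule com_anti)
    then show "com (endo_of PQ) (endo_of LL) = 0"
      using com_Q[OF X_Suc_N even_N] by (simp add: PQ LL H_def)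
  qed
  moreover have "alg_indep3 (principal_symbol LL) (principal_symbol PM) (principal_symbol PQ)"
  proof (rule alg_indep3I)
    have H2: "(ad v ^^ 2) H = mul (2 * rconst (bil v v))" for v
      by (simp add: H_def numeral_2_eq_2)
    have ordH: "ordlt (Suc 2) H"
      unfolding H_def using ordlt_diff[OF ordlt_L ordlt_3_mul] by (simp only: numeral_3_eq_3 numeral_2_eq_2)
    have "(ad e1 ^^ 2) H \<noteq> 0" unfolding H2 mul_eq_0_iff by simp
    note * = ev_principal_symbol_eq[OF LL ordH this, unfolded H2 mul_eq_iff]
    show "ev v (principal_symbol LL) = rconst (bil v v)" for v
      using *[of v] by (simp del: rconst_simps add: fact_2)
    have "(ad e1 ^^ 2) (ang pot) \<noteq> 0"
      unfolding ad_ang mul_eq_0_iff by (simp add: vec_eq_iff forall_2)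
    note * = ev_principal_symbol_eq[OF PM _ this, unfolded ad_ang mul_eq_iff]
    show "ev v (principal_symbol PM) = (lin (perp v))\<^sup>2" for v
      using *[of v] ordlt_ang by (simp del: rconst_simps add: fact_2)
    define hh where "hh v = (\<Prod>\<beta>\<in>S. bil v \<beta>) ^ (2 * kap)" for v
    \<comment> \<open>One factorial comes from \<open>ad_funpow_Q\<close>, the other from the N-th
      derivative of \<open>g\<close>; one of them cancels against that in
      \<open>ev_principal_symbol_eq\<close>.\<close>
    have NQ: "(ad v ^^ N) (Q \<omega>) = mul (rconst (2 ^ N * fact N * (fact N * hh v)))" for v
    proof -
      have "(der v ^^ N) g = rconst (fact N * hh v)"
        unfolding g_def N_def hh_def by (rule der_funpow_prod_lin[OF finite_S])
      moreover have "(of_nat (2 ^ N * fact N) :: ratfun) = rconst (2 ^ N * fact N)"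
        using rconst_of_nat[of "2 ^ N * fact N"] by (simp del: rconst_of_nat)
      ultimately show ?thesis unfolding ad_funpow_Q by (simp only: rconst_simps(6))
    qed
    \<comment> \<open>This isotropic vector pairs to a nonzero number with all members of
      \<open>S\<close> at once, which certifies that \<open>Q\<close> has order exactly
      \<open>N\<close>.\<close>
    define u :: plane where "u = (\<chi> m. if m = 1 then 1 else \<i>)"
    have "bil u \<beta> \<noteq> 0" if "\<beta> \<in> S" for \<beta>
      using nonisotropic_factor[OF nonisotropic_S[OF that]] by (simp add: u_def bil_eq)
    then have "hh u \<noteq> 0" using finite_S by (simp add: hh_def)
    then have "(ad u ^^ N) (Q \<omega>) \<noteq> 0" unfolding NQ mul_eq_0_iff by simp
    note * = ev_principal_symbol_eq[OF PQ ordlt_Q this, unfolded NQ mul_eq_iff]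
    show "ev v (principal_symbol PQ) = rconst ((2 ^ N * fact N) * (\<Prod>\<beta>\<in>S. bil v \<beta>) ^ (2 * kap))" for v
    proof -
      have "rconst (fact N) * ev v (principal_symbol PQ) = rconst (fact N) * rconst (2 ^ N * fact N * hh v)"
        unfolding *[of v] rconst_simps(6)[symmetric] by (rule arg_cong[of _ _ rconst]) simp
      then show ?thesis by (simp add: hh_def del: rconst_simps)
    qed
    show "(2 ^ N * fact N :: complex) \<noteq> 0" by simp
    show "2 * kap > 0" by (simp add: kap_def)
  qed (use finite_S S_nonempty nonisotropic_S in auto)
  ultimately show ?thesis
    unfolding superintegrable_def LL_def by blast
qed

end

theorem proposition8p3:
  fixes W :: "(plane \<Rightarrow> plane) set" and R Ap :: "plane set"
    and k :: "plane \<Rightarrow> complex" and \<omega> :: complex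
  assumes "reflection_group W" and "root_system W R"
    and "locus_configuration W R Ap k"
  shows "superintegrable (calogero_moser Ap k \<omega>)"
proof -
  interpret locus W R Ap k using assms by unfold_locales
  show ?thesis by (rule superintegrable)
qed

end
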